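(* Let $p\ge 2$, $K\ge 1$, $T$ be integers with $p+K<T$, and let $\mathbf{X}_t=\mathbf{B}\mathbf{f}_t+\mathbf{u}_t$, $t=1,\dots,T$, be the factor model described in the context, with $\mathbf{f}_t$ and $\mathbf{u}_t$ independent and normally distributed. Let $1\le j<i\le p$, let $d_{ij}=\omega_{ij}$, and let $$T_{ij}=(T-K-p+1)\frac{g_{ij}^2}{1-g_{ij}^2},\qquad g_{ij}=\frac{v_{ij}}{\sqrt{v_{ii}v_{jj}}}.$$ Then: (a) The density of $T_{ij}$ is given, for $x>0$, by $$F_{T_{ij}}(x)=F_{1,T-K-p+1}(x)\,(1+\lambda_{ij})^{-(T-K-p+2)/2}\;{}_2F_1\Big(\tfrac{T-K-p+2}{2},\tfrac{T-K-p+2}{2},\tfrac12;\ \tfrac{x}{T-K-p+1+x}\,\tfrac{\lambda_{ij}}{1+\lambda_{ij}}\Big),$$ where $\lambda_{ij}=d_{ij}^2/\{\omega_{jj}(\omega_{ii}-d_{ij}^2/\omega_{jj})\}$. (b) If $\omega_{ij}=0$ (hypothesis $H_{0,ij}$), then $T_{ij}\sim\mathcal{F}_{1,T-K-p+1}$.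
   Context: Model: $\mathbf{B}$ is a deterministic $p\times K$ matrix; $\mathbf{f}_1,\dots,\mathbf{f}_T$ are i.i.d. $K$-dimensional normal vectors with mean zero and positive definite covariance matrix; $\mathbf{u}_1,\dots,\mathbf{u}_T$ are i.i.d. $p$-dimensional normal vectors with mean zero and positive definite covariance matrix $\boldsymbol{\Sigma}_u$ (not assumed diagonal); the sequences $(\mathbf{f}_t)$ and $(\mathbf{u}_t)$ are independent. Put $\mathbf{Y}_t=(\mathbf{X}_t^\top,\mathbf{f}_t^\top)^\top\in\mathbb{R}^{p+K}$ and $\boldsymbol{\Omega}=\{\mathrm{cov}(\mathbf{Y}_t)\}^{-1}=(\omega_{ij})_{1\le i,j\le p+K}$. Let $\mathbf{Y}=(\mathbf{Y}_1,\dots,\mathbf{Y}_T)$, $\mathbf{S}=\frac1T\mathbf{Y}\mathbf{Y}^\top$ and $\mathbf{V}=(T\mathbf{S})^{-1}=(v_{ij})_{1\le i,j\le p+K}$. Notation: $\mathcal{F}_{a,b}$ is the (central) $\mathcal F$-distribution with $a$ and $b$ degrees of freedom and $F_{a,b}$ is its density; ${}_2F_1(a,b,c;x)=\frac{\Gamma(c)}{\Gamma(a)\Gamma(b)}\sum_{k=0}^\infty\frac{\Gamma(a+k)\Gamma(b+k)}{\Gamma(c+k)}\frac{x^k}{k!}$ is the hypergeometric function. *)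

theory Defs
  imports "HOL-Probability.Probability"
begin

definition pos_def_matrix :: "real^'n^'n \<Rightarrow> bool" where
  "pos_def_matrix A \<longleftrightarrow> transpose A = A \<and> (\<forall>x. x \<noteq> 0 \<longrightarrow> 0 < x \<bullet> (A *v x))"

definition mvn_density :: "real^'n \<Rightarrow> real^'n^'n \<Rightarrow> real^'n \<Rightarrow> real" where
  "mvn_density \<mu> \<Sigma> x =
     exp (- ((x - \<mu>) \<bullet> (matrix_inv \<Sigma> *v (x - \<mu>))) / 2) / sqrt ((2 * pi) ^ CARD('n) * det \<Sigma>)"

(* The multivariate normal law is given by its Lebesgue density; hence the covariance
   parameter is required to be positive definite, and degenerate laws are excluded. *)
definition normal_vector :: "'a measure \<Rightarrow> real^'n \<Rightarrow> real^'n^'n \<Rightarrow> ('a \<Rightarrow> real^'n) \<Rightarrow> bool" where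
  "normal_vector M \<mu> \<Sigma> Z \<longleftrightarrow>
     pos_def_matrix \<Sigma> \<and> distributed M lborel Z (\<lambda>x. ennreal (mvn_density \<mu> \<Sigma> x))"

definition cov_matrix :: "'a measure \<Rightarrow> ('a \<Rightarrow> real^'n) \<Rightarrow> real^'n^'n" where
  "cov_matrix M Z =
     (\<chi> i j. \<integral>w. (Z w $ i - (\<integral>v. Z v $ i \<partial>M)) * (Z w $ j - (\<integral>v. Z v $ j \<partial>M)) \<partial>M)"

(* The concatenation of x and y: coordinates of x carry indices Inl i, those of y
   indices Inr k, so that the index type 'p + 'k has p + K elements. *)
definition stack :: "real^'p \<Rightarrow> real^'k \<Rightarrow> real^('p + 'k)" where
  "stack x y = (\<chi> s. case s of Inl i \<Rightarrow> x $ i | Inr k \<Rightarrow> y $ k)"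

definition matrix_of_columns :: "('t \<Rightarrow> real^'n) \<Rightarrow> real^'t^'n" where
  "matrix_of_columns y = (\<chi> s t. y t $ s)"

definition F_density :: "real \<Rightarrow> real \<Rightarrow> real \<Rightarrow> real" where
  "F_density a b x =
     (if x > 0
      then (a / b) powr (a / 2) * x powr (a / 2 - 1) * (1 + a * x / b) powr (- (a + b) / 2)
             / Beta (a / 2) (b / 2)
      else 0)"

definition F_distribution :: "real \<Rightarrow> real \<Rightarrow> real measure" where
  "F_distribution a b = density lborel (\<lambda>x. ennreal (F_density a b x))"

definition hypergeom_2F1 :: "real \<Rightarrow> real \<Rightarrow> real \<Rightarrow> real \<Rightarrow> real" where
  "hypergeom_2F1 a b c x =
     Gamma c / (Gamma a * Gamma b) *
     (\<Sum>k. Gamma (a + real k) * Gamma (b + real k) / Gamma (c + real k) * (x ^ k / fact k))"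

end

theory Submission
  imports Defs
begin

text \<open>
  Write \<open>n = p + K\<close> and \<open>N = T - n + 2\<close>. The statistic depends on the data only through
  \<open>g\<^sup>2 / (1 - g\<^sup>2) = v\<^sub>i\<^sub>j\<^sup>2 / (v\<^sub>i\<^sub>i v\<^sub>j\<^sub>j - v\<^sub>i\<^sub>j\<^sup>2)\<close>, where \<open>V\<close> is the inverse of the Gram matrix of the
  \<open>n\<close> rows of the data matrix, regarded as vectors of \<open>\<real>\<^sup>T\<close>.

  \<^emph>\<open>Reduction to independent standard normal entries.\<close> Whitening \<open>f\<^sub>t\<close> and \<open>u\<^sub>t\<close> shows that
  \<open>Y\<^sub>t = C\<^sub>0 Z\<^sub>t\<close> with an invertible matrix \<open>C\<^sub>0\<close>, where all entries of the vectors \<open>Z\<^sub>t\<close> are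
  independent standard normal variables; hence \<open>\<Omega> = (C\<^sub>0 C\<^sub>0\<^sup>T)\<inverse>\<close>. By rotation invariance \<open>C\<^sub>0\<close> may be
  replaced by any \<open>C\<close> with \<open>C\<^sup>T \<Omega> C = 1\<close>. In \<open>pos_def_triangular_factor\<close> such a \<open>C\<close> is chosen for which the
  columns \<open>i\<close> and \<open>j\<close> of \<open>C\<inverse>\<close> are \<open>\<delta> e\<^sub>i\<close> and \<open>\<kappa> e\<^sub>j + \<mu> e\<^sub>i\<close>. If \<open>U\<close> is the inverse of the Gram matrix of the
  independent Gaussian rows \<open>z\<^sub>s\<close>, then \<open>v\<^sub>i\<^sub>j\<^sup>2 / (v\<^sub>i\<^sub>i v\<^sub>j\<^sub>j - v\<^sub>i\<^sub>j\<^sup>2)\<close> becomes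
  \<open>(\<tau> u\<^sub>i\<^sub>i + u\<^sub>i\<^sub>j)\<^sup>2 / (u\<^sub>i\<^sub>i u\<^sub>j\<^sub>j - u\<^sub>i\<^sub>j\<^sup>2)\<close> with \<open>\<tau> = \<mu> / \<kappa>\<close>, and \<open>\<tau>\<^sup>2 = \<lambda>\<^sub>i\<^sub>j\<close>
  (\<open>inverse_correlation_statistic_congruence\<close>).

  \<^emph>\<open>Geometry.\<close> Let \<open>P\<close> be the projection of \<open>\<real>\<^sup>T\<close> onto the orthogonal complement of the rows other than
  \<open>z\<^sub>i\<close> and \<open>z\<^sub>j\<close>, of rank \<open>N\<close>, let \<open>s = |P z\<^sub>j|\<close> and \<open>e = P z\<^sub>j / s\<close>, and let \<open>Q\<close> be the projection, of rank \<open>N - 1\<close>,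
  that in addition removes \<open>e\<close>. Then the ratio equals \<open>(\<tau> s - z\<^sub>i \<bullet> e)\<^sup>2 / |Q z\<^sub>i|\<^sup>2\<close>
  (\<open>inverse_gram_entries_orthonormal\<close>). Conditionally on all rows but \<open>z\<^sub>i\<close>, the variables \<open>z\<^sub>i \<bullet> e\<close> and
  \<open>|Q z\<^sub>i|\<^sup>2 / 2\<close> are independent, with a standard normal and a \<open>Gamma((N - 1)/2)\<close> law; conditionally on the rows
  other than \<open>z\<^sub>i\<close> and \<open>z\<^sub>j\<close>, the law of \<open>s\<^sup>2 / 2\<close> is \<open>Gamma(N/2)\<close>. All these laws are free of the rows conditioned on
  (\<open>nn_integral_gram_inverse_ratio\<close>).

  \<^emph>\<open>Computation.\<close> For fixed \<open>s\<close> the square \<open>(\<tau> s - z)\<^sup>2 / 2\<close> of a shifted standard normal variable is, by the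
  power series of \<open>cosh\<close>, a Poisson mixture with mean \<open>\<tau>\<^sup>2 s\<^sup>2 / 2\<close> of \<open>Gamma(k + 1/2)\<close> laws. Integrating out \<open>s\<close>
  turns the Poisson weights into negative binomial ones, and dividing by the independent \<open>Gamma((N - 1)/2)\<close>
  variable turns the Gamma laws into beta prime laws (\<open>nn_integral_noncentral_ratio\<close>). After rescaling by
  \<open>N - 1\<close>, the resulting series of densities is the stated product of an \<open>F\<close> density and a hypergeometric function
  (\<open>noncentral_ratio_density_eq\<close>); for \<open>\<lambda>\<^sub>i\<^sub>j = 0\<close> only its first term remains, which is the central \<open>F\<close>
  density.
\<close>

section \<open>Orthonormal systems\<close>

lemma symmetric_matrix_inner_commute:
  fixes S :: "real^'n^'n"
  assumes "transpose S = S"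
  shows "x \<bullet> (S *v y) = y \<bullet> (S *v x)"
  by (metis assms dot_lmul_matrix inner_commute transpose_matrix_vector)

text \<open>
  Gram-Schmidt for the inner product \<open>x \<bullet> (S *v y)\<close>: a partial orthonormal family, indexed by a subset of
  the coordinates, extends to a full one. The case of an empty family gives whitening matrices, the case
  \<open>S = mat 1\<close> completes orthonormal systems, and the case of two prescribed vectors gives triangular factors.
\<close>

lemma orthonormal_wrt_extend:
  fixes S :: "real^'n^'n" and x :: "'n \<Rightarrow> real^'n"
  assumes S: "pos_def_matrix S"
    and x: "\<And>k l. k \<in> I \<Longrightarrow> l \<in> I \<Longrightarrow> x k \<bullet> (S *v x l) = of_bool (k = l)"
  obtains y where "\<And>k. k \<in> I \<Longrightarrow> y k = x k" "\<And>k l. y k \<bullet> (S *v y l) = of_bool (k = l)"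
proof -
  have sym: "transpose S = S" and pos: "\<And>v. v \<noteq> 0 \<Longrightarrow> 0 < v \<bullet> (S *v v)"
    using S by (auto simp: pos_def_matrix_def)
  have "\<exists>y. (\<forall>k\<in>I. y k = x k) \<and> (\<forall>k\<in>I \<union> J. \<forall>l\<in>I \<union> J. y k \<bullet> (S *v y l) = of_bool (k = l))"
    if "finite J" for J :: "'n set"
    using that
  proof (induction J rule: finite_induct)
    case empty
    show ?case using x by auto
  next
    case (insert a J)
    then obtain y where y: "\<forall>k\<in>I. y k = x k"
      "\<forall>k\<in>I \<union> J. \<forall>l\<in>I \<union> J. y k \<bullet> (S *v y l) = of_bool (k = l)" by blast
    show ?case
    proof (cases "a \<in> I \<union> J")
      case True
      then show ?thesis using y by (intro exI[of _ y]) (auto simp: insert_absorb)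
    next
      case False
      \<comment> \<open>Fewer vectors than the dimension: some nonzero vector is orthogonal to all \<open>S *v y k\<close>.\<close>
      let ?R = "(\<lambda>k. S *v y k) ` (I \<union> J)"
      have "dim ?R \<le> card ?R" by (rule dim_le_card) (auto intro: span_base)
      also have "\<dots> \<le> card (I \<union> J)" by (rule card_image_le) auto
      also have "\<dots> < CARD('n)"
        using False by (metis UNIV_I finite psubset_card_mono psubsetI subset_UNIV)
      finally obtain v where v: "v \<noteq> 0" "\<And>z. z \<in> span ?R \<Longrightarrow> orthogonal v z"
        using orthogonal_to_subspace_exists[of ?R] by auto
      have vR: "v \<bullet> (S *v y k) = 0" if "k \<in> I \<union> J" for k
        using v(2)[of "S *v y k"] that by (auto simp: orthogonal_def intro: span_base)
      define w where "w = (1 / sqrt (v \<bullet> (S *v v))) *\<^sub>R v"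
      have ww: "w \<bullet> (S *v w) = 1"
        using pos[OF v(1)] by (simp add: w_def matrix_vector_mult_scaleR field_simps)
      have wR: "w \<bullet> (S *v y k) = 0" "y k \<bullet> (S *v w) = 0" if "k \<in> I \<union> J" for k
        using vR[OF that] symmetric_matrix_inner_commute[OF sym, of "y k" v]
        by (simp_all add: w_def matrix_vector_mult_scaleR)
      show ?thesis
        using y False ww wR by (intro exI[of _ "y(a := w)"]) auto
    qed
  qed
  from this[of UNIV] obtain y where "\<forall>k\<in>I. y k = x k" "\<forall>k l. y k \<bullet> (S *v y l) = of_bool (k = l)"
    by auto
  then show thesis using that by blast
qed

lemma matrix_of_columns_congruence:
  fixes S :: "real^'n^'n" and y :: "'m::finite \<Rightarrow> real^'n"
  shows "(transpose (matrix_of_columns y) ** S ** matrix_of_columns y) $ k $ l = y k \<bullet> (S *v y l)"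
proof -
  have "(transpose (matrix_of_columns y) ** S ** matrix_of_columns y) $ k $ l
      = (transpose (matrix_of_columns y) ** (S ** matrix_of_columns y)) $ k $ l"
    by (simp add: matrix_mul_assoc)
  also have "\<dots> = y k \<bullet> (S *v y l)"
    by (simp add: matrix_matrix_mult_def transpose_def matrix_of_columns_def inner_vec_def matrix_vector_mult_def)
  finally show ?thesis .
qed

lemma pos_def_whitening:
  fixes S :: "real^'n^'n"
  assumes "pos_def_matrix S"
  obtains W :: "real^'n^'n" where "transpose W ** S ** W = mat 1"
proof -
  obtain y :: "'n \<Rightarrow> real^'n" where y: "\<And>k l. y k \<bullet> (S *v y l) = of_bool (k = l)"
    using orthonormal_wrt_extend[OF assms, of "{}" "\<lambda>_. 0"] by auto
  have "transpose (matrix_of_columns y) ** S ** matrix_of_columns y = mat 1"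
    unfolding vec_eq_iff matrix_of_columns_congruence y by (simp add: mat_def)
  then show thesis by (rule that)
qed

text \<open>
  The vectors \<open>v k\<close> with \<open>k \<in> I\<close> form an orthonormal system; \<open>v\<close> is arbitrary outside \<open>I\<close>.
\<close>

definition orthonormal_on :: "'n set \<Rightarrow> ('n \<Rightarrow> 'a::real_inner) \<Rightarrow> bool" where
  "orthonormal_on I v \<longleftrightarrow> (\<forall>k\<in>I. \<forall>l\<in>I. v k \<bullet> v l = of_bool (k = l))"

lemma pos_def_mat_1: "pos_def_matrix (mat 1 :: real^'n^'n)"
  by (simp add: pos_def_matrix_def)

lemma orthonormal_on_extend:
  fixes x :: "'n \<Rightarrow> real^'n"
  assumes "orthonormal_on I x"
  obtains y where "\<And>k. k \<in> I \<Longrightarrow> y k = x k" "orthonormal_on UNIV y"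
  using orthonormal_wrt_extend[OF pos_def_mat_1, of I x] assms
  unfolding orthonormal_on_def by (metis UNIV_I matrix_vector_mul_lid)

lemma orthonormal_matrix_of_columns:
  fixes y :: "'n \<Rightarrow> real^'n"
  assumes "orthonormal_on UNIV y"
  shows "orthogonal_matrix (matrix_of_columns y)"
proof -
  have "transpose (matrix_of_columns y) ** mat 1 ** matrix_of_columns y = mat 1"
    unfolding vec_eq_iff matrix_of_columns_congruence
    using assms by (simp add: orthonormal_on_def) (simp add: mat_def)
  then show ?thesis by (simp add: orthogonal_matrix)
qed

lemma orthonormal_expansion:
  fixes y :: "'n \<Rightarrow> real^'n"
  assumes "orthonormal_on UNIV y"
  shows "(\<Sum>k\<in>UNIV. (x \<bullet> y k) *\<^sub>R y k) = x"
proof -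
  let ?M = "matrix_of_columns y"
  have "?M ** transpose ?M = mat 1"
    using orthonormal_matrix_of_columns[OF assms] by (simp add: orthogonal_matrix_def)
  then have "?M *v (transpose ?M *v x) = x"
    by (simp add: matrix_vector_mul_assoc del: transpose_matrix_vector)
  moreover have "transpose ?M *v x = (\<chi> k. x \<bullet> y k)"
    by (simp add: vec_eq_iff matrix_vector_mult_def transpose_def matrix_of_columns_def inner_vec_def mult.commute)
  moreover have "?M *v (\<chi> k. x \<bullet> y k) = (\<Sum>k\<in>UNIV. (x \<bullet> y k) *\<^sub>R y k)"
    by (simp add: vec_eq_iff matrix_vector_mult_def matrix_of_columns_def mult.commute)
  ultimately show ?thesis by simp
qed

lemma orthonormal_family_of_subspace:
  fixes S :: "(real^'n) set" and I :: "'n set"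
  assumes S: "subspace S" and dim: "dim S = card I"
  obtains v where "orthonormal_on I v" "span (v ` I) = S"
proof -
  obtain B where B: "B \<subseteq> S" "pairwise orthogonal B" "\<And>x. x \<in> B \<Longrightarrow> norm x = 1"
     "independent B" "card B = dim S" "span B = S"
    using orthonormal_basis_subspace[OF S] by blast
  have "finite B" using B(4) by (rule independent_imp_finite)
  then obtain v where v: "bij_betw v I B"
    using finite_same_card_bij[of I B] B(5) dim by auto
  have im: "v ` I = B" using v by (simp add: bij_betw_def)
  have "orthonormal_on I v"
    unfolding orthonormal_on_def
  proof (intro ballI)
    fix k l assume kl: "k \<in> I" "l \<in> I"
    show "v k \<bullet> v l = of_bool (k = l)"
    proof (cases "k = l")
      case True
      then show ?thesis using B(3)[of "v k"] kl im by (auto simp: norm_eq_1)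
    next
      case False
      then have "v k \<noteq> v l" using v kl by (auto simp: bij_betw_def inj_on_def)
      then show ?thesis
        using B(2) kl im False by (auto simp: pairwise_def orthogonal_def)
    qed
  qed
  with im B(6) show thesis by (intro that[of v]) auto
qed

section \<open>Inverse Gram matrices\<close>

text \<open>
  Linear independence of a family of vectors, so that repeated vectors count as dependent.
\<close>

definition lin_indep_family :: "'i set \<Rightarrow> ('i \<Rightarrow> 'v::real_vector) \<Rightarrow> bool" where
  "lin_indep_family I z \<longleftrightarrow> (\<forall>c. (\<Sum>i\<in>I. c i *\<^sub>R z i) = 0 \<longrightarrow> (\<forall>i\<in>I. c i = 0))"

text \<open>
  The Gram matrix of a family of vectors indexed by the coordinate type \<open>'n\<close>.
\<close>

definition gram :: "('n \<Rightarrow> 'v::real_inner) \<Rightarrow> real^'n^'n" where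
  "gram z = (\<chi> a b. z a \<bullet> z b)"

lemma gram_mult_vec:
  fixes z :: "'n::finite \<Rightarrow> 'v::real_inner"
  shows "(gram z *v c) $ a = z a \<bullet> (\<Sum>b\<in>UNIV. c $ b *\<^sub>R z b)"
  by (simp add: gram_def matrix_vector_mult_def inner_sum_right mult.commute)

lemma matrix_inv_mult:
  fixes A :: "real^'n^'n"
  assumes "invertible A"
  shows "A ** matrix_inv A = mat 1" "matrix_inv A ** A = mat 1"
  using someI_ex[OF assms[unfolded invertible_def]] by (auto simp: matrix_inv_def)

lemma matrix_inv_eqI:
  fixes A :: "real^'n^'n"
  assumes "A ** B = mat 1"
  shows "matrix_inv A = B"
proof -
  have BA: "B ** A = mat 1" using assms by (simp add: matrix_left_right_inverse)
  with assms have "invertible A" by (auto simp: invertible_def)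
  then have "B = B ** (A ** matrix_inv A)" by (simp add: matrix_inv_mult)
  also have "\<dots> = matrix_inv A" by (simp add: matrix_mul_assoc BA)
  finally show ?thesis by simp
qed

lemma invertible_gram:
  fixes z :: "'n::finite \<Rightarrow> 'v::real_inner"
  assumes "lin_indep_family UNIV z"
  shows "invertible (gram z)"
proof -
  have "c = 0" if "gram z *v c = 0" for c
  proof -
    let ?s = "\<Sum>b\<in>UNIV. c $ b *\<^sub>R z b"
    have "z a \<bullet> ?s = 0" for a using that by (simp flip: gram_mult_vec)
    then have "?s \<bullet> ?s = 0" by (simp add: inner_sum_left)
    then have "?s = 0" by simp
    with assms show ?thesis by (auto simp: lin_indep_family_def vec_eq_iff)
  qed
  then show ?thesis
    using matrix_left_invertible_ker[of "gram z"] invertible_left_inverse by blast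
qed

lemma span_family_representation:
  assumes "finite I" "x \<in> span (z ` I)"
  obtains c where "x = (\<Sum>i\<in>I. c i *\<^sub>R z i)"
proof -
  have "\<exists>c. x = (\<Sum>i\<in>I. c i *\<^sub>R z i)"
    using assms(2)
  proof (induction rule: span_induct_alt)
    case base
    show ?case by (intro exI[of _ "\<lambda>_. 0"]) simp
  next
    case (step r y x)
    then obtain i c where i: "i \<in> I" "y = z i" and c: "x = (\<Sum>i\<in>I. c i *\<^sub>R z i)" by auto
    have "(\<Sum>k\<in>I. of_bool (k = i) *\<^sub>R (r *\<^sub>R z k)) = (\<Sum>k\<in>I. if k = i then r *\<^sub>R z k else 0)"
      by (rule sum.cong) auto
    also have "\<dots> = r *\<^sub>R z i"
      using i assms(1) by (simp add: sum.delta)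
    finally show ?case
      unfolding c i
      by (intro exI[of _ "\<lambda>k. of_bool (k = i) * r + c k"])
         (simp add: scaleR_add_left sum.distrib)
  qed
  then show thesis using that by blast
qed

text \<open>
  The entries of the inverse Gram matrix are the inner products of the dual basis; only the second
  dual vector has to lie in the span of the family.
\<close>

lemma inverse_gram_entry:
  fixes z :: "'n::finite \<Rightarrow> 'v::real_inner"
  assumes inv: "invertible (gram z)"
    and a: "\<And>b. a \<bullet> z b = of_bool (b = i)"
    and a': "a' \<in> span (range z)" "\<And>b. a' \<bullet> z b = of_bool (b = j)"
  shows "matrix_inv (gram z) $ i $ j = a \<bullet> a'"
proof -
  obtain c where c: "a' = (\<Sum>b\<in>UNIV. c b *\<^sub>R z b)"
    using span_family_representation[OF finite a'(1)] .
  have "gram z *v (\<chi> b. c b) = axis j 1"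
    using a'(2) by (simp add: vec_eq_iff gram_mult_vec axis_def inner_commute flip: c)
  then have "matrix_inv (gram z) *v (gram z *v (\<chi> b. c b)) = matrix_inv (gram z) *v axis j 1"
    by simp
  then have "(\<chi> b. c b) = matrix_inv (gram z) *v axis j 1"
    by (simp add: matrix_vector_mul_assoc matrix_inv_mult[OF inv])
  then have "matrix_inv (gram z) $ i $ j = c i"
    by (metis column_def matrix_vector_mult_basis vec_lambda_beta)
  also have "\<dots> = a \<bullet> a'"
    by (simp add: c inner_sum_right a)
  finally show ?thesis .
qed

text \<open>
  The vectors \<open>q k\<close> with \<open>k \<in> I\<close> span the same space as the family without \<open>z i\<close> and \<open>z j\<close>, \<open>s\<close> is the component of
  \<open>z j\<close> along \<open>q k0\<close>, and \<open>R\<close> is the squared norm of the part of \<open>z i\<close> orthogonal to all other vectors.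
  The dual vectors of \<open>z i\<close> and \<open>z j\<close> can then be written down.
\<close>

lemma inverse_gram_entries_orthonormal:
  fixes z :: "'n::finite \<Rightarrow> real^'t" and q :: "'t \<Rightarrow> real^'t" and s :: real
  assumes indep: "lin_indep_family UNIV z" and ij: "i \<noteq> j"
    and q: "orthonormal_on UNIV q" and k0: "k0 \<notin> I"
    and spanI: "span (q ` I) = span (z ` (UNIV - {i, j}))"
    and zj: "z j - s *\<^sub>R q k0 \<in> span (q ` I)" and s: "s \<noteq> 0"
  defines "U \<equiv> matrix_inv (gram z)"
    and "R \<equiv> \<Sum>k\<in>UNIV - insert k0 I. (z i \<bullet> q k)\<^sup>2"
  shows "R > 0" "U $ i $ i = 1 / R"
    "U $ i $ i * U $ j $ j - U $ i $ j * U $ i $ j = 1 / (R * s\<^sup>2)"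
    "U $ i $ j = - (z i \<bullet> q k0) / (s * R)"
proof -
  define J where "J = UNIV - insert k0 I"
  define \<alpha> where "\<alpha> = z i \<bullet> q k0"
  define r where "r = (\<Sum>k\<in>J. (z i \<bullet> q k) *\<^sub>R q k)"
  have qq: "q k \<bullet> q l = of_bool (k = l)" for k l using q by (simp add: orthonormal_on_def)
  have qI: "q k \<bullet> x = 0" if "k \<notin> I" "x \<in> span (q ` I)" for k x
  proof -
    from that(2) obtain c where "x = (\<Sum>i\<in>I. c i *\<^sub>R q i)"
      by (rule span_family_representation[OF finite])
    then show ?thesis using that(1) by (auto simp: inner_sum_right qq intro!: sum.neutral)
  qed
  have zW: "z w \<in> span (q ` I)" if "w \<noteq> i" "w \<noteq> j" for w
    unfolding spanI using that by (intro span_base) auto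
  have sub: "span (q ` I) \<subseteq> span (range z)"
    unfolding spanI by (rule span_mono) auto
  have zr: "z k \<in> span (range z)" for k by (rule span_base) auto
  have kj: "q k \<bullet> z j = of_bool (k = k0) * s" if "k \<notin> I" for k
  proof -
    have "q k \<bullet> (z j - s *\<^sub>R q k0) = 0" using qI[OF that zj] .
    then show ?thesis by (simp add: inner_diff_right qq split: if_splits)
  qed
  have kw: "q k \<bullet> z w = 0" if "k \<notin> I" "w \<noteq> i" "w \<noteq> j" for k w
    using qI[OF that(1) zW] that by simp
  have rz: "r \<bullet> z b = of_bool (b = i) * R" for b
  proof -
    have "r \<bullet> z b = (\<Sum>k\<in>J. (z i \<bullet> q k) * (q k \<bullet> z b))" by (simp add: r_def inner_sum_left)
    also have "\<dots> = of_bool (b = i) * R"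
    proof (cases "b = i")
      case True
      then show ?thesis by (simp add: R_def J_def power2_eq_square inner_commute)
    next
      case False
      then show ?thesis using kw kj by (cases "b = j") (auto simp: J_def intro!: sum.neutral)
    qed
    finally show ?thesis .
  qed
  have rr: "r \<bullet> r = R" "q k0 \<bullet> r = 0"
    by (simp_all add: r_def R_def inner_sum_left inner_sum_right qq J_def power2_eq_square
        sum.delta of_bool_def if_distrib cong: if_cong)
  have q0z: "q k0 \<bullet> z b = (if b = i then \<alpha> else if b = j then s else 0)" for b
    using kw[OF k0] kj[OF k0] by (auto simp: \<alpha>_def inner_commute)
  have q0s: "q k0 \<in> span (range z)"
  proof -
    have "s *\<^sub>R q k0 = z j - (z j - s *\<^sub>R q k0)" by simp
    also have "\<dots> \<in> span (range z)" by (rule span_diff[OF zr subsetD[OF sub zj]])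
    finally have "(1/s) *\<^sub>R (s *\<^sub>R q k0) \<in> span (range z)" by (rule span_scale)
    then show ?thesis using s by simp
  qed
  have zi: "z i = (\<Sum>k\<in>I. (z i \<bullet> q k) *\<^sub>R q k) + \<alpha> *\<^sub>R q k0 + r"
  proof -
    have "z i = (\<Sum>k\<in>UNIV. (z i \<bullet> q k) *\<^sub>R q k)"
      using orthonormal_expansion[OF q] by simp
    also have "(UNIV :: 't set) = I \<union> {k0} \<union> J" by (auto simp: J_def)
    also have "(\<Sum>k\<in>\<dots>. (z i \<bullet> q k) *\<^sub>R q k) = (\<Sum>k\<in>I. (z i \<bullet> q k) *\<^sub>R q k) + \<alpha> *\<^sub>R q k0 + r"
      using k0 by (subst sum.union_disjoint; (auto simp: J_def r_def \<alpha>_def)?)+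
    finally show ?thesis .
  qed
  have cI: "(\<Sum>k\<in>I. c k *\<^sub>R q k) \<in> span (q ` I)" for c
    by (intro span_sum span_scale span_base) auto
  have rs: "r \<in> span (range z)"
  proof -
    have "r = z i - (\<Sum>k\<in>I. (z i \<bullet> q k) *\<^sub>R q k) - \<alpha> *\<^sub>R q k0" by (subst zi) simp
    also have "\<dots> \<in> span (range z)" using cI sub zr q0s by (intro span_diff span_scale) auto
    finally show ?thesis .
  qed
  have R0: "R \<ge> 0" unfolding R_def by (intro sum_nonneg) auto
  have "R \<noteq> 0"
  proof
    assume "R = 0"
    then have "r = 0" using rr(1) by simp
    \<comment> \<open>If \<open>r = 0\<close>, then \<open>z i\<close> is a combination of the other rows.\<close>
    define w where "w = (\<Sum>k\<in>I. (z i \<bullet> q k) *\<^sub>R q k) - (\<alpha>/s) *\<^sub>R (z j - s *\<^sub>R q k0)"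
    have "w \<in> span (z ` (UNIV - {i,j}))"
      unfolding w_def using cI zj spanI by (auto intro: span_diff span_scale)
    then obtain c where c: "w = (\<Sum>b\<in>UNIV - {i,j}. c b *\<^sub>R z b)"
      using span_family_representation[OF finite] by blast
    have "z i = w + (\<alpha>/s) *\<^sub>R z j"
      using zi s \<open>r = 0\<close> by (simp add: w_def algebra_simps)
    then have zi': "z i = (\<Sum>b\<in>UNIV - {i,j}. c b *\<^sub>R z b) + (\<alpha>/s) *\<^sub>R z j" using c by simp
    define c' where "c' b = (if b = i then -1 else if b = j then \<alpha>/s else c b)" for b
    have "(\<Sum>b\<in>UNIV. c' b *\<^sub>R z b) = (\<Sum>b\<in>insert i (insert j (UNIV - {i,j})). c' b *\<^sub>R z b)"
      by (rule sum.cong) auto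
    also have "\<dots> = - z i + ((\<alpha>/s) *\<^sub>R z j + (\<Sum>b\<in>UNIV - {i,j}. c' b *\<^sub>R z b))"
      using ij by (simp add: c'_def)
    also have "(\<Sum>b\<in>UNIV - {i,j}. c' b *\<^sub>R z b) = (\<Sum>b\<in>UNIV - {i,j}. c b *\<^sub>R z b)"
      by (rule sum.cong) (auto simp: c'_def)
    finally have "(\<Sum>b\<in>UNIV. c' b *\<^sub>R z b) = 0" using zi' by simp
    then have "c' i = 0" using indep by (auto simp: lin_indep_family_def)
    then show False by (simp add: c'_def)
  qed
  with R0 show R: "R > 0" by simp
  \<comment> \<open>The dual vectors of \<open>z i\<close> and \<open>z j\<close>.\<close>
  define a where "a = (1/R) *\<^sub>R r"
  define b where "b = (1/s) *\<^sub>R q k0 - (\<alpha>/(s*R)) *\<^sub>R r"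
  have a: "a \<in> span (range z)" "\<And>w. a \<bullet> z w = of_bool (w = i)"
    using rs R by (auto simp: a_def rz intro: span_scale)
  have b: "b \<in> span (range z)" "\<And>w. b \<bullet> z w = of_bool (w = j)"
    using rs q0s R s ij by (auto simp: b_def rz q0z inner_diff_left intro: span_scale span_diff)
  note inv = invertible_gram[OF indep]
  show Uii: "U $ i $ i = 1 / R"
    unfolding U_def inverse_gram_entry[OF inv a(2) a] using rr R by (simp add: a_def)
  show Uij: "U $ i $ j = - (z i \<bullet> q k0) / (s * R)"
    unfolding U_def inverse_gram_entry[OF inv a(2) b] using rr R
    by (simp add: a_def b_def inner_diff_right inner_commute \<alpha>_def)
  have Ujj: "U $ j $ j = 1 / s\<^sup>2 + \<alpha>\<^sup>2 / (s\<^sup>2 * R)"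
    unfolding U_def inverse_gram_entry[OF inv b(2) b] using rr R s
    by (simp add: b_def inner_diff_right inner_diff_left inner_commute qq power2_eq_square field_simps)
  show "U $ i $ i * U $ j $ j - U $ i $ j * U $ i $ j = 1 / (R * s\<^sup>2)"
    unfolding Uii Uij Ujj using s R by (simp add: \<alpha>_def field_simps power2_eq_square)
qed

section \<open>Gamma and beta prime laws\<close>

text \<open>
  The density of the Gamma law with shape \<open>a\<close> and scale \<open>1\<close>.
\<close>

definition gamma_density :: "real \<Rightarrow> real \<Rightarrow> real" where
  "gamma_density a x = (if x > 0 then x powr (a - 1) * exp (- x) / Gamma a else 0)"

lemma borel_measurable_gamma_density [measurable]: "gamma_density a \<in> borel_measurable borel"
  unfolding gamma_density_def by measurable

lemma gamma_density_nonneg: "a > 0 \<Longrightarrow> 0 \<le> gamma_density a x"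
  using Gamma_real_pos[of a] by (auto simp: gamma_density_def)

lemma nn_integral_Gamma_scaled:
  assumes a: "a > 0" and c: "c > (0::real)"
  shows "(\<integral>\<^sup>+x. ennreal (x powr (a - 1) * exp (- c * x)) * indicator {0<..} x \<partial>lborel)
       = ennreal (Gamma a / c powr a)"
proof -
  let ?f = "\<lambda>x. ennreal (x powr (a - 1) * exp (- c * x)) * indicator {0<..} x"
  have "(\<integral>\<^sup>+x. ?f x \<partial>lborel) = ennreal \<bar>1/c\<bar> * (\<integral>\<^sup>+x. ?f (0 + 1/c * x) \<partial>lborel)"
    using c by (intro nn_integral_real_affine) auto
  also have "(\<integral>\<^sup>+x. ?f (0 + 1/c * x) \<partial>lborel)
      = (\<integral>\<^sup>+x. ennreal (1 / c powr (a - 1)) * ennreal (indicator {0..} x * x powr (a - 1) / exp x) \<partial>lborel)"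
  proof (intro nn_integral_cong)
    fix x :: real
    show "?f (0 + 1/c * x) = ennreal (1 / c powr (a - 1)) * ennreal (indicator {0..} x * x powr (a - 1) / exp x)"
      using c by (auto simp: indicator_def powr_divide exp_minus field_simps zero_less_divide_iff
          simp flip: ennreal_mult)
  qed
  also have "\<dots> = ennreal (1 / c powr (a - 1)) * ennreal (Gamma a)"
    by (subst nn_integral_cmult) (auto simp: Gamma_conv_nn_integral_real[OF a])
  also have "ennreal \<bar>1/c\<bar> * \<dots> = ennreal (Gamma a / c powr a)"
    using c a Gamma_real_pos[of a]
    by (simp add: powr_diff field_simps flip: ennreal_mult)
  finally show ?thesis .
qed

lemma nn_integral_gamma_density:
  assumes a: "a > 0"
  shows "(\<integral>\<^sup>+x. ennreal (gamma_density a x) \<partial>lborel) = 1"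
proof -
  have "(\<integral>\<^sup>+x. ennreal (gamma_density a x) \<partial>lborel)
     = (\<integral>\<^sup>+x. ennreal (1 / Gamma a) * (ennreal (x powr (a - 1) * exp (- 1 * x)) * indicator {0<..} x) \<partial>lborel)"
    using Gamma_real_pos[of a] a
    by (intro nn_integral_cong) (auto simp: gamma_density_def indicator_def simp flip: ennreal_mult)
  also have "\<dots> = ennreal (1 / Gamma a) * ennreal (Gamma a / 1 powr a)"
    using a by (subst nn_integral_cmult, simp, subst nn_integral_Gamma_scaled) auto
  also have "\<dots> = 1"
  proof -
    have "Gamma a > 0" using a by (rule Gamma_real_pos)
    then show ?thesis by (simp flip: ennreal_mult)
  qed
  finally show ?thesis .
qed

text \<open>
  The sum of independent Gamma variables with shapes \<open>a\<close> and \<open>b\<close> has a Gamma law with shape \<open>a + b\<close>.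
\<close>

lemma nn_integral_gamma_convolution:
  fixes h :: "real \<Rightarrow> ennreal"
  assumes a: "a > 0" and b: "b > 0" and [measurable]: "h \<in> borel_measurable borel"
  shows "(\<integral>\<^sup>+y. (\<integral>\<^sup>+x. h (x + y) * ennreal (gamma_density a x) \<partial>lborel) * ennreal (gamma_density b y) \<partial>lborel)
       = (\<integral>\<^sup>+s. h s * ennreal (gamma_density (a + b) s) \<partial>lborel)"
proof -
  let ?g = "gamma_density"
  define Q where "Q s = (\<integral>\<^sup>+y. ennreal (?g a (s - y)) * ennreal (?g b y) \<partial>lborel)" for s
  have [measurable]: "Q \<in> borel_measurable borel" unfolding Q_def by measurable
  have main: "(\<integral>\<^sup>+y. (\<integral>\<^sup>+x. h (x + y) * ennreal (?g a x) \<partial>lborel) * ennreal (?g b y) \<partial>lborel)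
     = (\<integral>\<^sup>+s. h s * Q s \<partial>lborel)" if [measurable]: "h \<in> borel_measurable borel" for h :: "real \<Rightarrow> ennreal"
  proof -
    have "(\<integral>\<^sup>+x. h (x + y) * ennreal (?g a x) \<partial>lborel) = (\<integral>\<^sup>+s. h s * ennreal (?g a (s - y)) \<partial>lborel)" for y
      by (subst nn_integral_real_affine[where c = 1 and t = "- y"]) simp_all
    then have "(\<integral>\<^sup>+y. (\<integral>\<^sup>+x. h (x + y) * ennreal (?g a x) \<partial>lborel) * ennreal (?g b y) \<partial>lborel)
       = (\<integral>\<^sup>+y. (\<integral>\<^sup>+s. h s * ennreal (?g a (s - y)) * ennreal (?g b y) \<partial>lborel) \<partial>lborel)"
      by (simp add: nn_integral_multc)
    also have "\<dots> = (\<integral>\<^sup>+s. (\<integral>\<^sup>+y. h s * ennreal (?g a (s - y)) * ennreal (?g b y) \<partial>lborel) \<partial>lborel)"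
      by (rule lborel_pair.Fubini') simp
    also have "\<dots> = (\<integral>\<^sup>+s. h s * Q s \<partial>lborel)"
      unfolding Q_def by (simp add: nn_integral_cmult mult.assoc)
    finally show ?thesis .
  qed
  \<comment> \<open>The convolution is a multiple of the Gamma density; the constant is \<open>1\<close> by comparing total masses.\<close>
  define C where "C = (\<integral>\<^sup>+y. ennreal ((1 - y) powr (a - 1) * y powr (b - 1)) * indicator {0<..<1} y \<partial>lborel)
      * ennreal (Gamma (a + b) / (Gamma a * Gamma b))"
  have Ga: "Gamma a > 0" "Gamma b > 0" "Gamma (a + b) > 0" using a b by (auto intro!: Gamma_real_pos)
  have QC: "Q s = C * ennreal (?g (a + b) s)" for s
  proof (cases "s > 0")
    case True
    have "Q s = ennreal \<bar>s\<bar> * (\<integral>\<^sup>+y. ennreal (?g a (s - (0 + s * y))) * ennreal (?g b (0 + s * y)) \<partial>lborel)"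
      unfolding Q_def using True by (intro nn_integral_real_affine) auto
    also have "\<dots> = (\<integral>\<^sup>+y. ennreal s * (ennreal (?g a (s - (0 + s * y))) * ennreal (?g b (0 + s * y))) \<partial>lborel)"
      using True by (subst nn_integral_cmult) auto
    also have "\<dots> = (\<integral>\<^sup>+y. ennreal ((1 - y) powr (a - 1) * y powr (b - 1)) * indicator {0<..<1} y
        * ennreal (Gamma (a + b) / (Gamma a * Gamma b) * ?g (a + b) s) \<partial>lborel)"
    proof (intro nn_integral_cong)
      fix y :: real
      have *: "s - s * y = s * (1 - y)" by (simp add: algebra_simps)
      have pos: "s * y < s \<longleftrightarrow> y < 1" "0 < s * y \<longleftrightarrow> 0 < y"
        using True by (auto simp: zero_less_mult_iff)
      show "ennreal s * (ennreal (?g a (s - (0 + s * y))) * ennreal (?g b (0 + s * y)))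
         = ennreal ((1 - y) powr (a - 1) * y powr (b - 1)) * indicator {0<..<1} y
        * ennreal (Gamma (a + b) / (Gamma a * Gamma b) * ?g (a + b) s)"
      proof (cases "0 < y \<and> y < 1")
        case y: True
        have "s * (?g a (s - s * y) * ?g b (s * y))
           = s * ((s * (1 - y)) powr (a - 1) * (s * y) powr (b - 1) * (exp (- (s - s * y)) * exp (- (s * y))))
              / (Gamma a * Gamma b)"
          using y True Ga by (simp add: gamma_density_def pos *)
        also have "exp (- (s - s * y)) * exp (- (s * y)) = exp (- s)"
          by (simp flip: exp_add)
        also have "(s * (1 - y)) powr (a - 1) = s powr (a - 1) * (1 - y) powr (a - 1)"
          using y True by (simp add: powr_mult)
        also have "(s * y) powr (b - 1) = s powr (b - 1) * y powr (b - 1)"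
          using y True by (simp add: powr_mult)
        also have "s * (s powr (a - 1) * (1 - y) powr (a - 1) * (s powr (b - 1) * y powr (b - 1)) * exp (- s))
            = (1 - y) powr (a - 1) * y powr (b - 1) * (s powr 1 * s powr (a - 1) * s powr (b - 1) * exp (- s))"
          using True by (simp add: mult_ac)
        also have "s powr 1 * s powr (a - 1) * s powr (b - 1) = s powr (a + b - 1)"
          by (simp only: powr_add[symmetric]) (simp add: algebra_simps)
        also have "(1 - y) powr (a - 1) * y powr (b - 1) * (s powr (a + b - 1) * exp (- s)) / (Gamma a * Gamma b)
            = (1 - y) powr (a - 1) * y powr (b - 1) * (Gamma (a + b) / (Gamma a * Gamma b) * ?g (a + b) s)"
          using True Ga by (simp add: gamma_density_def)
        finally show ?thesis
          using y True Ga a b by (simp add: gamma_density_nonneg flip: ennreal_mult)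
      next
        case False
        then show ?thesis by (auto simp: gamma_density_def pos)
      qed
    qed
    also have "\<dots> = C * ennreal (?g (a + b) s)"
    proof -
      have "ennreal (Gamma (a + b) / (Gamma a * Gamma b) * ?g (a + b) s)
          = ennreal (Gamma (a + b) / (Gamma a * Gamma b)) * ennreal (?g (a + b) s)"
        using a b Ga by (intro ennreal_mult) (auto simp: gamma_density_nonneg)
      then show ?thesis unfolding C_def by (subst nn_integral_multc) (auto simp: mult.assoc)
    qed
    finally show ?thesis .
  next
    case False
    then have "(\<lambda>y. ennreal (?g a (s - y)) * ennreal (?g b y)) = (\<lambda>_. 0)"
      by (auto simp: gamma_density_def)
    then have "Q s = 0" unfolding Q_def by simp
    then show ?thesis using False by (simp add: gamma_density_def)
  qed
  have "1 = (\<integral>\<^sup>+y. (\<integral>\<^sup>+x. 1 * ennreal (?g a x) \<partial>lborel) * ennreal (?g b y) \<partial>lborel)"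
    using a b by (simp add: nn_integral_gamma_density)
  also have "\<dots> = (\<integral>\<^sup>+s. 1 * Q s \<partial>lborel)"
    by (rule main) simp
  also have "\<dots> = C"
    using a b by (simp add: QC nn_integral_cmult nn_integral_gamma_density)
  finally have "C = 1" by simp
  then show ?thesis using main[OF assms(3)] by (simp add: QC)
qed

text \<open>
  The substitution \<open>w = y\<^sup>2 / 2\<close> on the half line. The value of \<open>1 / sqrt (2 * w)\<close> at \<open>w = 0\<close> is irrelevant.
\<close>

lemma nn_integral_half_square_substitution_pos:
  fixes F :: "real \<Rightarrow> ennreal"
  assumes [measurable]: "F \<in> borel_measurable borel"
  shows "(\<integral>\<^sup>+y. F y * indicator {0..} y \<partial>lborel)
       = (\<integral>\<^sup>+w. F (sqrt (2 * w)) * ennreal (1 / sqrt (2 * w)) * indicator {0..} w \<partial>lborel)"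
proof -
  define f where "f w = F (sqrt (2 * w)) * ennreal (1 / sqrt (2 * w))" for w
  have [measurable]: "f \<in> borel_measurable borel" unfolding f_def by measurable
  have *: "(\<integral>\<^sup>+w. f w * indicator {0..(real (Suc n))\<^sup>2 / 2} w \<partial>lborel)
     = (\<integral>\<^sup>+y. F y * indicator {0..real (Suc n)} y \<partial>lborel)" for n
  proof -
    have "(\<integral>\<^sup>+w. f w * indicator {0\<^sup>2/2..(real (Suc n))\<^sup>2 / 2} w \<partial>lborel)
      = (\<integral>\<^sup>+y. f (y\<^sup>2 / 2) * ennreal y * indicator {0..real (Suc n)} y \<partial>lborel)"
      by (rule nn_integral_substitution_aux[where g = "\<lambda>y. y\<^sup>2 / 2"])
         (auto intro!: derivative_eq_intros continuous_intros)
    also have "\<dots> = (\<integral>\<^sup>+y. F y * indicator {0..real (Suc n)} y \<partial>lborel)"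
    proof (intro nn_integral_cong_AE AE_I[of _ _ "{0}"] subsetI; (simp; fail)?)
      fix y assume "y \<in> {x \<in> space lborel. f (x\<^sup>2 / 2) * ennreal x * indicator {0..real (Suc n)} x
         \<noteq> F x * indicator {0..real (Suc n)} x}"
      then have y: "y \<ge> 0" "f (y\<^sup>2 / 2) * ennreal y \<noteq> F y" by (auto split: split_indicator_asm)
      show "y \<in> {0}"
      proof (rule ccontr)
        assume "y \<notin> {0}"
        with y have "y > 0" by auto
        then have "f (y\<^sup>2 / 2) * ennreal y = F y * (ennreal (1/y) * ennreal y)"
          by (simp add: f_def mult.assoc)
        also have "\<dots> = F y" using \<open>y > 0\<close> by (simp flip: ennreal_mult)
        finally show False using y by simp
      qed
    qed
    finally show ?thesis by simp
  qed
  have "(\<lambda>n. \<integral>\<^sup>+w. f w * indicator {0..(real (Suc n))\<^sup>2 / 2} w \<partial>lborel) \<longlonglongrightarrow> (\<integral>\<^sup>+w. f w * indicator {0..} w \<partial>lborel)"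
  proof (intro nn_integral_LIMSEQ)
    show "incseq (\<lambda>n w. f w * indicator {0..(real (Suc n))\<^sup>2 / 2} w)"
      by (intro incseq_SucI le_funI mult_left_mono)
         (auto split: split_indicator intro: order_trans simp: field_simps power2_eq_square)
    fix w :: real
    obtain N where N: "real N \<ge> 2 * w" using real_arch_simple by blast
    have "w \<le> (real (Suc n))\<^sup>2 / 2" if "n \<ge> N" for n
    proof -
      have "2 * w \<le> real (Suc n) * 1" using N that by simp
      also have "\<dots> \<le> real (Suc n) * real (Suc n)" by (intro mult_left_mono) auto
      finally show ?thesis by (simp add: power2_eq_square)
    qed
    then show "(\<lambda>n. f w * indicator {0..(real (Suc n))\<^sup>2 / 2} w) \<longlonglongrightarrow> f w * indicator {0..} w"
      by (intro tendsto_eventually eventually_sequentiallyI[of N]) (auto split: split_indicator)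
  qed auto
  moreover have "(\<lambda>n. \<integral>\<^sup>+y. F y * indicator {0..real (Suc n)} y \<partial>lborel) \<longlonglongrightarrow> (\<integral>\<^sup>+y. F y * indicator {0..} y \<partial>lborel)"
  proof (intro nn_integral_LIMSEQ)
    show "incseq (\<lambda>n w. F w * indicator {0..real (Suc n)} w)"
      by (intro incseq_SucI le_funI mult_left_mono) (auto split: split_indicator)
    fix w :: real
    obtain N where N: "real N \<ge> w" using real_arch_simple by blast
    then show "(\<lambda>n. F w * indicator {0..real (Suc n)} w) \<longlonglongrightarrow> F w * indicator {0..} w"
      by (intro tendsto_eventually eventually_sequentiallyI[of N]) (auto split: split_indicator)
  qed auto
  ultimately have "(\<integral>\<^sup>+w. f w * indicator {0..} w \<partial>lborel) = (\<integral>\<^sup>+y. F y * indicator {0..} y \<partial>lborel)"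
    unfolding * by (rule LIMSEQ_unique)
  then show ?thesis by (simp add: f_def)
qed

lemma nn_integral_half_square_substitution:
  fixes F :: "real \<Rightarrow> ennreal"
  assumes [measurable]: "F \<in> borel_measurable borel"
  shows "(\<integral>\<^sup>+y. F y \<partial>lborel)
       = (\<integral>\<^sup>+w. (F (sqrt (2 * w)) + F (- sqrt (2 * w))) * ennreal (1 / sqrt (2 * w)) * indicator {0..} w \<partial>lborel)"
proof -
  have "(\<integral>\<^sup>+y. F y \<partial>lborel) = (\<integral>\<^sup>+y. F y * indicator {0..} y + F y * indicator {..0} y \<partial>lborel)"
    by (intro nn_integral_cong_AE AE_I[of _ _ "{0}"]) (auto split: split_indicator_asm)
  also have "\<dots> = (\<integral>\<^sup>+y. F y * indicator {0..} y \<partial>lborel) + (\<integral>\<^sup>+y. F y * indicator {..0} y \<partial>lborel)"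
    by (rule nn_integral_add) auto
  also have "(\<integral>\<^sup>+y. F y * indicator {..0} y \<partial>lborel) = (\<integral>\<^sup>+y. F (- y) * indicator {0..} y \<partial>lborel)"
    by (subst nn_integral_real_affine[where c = "-1" and t = 0]) (auto intro!: nn_integral_cong split: split_indicator)
  also have "(\<integral>\<^sup>+y. F y * indicator {0..} y \<partial>lborel) + \<dots> =
     (\<integral>\<^sup>+y. F y * indicator {0..} y + F (- y) * indicator {0..} y \<partial>lborel)"
    by (rule nn_integral_add[symmetric]) auto
  also have "\<dots> = (\<integral>\<^sup>+y. (F y + F (- y)) * indicator {0..} y \<partial>lborel)"
    by (simp add: distrib_right)
  also have "\<dots> = (\<integral>\<^sup>+w. (F (sqrt (2 * w)) + F (- sqrt (2 * w))) * ennreal (1 / sqrt (2 * w)) * indicator {0..} w \<partial>lborel)"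
    by (rule nn_integral_half_square_substitution_pos) auto
  finally show ?thesis .
qed

text \<open>
  If \<open>x\<close> is a standard normal variable, then \<open>x\<^sup>2 / 2\<close> has a Gamma law with shape \<open>1/2\<close>.
\<close>

lemma nn_integral_std_normal_half_square:
  fixes h :: "real \<Rightarrow> ennreal"
  assumes [measurable]: "h \<in> borel_measurable borel"
  shows "(\<integral>\<^sup>+x. h (x\<^sup>2 / 2) * ennreal (std_normal_density x) \<partial>lborel)
       = (\<integral>\<^sup>+w. h w * ennreal (gamma_density (1/2) w) \<partial>lborel)"
proof -
  have "(\<integral>\<^sup>+x. h (x\<^sup>2 / 2) * ennreal (std_normal_density x) \<partial>lborel)
     = (\<integral>\<^sup>+w. (h ((sqrt (2 * w))\<^sup>2 / 2) * ennreal (std_normal_density (sqrt (2 * w)))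
          + h ((- sqrt (2 * w))\<^sup>2 / 2) * ennreal (std_normal_density (- sqrt (2 * w))))
          * ennreal (1 / sqrt (2 * w)) * indicator {0..} w \<partial>lborel)"
    by (rule nn_integral_half_square_substitution) measurable
  also have "\<dots> = (\<integral>\<^sup>+w. h w * ennreal (gamma_density (1/2) w) \<partial>lborel)"
  proof (intro nn_integral_cong)
    fix w :: real
    show "(h ((sqrt (2 * w))\<^sup>2 / 2) * ennreal (std_normal_density (sqrt (2 * w)))
          + h ((- sqrt (2 * w))\<^sup>2 / 2) * ennreal (std_normal_density (- sqrt (2 * w))))
          * ennreal (1 / sqrt (2 * w)) * indicator {0..} w = h w * ennreal (gamma_density (1/2) w)"
    proof (cases "w > 0")
      case True
      have sn: "std_normal_density (- x) = std_normal_density x" for x by (simp add: std_normal_density_def)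
      have "2 * std_normal_density (sqrt (2 * w)) * (1 / sqrt (2 * w)) = gamma_density (1/2) w"
        using True
        by (simp add: std_normal_density_def gamma_density_def Gamma_one_half_real real_sqrt_mult
            powr_minus powr_half_sqrt field_simps)
      then have "ennreal (gamma_density (1/2) w)
          = (ennreal (std_normal_density (sqrt (2 * w))) + ennreal (std_normal_density (sqrt (2 * w))))
             * ennreal (1 / sqrt (2 * w))"
        using True by (subst ennreal_plus[symmetric], simp, simp, subst ennreal_mult[symmetric]) auto
      then show ?thesis
        using True unfolding sn by (simp add: mult.assoc flip: distrib_left)
    qed (auto simp: gamma_density_def indicator_def)
  qed
  finally show ?thesis .
qed

text \<open>
  The standard normal law on the line.
\<close>

definition std_normal :: "real measure" where
  "std_normal = density lborel (\<lambda>x. ennreal (std_normal_density x))"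

lemma prob_space_std_normal: "prob_space std_normal"
  unfolding std_normal_def by (rule prob_space_normal_density) simp

lemma sets_std_normal [measurable_cong]: "sets std_normal = sets borel"
  by (simp add: std_normal_def)

lemma nn_integral_std_normal:
  assumes [measurable]: "h \<in> borel_measurable borel"
  shows "(\<integral>\<^sup>+x. h x \<partial>std_normal) = (\<integral>\<^sup>+x. h x * ennreal (std_normal_density x) \<partial>lborel)"
  unfolding std_normal_def by (subst nn_integral_density) (auto simp: mult.commute)

lemma product_sigma_finite_std_normal: "product_sigma_finite (\<lambda>_. std_normal)"
  by (rule product_sigma_finite.intro)
     (metis prob_space_std_normal prob_space.axioms(1) finite_measure.axioms(1))

text \<open>
  Half of a chi-squared variable with \<open>card J\<close> degrees of freedom has a Gamma law with shape \<open>card J / 2\<close>.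
\<close>

lemma nn_integral_sum_squares_std_normal:
  fixes h :: "real \<Rightarrow> ennreal" and J :: "'i set"
  assumes "finite J" "J \<noteq> {}" and "h \<in> borel_measurable borel"
  shows "(\<integral>\<^sup>+x. h ((\<Sum>k\<in>J. (x k)\<^sup>2) / 2) \<partial>PiM J (\<lambda>_. std_normal))
       = (\<integral>\<^sup>+w. h w * ennreal (gamma_density (real (card J) / 2) w) \<partial>lborel)"
  using assms
proof (induction J arbitrary: h rule: finite_ne_induct)
  case (singleton k)
  interpret product_sigma_finite "\<lambda>_. std_normal" by (rule product_sigma_finite_std_normal)
  note [measurable] = singleton
  have "(\<integral>\<^sup>+x. h ((\<Sum>k\<in>{k}. (x k)\<^sup>2) / 2) \<partial>PiM {k} (\<lambda>_. std_normal)) = (\<integral>\<^sup>+y. h (y\<^sup>2 / 2) \<partial>std_normal)"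
    by (simp add: product_nn_integral_singleton[of "\<lambda>y. h (y\<^sup>2 / 2)" k])
  also have "\<dots> = (\<integral>\<^sup>+w. h w * ennreal (gamma_density (1 / 2) w) \<partial>lborel)"
    by (simp add: nn_integral_std_normal nn_integral_std_normal_half_square)
  finally show ?case by simp
next
  case (insert k J)
  interpret product_sigma_finite "\<lambda>_. std_normal" by (rule product_sigma_finite_std_normal)
  note [measurable] = insert.prems
  have c: "card J > 0" using insert by (simp add: card_gt_0_iff)
  have "(\<integral>\<^sup>+x. h ((\<Sum>k\<in>insert k J. (x k)\<^sup>2) / 2) \<partial>PiM (insert k J) (\<lambda>_. std_normal))
     = (\<integral>\<^sup>+x. (\<integral>\<^sup>+y. h ((\<Sum>l\<in>insert k J. ((x(k := y)) l)\<^sup>2) / 2) \<partial>std_normal) \<partial>PiM J (\<lambda>_. std_normal))"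
    using insert by (intro product_nn_integral_insert) auto
  also have "\<dots> = (\<integral>\<^sup>+x. (\<integral>\<^sup>+y. h (y\<^sup>2 / 2 + (\<Sum>l\<in>J. (x l)\<^sup>2) / 2) \<partial>std_normal) \<partial>PiM J (\<lambda>_. std_normal))"
  proof (intro nn_integral_cong)
    fix x :: "'i \<Rightarrow> real" and y :: real
    have "(\<Sum>l\<in>J. ((x(k := y)) l)\<^sup>2) = (\<Sum>l\<in>J. (x l)\<^sup>2)"
      using insert by (intro sum.cong) auto
    then show "h ((\<Sum>l\<in>insert k J. ((x(k := y)) l)\<^sup>2) / 2) = h (y\<^sup>2 / 2 + (\<Sum>l\<in>J. (x l)\<^sup>2) / 2)"
      using insert by (simp add: add_divide_distrib)
  qed
  also have "\<dots> = (\<integral>\<^sup>+x. (\<integral>\<^sup>+w. h (w + (\<Sum>l\<in>J. (x l)\<^sup>2) / 2) * ennreal (gamma_density (1/2) w) \<partial>lborel) \<partial>PiM J (\<lambda>_. std_normal))"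
    by (simp add: nn_integral_std_normal nn_integral_std_normal_half_square[of "\<lambda>w. h (w + _)"])
  also have "\<dots> = (\<integral>\<^sup>+v. (\<integral>\<^sup>+w. h (w + v) * ennreal (gamma_density (1/2) w) \<partial>lborel)
      * ennreal (gamma_density (real (card J) / 2) v) \<partial>lborel)"
    by (rule insert.IH) measurable
  also have "\<dots> = (\<integral>\<^sup>+w. h w * ennreal (gamma_density (1/2 + real (card J) / 2) w) \<partial>lborel)"
    using c by (intro nn_integral_gamma_convolution) auto
  also have "1/2 + real (card J) / 2 = real (card (insert k J)) / 2"
    using insert by (simp add: add_divide_distrib)
  finally show ?case .
qed

text \<open>
  The density of the beta prime law, the law of the quotient of two independent Gamma variables.
\<close>

definition beta_prime_density :: "real \<Rightarrow> real \<Rightarrow> real \<Rightarrow> real" where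
  "beta_prime_density a b y = (if y > 0 then y powr (a - 1) * (1 + y) powr (- (a + b)) / Beta a b else 0)"

lemma borel_measurable_beta_prime_density [measurable]: "beta_prime_density a b \<in> borel_measurable borel"
  unfolding beta_prime_density_def by measurable

lemma nn_integral_gamma_ratio:
  fixes h :: "real \<Rightarrow> ennreal"
  assumes a: "a > 0" and b: "b > 0" and [measurable]: "h \<in> borel_measurable borel"
  shows "(\<integral>\<^sup>+v. (\<integral>\<^sup>+w. h (w / v) * ennreal (gamma_density a w) \<partial>lborel) * ennreal (gamma_density b v) \<partial>lborel)
       = (\<integral>\<^sup>+y. h y * ennreal (beta_prime_density a b y) \<partial>lborel)"
proof -
  have Ga: "Gamma a > 0" "Gamma b > 0" "Gamma (a + b) > 0" using a b by (auto intro!: Gamma_real_pos)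
  let ?k = "\<lambda>y v. ennreal (v * gamma_density a (v * y) * gamma_density b v)"
  have "(\<integral>\<^sup>+w. h (w / v) * ennreal (gamma_density a w) \<partial>lborel) * ennreal (gamma_density b v)
      = (\<integral>\<^sup>+y. h y * ?k y v \<partial>lborel)" for v
  proof (cases "v > 0")
    case True
    have "(\<integral>\<^sup>+w. h (w / v) * ennreal (gamma_density a w) \<partial>lborel)
        = ennreal \<bar>v\<bar> * (\<integral>\<^sup>+y. h ((0 + v * y) / v) * ennreal (gamma_density a (0 + v * y)) \<partial>lborel)"
      using True by (intro nn_integral_real_affine) auto
    also have "\<dots> * ennreal (gamma_density b v)
       = (\<integral>\<^sup>+y. ennreal v * (h y * ennreal (gamma_density a (v * y))) * ennreal (gamma_density b v) \<partial>lborel)"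
      using True by (simp add: nn_integral_cmult nn_integral_multc)
    also have "\<dots> = (\<integral>\<^sup>+y. h y * ?k y v \<partial>lborel)"
      using True a b by (intro nn_integral_cong) (simp add: ennreal_mult gamma_density_nonneg mult_ac)
    finally show ?thesis .
  qed (auto simp: gamma_density_def)
  then have "(\<integral>\<^sup>+v. (\<integral>\<^sup>+w. h (w / v) * ennreal (gamma_density a w) \<partial>lborel) * ennreal (gamma_density b v) \<partial>lborel)
     = (\<integral>\<^sup>+v. (\<integral>\<^sup>+y. h y * ?k y v \<partial>lborel) \<partial>lborel)"
    by simp
  also have "\<dots> = (\<integral>\<^sup>+y. (\<integral>\<^sup>+v. h y * ?k y v \<partial>lborel) \<partial>lborel)"
    by (rule lborel_pair.Fubini') measurable
  also have "\<dots> = (\<integral>\<^sup>+y. h y * ennreal (beta_prime_density a b y) \<partial>lborel)"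
  proof (intro nn_integral_cong)
    fix y :: real
    have "(\<integral>\<^sup>+v. ?k y v \<partial>lborel) = ennreal (beta_prime_density a b y)"
    proof (cases "y > 0")
      case True
      define C where "C = y powr (a - 1) / (Gamma a * Gamma b)"
      have C: "C \<ge> 0" using Ga by (simp add: C_def)
      have "(\<integral>\<^sup>+v. ?k y v \<partial>lborel)
         = (\<integral>\<^sup>+v. ennreal C * (ennreal (v powr (a + b - 1) * exp (- (1 + y) * v)) * indicator {0<..} v) \<partial>lborel)"
      proof (intro nn_integral_cong)
        fix v :: real
        show "?k y v = ennreal C * (ennreal (v powr (a + b - 1) * exp (- (1 + y) * v)) * indicator {0<..} v)"
        proof (cases "v > 0")
          case v: True
          have "v * gamma_density a (v * y) * gamma_density b v
             = C * ((v powr 1 * v powr (a - 1) * v powr (b - 1)) * (exp (- (v * y)) * exp (- v)))"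
            using v True by (simp add: gamma_density_def C_def powr_mult mult_ac)
          also have "v powr 1 * v powr (a - 1) * v powr (b - 1) = v powr (a + b - 1)"
            by (simp only: powr_add[symmetric]) (simp add: algebra_simps)
          also have "exp (- (v * y)) * exp (- v) = exp (- (1 + y) * v)"
            by (simp add: algebra_simps flip: exp_add)
          finally show ?thesis using v C by (simp flip: ennreal_mult)
        qed (auto simp: gamma_density_def)
      qed
      also have "\<dots> = ennreal C * ennreal (Gamma (a + b) / (1 + y) powr (a + b))"
        using True a b by (subst nn_integral_cmult, simp, subst nn_integral_Gamma_scaled) auto
      also have "\<dots> = ennreal (C * (Gamma (a + b) / (1 + y) powr (a + b)))"
        using True C Ga by (intro ennreal_mult[symmetric]) auto
      also have "C * (Gamma (a + b) / (1 + y) powr (a + b)) = beta_prime_density a b y"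
        unfolding C_def beta_prime_density_def Beta_def powr_minus using True Ga by (simp add: field_simps)
      finally show ?thesis .
    next
      case False
      then have "?k y v = 0" for v
        by (cases "v > 0") (auto simp: gamma_density_def zero_less_mult_iff)
      then show ?thesis using False by (simp add: beta_prime_density_def)
    qed
    then show "(\<integral>\<^sup>+v. h y * ?k y v \<partial>lborel) = h y * ennreal (beta_prime_density a b y)"
      by (simp add: nn_integral_cmult)
  qed
  finally show ?thesis .
qed

section \<open>The quotient of a noncentral square and a Gamma variable\<close>

lemma Gamma_half_integer: "Gamma (real k + 1/2) = fact (2 * k) * sqrt pi / (4 ^ k * fact k)"
proof (induction k)
  case 0
  show ?case by (simp add: Gamma_one_half_real)
next
  case (Suc k)
  have "Gamma (real (Suc k) + 1/2) = Gamma ((real k + 1/2) + 1)" by (simp add: algebra_simps)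
  also have "\<dots> = (real k + 1/2) * Gamma (real k + 1/2)"
    using nonpos_Ints_nonpos[of "real k + 1/2"] by (intro Gamma_plus1) auto
  also have "\<dots> = fact (2 * Suc k) * sqrt pi / (4 ^ Suc k * fact (Suc k))"
  proof -
    define m where "m = real k + 1"
    have f2: "(fact (2 * Suc k) :: real) = 4 * m * (real k + 1/2) * fact (2 * k)"
      by (simp add: m_def algebra_simps)
    have f1: "(fact (Suc k) :: real) = m * fact k" and m: "m \<noteq> 0"
      by (simp_all add: m_def)
    show ?thesis unfolding Suc.IH f1 f2 using m by simp
  qed
  finally show ?case .
qed

lemma cosh_sums_even: "(\<lambda>k. x ^ (2 * k) / fact (2 * k)) sums cosh (x::real)"
proof -
  have "(\<lambda>n. if even n then x ^ n /\<^sub>R fact n else 0) sums cosh x"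
    by (rule cosh_converges)
  moreover have "strict_mono (\<lambda>k::nat. 2 * k)" by (auto simp: strict_mono_def)
  moreover have "n \<notin> range (\<lambda>k::nat. 2 * k) \<Longrightarrow> (if even n then x ^ n /\<^sub>R fact n else 0) = 0" for n
    by (auto elim!: evenE)
  ultimately have "(\<lambda>k. if even (2 * k) then x ^ (2 * k) /\<^sub>R fact (2 * k) else 0) sums cosh x"
    using sums_mono_reindex[where g = "\<lambda>k::nat. 2 * k" and f = "\<lambda>n. if even n then x ^ n /\<^sub>R fact n else 0"]
    by blast
  then show ?thesis by (simp add: divide_real_def mult.commute)
qed

text \<open>
  The right-hand side is the density at \<open>w\<close> of half the square of a normal variable with mean \<open>\<tau> * sqrt (2 * r)\<close>
  and variance \<open>1\<close>. It is a Poisson mixture, with mean \<open>\<tau>\<^sup>2 * r\<close>, of Gamma densities: the two normal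
  densities add up to a multiple of \<open>cosh\<close>, whose power series is rewritten by the values of the Gamma function at
  half-integers.
\<close>

lemma noncentral_square_density:
  fixes r w \<tau> :: real
  assumes r: "r \<ge> 0" and w: "w > 0"
  shows "(\<lambda>k. gamma_density (real k + 1/2) w * (exp (- (\<tau>\<^sup>2 * r)) * (\<tau>\<^sup>2 * r) ^ k / fact k)) sums
    ((std_normal_density (\<tau> * sqrt (2 * r) - sqrt (2 * w)) + std_normal_density (\<tau> * sqrt (2 * r) + sqrt (2 * w)))
      / sqrt (2 * w))"
proof -
  define x y where "x = \<tau> * sqrt (2 * r)" and "y = sqrt (2 * w)"
  have xy: "x\<^sup>2 = 2 * (\<tau>\<^sup>2 * r)" "y\<^sup>2 = 2 * w" "y > 0" using r w by (auto simp: x_def y_def power_mult_distrib)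
  have e: "exp (- (x - y)\<^sup>2 / 2) = exp (- (\<tau>\<^sup>2 * r)) * exp (- w) * exp (x * y)"
          "exp (- (x + y)\<^sup>2 / 2) = exp (- (\<tau>\<^sup>2 * r)) * exp (- w) * exp (- (x * y))"
    using xy(1,2) by (simp_all add: power2_diff power2_sum field_simps flip: exp_add)
  define c where "c = 2 / sqrt (2 * pi) * (exp (- (\<tau>\<^sup>2 * r)) * exp (- w)) / y"
  have "(std_normal_density (x - y) + std_normal_density (x + y)) / y = c * cosh (x * y)"
  proof -
    define E where "E = exp (- (\<tau>\<^sup>2 * r)) * exp (- w)"
    have "exp (x * y) + exp (- (x * y)) = 2 * cosh (x * y)" by (simp add: cosh_def)
    moreover have "std_normal_density (x - y) + std_normal_density (x + y)
        = 1 / sqrt (2 * pi) * E * (exp (x * y) + exp (- (x * y)))"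
      unfolding std_normal_density_def e E_def by (simp only: distrib_left mult.assoc)
    ultimately show ?thesis unfolding c_def E_def[symmetric] by simp
  qed
  moreover have "(\<lambda>k. c * ((x * y) ^ (2 * k) / fact (2 * k))) sums (c * cosh (x * y))"
    by (intro sums_mult cosh_sums_even)
  moreover have "c * ((x * y) ^ (2 * k) / fact (2 * k))
     = gamma_density (real k + 1/2) w * (exp (- (\<tau>\<^sup>2 * r)) * (\<tau>\<^sup>2 * r) ^ k / fact k)" for k
  proof -
    have "(x * y) ^ (2 * k) = (x\<^sup>2 * y\<^sup>2) ^ k" by (simp add: power_mult power_mult_distrib)
    also have "x\<^sup>2 * y\<^sup>2 = 4 * (\<tau>\<^sup>2 * r) * w" unfolding xy by simp
    also have "(4 * (\<tau>\<^sup>2 * r) * w) ^ k = 4 ^ k * (\<tau>\<^sup>2 * r) ^ k * w ^ k" by (simp add: power_mult_distrib)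
    finally have 1: "(x * y) ^ (2 * k) = 4 ^ k * (\<tau>\<^sup>2 * r) ^ k * w ^ k" .
    have "w powr (real k + 1/2 - 1) = w powr real k * w powr (- (1/2))"
      by (simp only: powr_add[symmetric]) (simp add: algebra_simps)
    also have "\<dots> = w ^ k / sqrt w" using w by (simp add: powr_minus_divide powr_half_sqrt powr_realpow)
    finally have 2: "w powr (real k + 1/2 - 1) = w ^ k / sqrt w" .
    have 3: "c = exp (- (\<tau>\<^sup>2 * r)) * exp (- w) / (sqrt pi * sqrt w)"
    proof -
      have "sqrt (2 * pi) * sqrt (2 * w) = (sqrt 2 * sqrt 2) * (sqrt pi * sqrt w)"
        by (simp only: real_sqrt_mult mult_ac)
      then have "sqrt (2 * pi) * sqrt (2 * w) = 2 * (sqrt pi * sqrt w)" by simp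
      then show ?thesis unfolding c_def y_def by simp
    qed
    have 4: "E * E' / (p * v) * (Q * R * W / D) = W / v * E' / (D * p / (Q * F)) * (E * R / F)"
      if "Q \<noteq> 0" "F \<noteq> 0" for E E' p v Q R W D F :: real
      using that by (simp add: mult_ac)
    show ?thesis
      unfolding 1 gamma_density_def 2 Gamma_half_integer 3 if_P[OF w] by (rule 4) auto
  qed
  ultimately show ?thesis unfolding x_def y_def by simp
qed

text \<open>
  The probability of \<open>k\<close> for a Poisson variable whose mean is \<open>l\<close> times a Gamma variable with shape \<open>a\<close>, that is,
  a negative binomial probability.
\<close>

definition mixture_weight :: "real \<Rightarrow> real \<Rightarrow> nat \<Rightarrow> real" where
  "mixture_weight a l k = Gamma (a + real k) / (Gamma a * fact k) * l ^ k / (1 + l) powr (a + real k)"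

lemma mixture_weight_nonneg: "a > 0 \<Longrightarrow> l \<ge> 0 \<Longrightarrow> mixture_weight a l k \<ge> 0"
  unfolding mixture_weight_def using Gamma_real_pos[of a] Gamma_real_pos[of "a + real k"] by simp

lemma nn_integral_gamma_mixed_poisson:
  assumes a: "a > 0" and l: "l \<ge> (0::real)"
  shows "(\<integral>\<^sup>+r. ennreal (exp (- (l * r)) * (l * r) ^ k / fact k) * ennreal (gamma_density a r) \<partial>lborel)
     = ennreal (mixture_weight a l k)"
proof -
  have Ga: "Gamma a > 0" "Gamma (a + real k) > 0" using a by (auto intro!: Gamma_real_pos)
  define C where "C = l ^ k / (fact k * Gamma a)"
  have C: "C \<ge> 0" using l Ga by (simp add: C_def)
  have "(\<integral>\<^sup>+r. ennreal (exp (- (l * r)) * (l * r) ^ k / fact k) * ennreal (gamma_density a r) \<partial>lborel)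
      = (\<integral>\<^sup>+r. ennreal C * (ennreal (r powr (a + real k - 1) * exp (- (1 + l) * r)) * indicator {0<..} r) \<partial>lborel)"
  proof (intro nn_integral_cong)
    fix r :: real
    show "ennreal (exp (- (l * r)) * (l * r) ^ k / fact k) * ennreal (gamma_density a r)
       = ennreal C * (ennreal (r powr (a + real k - 1) * exp (- (1 + l) * r)) * indicator {0<..} r)"
    proof (cases "r > 0")
      case r: True
      have "exp (- (l * r)) * (l * r) ^ k / fact k * gamma_density a r
          = C * ((r powr real k * r powr (a - 1)) * (exp (- (l * r)) * exp (- r)))"
        using r by (simp add: gamma_density_def C_def powr_realpow power_mult_distrib)
      also have "r powr real k * r powr (a - 1) = r powr (a + real k - 1)"
        by (simp only: powr_add[symmetric]) (simp add: algebra_simps)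
      also have "exp (- (l * r)) * exp (- r) = exp (- (1 + l) * r)"
        by (simp add: algebra_simps flip: exp_add)
      finally show ?thesis using r C l a by (simp add: gamma_density_nonneg flip: ennreal_mult)
    qed (auto simp: gamma_density_def)
  qed
  also have "\<dots> = ennreal C * ennreal (Gamma (a + real k) / (1 + l) powr (a + real k))"
    using l a by (subst nn_integral_cmult, simp, subst nn_integral_Gamma_scaled) auto
  also have "\<dots> = ennreal (C * (Gamma (a + real k) / (1 + l) powr (a + real k)))"
    using C Ga by (intro ennreal_mult[symmetric]) auto
  also have "C * (Gamma (a + real k) / (1 + l) powr (a + real k)) = mixture_weight a l k"
    by (simp add: C_def mixture_weight_def mult_ac)
  finally show ?thesis .
qed

lemma nn_integral_noncentral_square:
  fixes H :: "real \<Rightarrow> ennreal"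
  assumes r: "r \<ge> 0" and [measurable]: "H \<in> borel_measurable borel"
  shows "(\<integral>\<^sup>+z. H ((\<tau> * sqrt (2 * r) - z)\<^sup>2 / 2) \<partial>std_normal)
    = (\<Sum>k. (\<integral>\<^sup>+w. H w * ennreal (gamma_density (real k + 1/2) w) \<partial>lborel)
          * ennreal (exp (- (\<tau>\<^sup>2 * r)) * (\<tau>\<^sup>2 * r) ^ k / fact k))"
proof -
  let ?x = "\<tau> * sqrt (2 * r)"
  let ?P = "\<lambda>k. exp (- (\<tau>\<^sup>2 * r)) * (\<tau>\<^sup>2 * r) ^ k / fact k"
  have "(\<integral>\<^sup>+z. H ((?x - z)\<^sup>2 / 2) \<partial>std_normal) = (\<integral>\<^sup>+z. H ((?x - z)\<^sup>2 / 2) * ennreal (std_normal_density z) \<partial>lborel)"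
    by (rule nn_integral_std_normal) measurable
  also have "\<dots> = (\<integral>\<^sup>+y. H (y\<^sup>2 / 2) * ennreal (std_normal_density (?x - y)) \<partial>lborel)"
    by (subst nn_integral_real_affine[where c = "-1" and t = ?x]) simp_all
  also have "\<dots> = (\<integral>\<^sup>+w. (H ((sqrt (2 * w))\<^sup>2 / 2) * ennreal (std_normal_density (?x - sqrt (2 * w)))
          + H ((- sqrt (2 * w))\<^sup>2 / 2) * ennreal (std_normal_density (?x - (- sqrt (2 * w)))))
          * ennreal (1 / sqrt (2 * w)) * indicator {0..} w \<partial>lborel)"
    by (rule nn_integral_half_square_substitution) measurable
  also have "\<dots> = (\<integral>\<^sup>+w. (\<Sum>k. H w * ennreal (gamma_density (real k + 1/2) w) * ennreal (?P k)) \<partial>lborel)"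
  proof (intro nn_integral_cong)
    fix w :: real
    let ?A = "std_normal_density (?x - sqrt (2 * w))" and ?B = "std_normal_density (?x + sqrt (2 * w))"
    show "(H ((sqrt (2 * w))\<^sup>2 / 2) * ennreal ?A
          + H ((- sqrt (2 * w))\<^sup>2 / 2) * ennreal (std_normal_density (?x - (- sqrt (2 * w)))))
          * ennreal (1 / sqrt (2 * w)) * indicator {0..} w
       = (\<Sum>k. H w * ennreal (gamma_density (real k + 1/2) w) * ennreal (?P k))"
    proof (cases "w > 0")
      case w: True
      have "(\<Sum>k. H w * ennreal (gamma_density (real k + 1/2) w) * ennreal (?P k))
          = (\<Sum>k. H w * ennreal (gamma_density (real k + 1/2) w * ?P k))"
      proof (intro suminf_cong)
        fix k
        have "ennreal (gamma_density (real k + 1/2) w * ?P k) = ennreal (gamma_density (real k + 1/2) w) * ennreal (?P k)"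
          using r by (intro ennreal_mult) (auto intro!: gamma_density_nonneg)
        then show "H w * ennreal (gamma_density (real k + 1/2) w) * ennreal (?P k)
            = H w * ennreal (gamma_density (real k + 1/2) w * ?P k)" by (simp only: mult.assoc)
      qed
      also have "\<dots> = H w * (\<Sum>k. ennreal (gamma_density (real k + 1/2) w * ?P k))"
        by (rule ennreal_suminf_cmult)
      also have "(\<Sum>k. ennreal (gamma_density (real k + 1/2) w * ?P k)) = ennreal ((?A + ?B) / sqrt (2 * w))"
        using noncentral_square_density[OF r w, of \<tau>] r
        by (intro suminf_ennreal_eq) (auto simp: gamma_density_nonneg)
      also have "\<dots> = ennreal ((?A + ?B) * (1 / sqrt (2 * w)))" by simp
      also have "\<dots> = (ennreal ?A + ennreal ?B) * ennreal (1 / sqrt (2 * w))"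
        using w by (subst ennreal_plus[symmetric], simp, simp, subst ennreal_mult[symmetric]) auto
      finally show ?thesis using w by (simp add: distrib_left distrib_right mult.assoc)
    qed (auto simp: gamma_density_def indicator_def)
  qed
  also have "\<dots> = (\<Sum>k. (\<integral>\<^sup>+w. H w * ennreal (gamma_density (real k + 1/2) w) * ennreal (?P k) \<partial>lborel))"
    by (rule nn_integral_suminf) measurable
  also have "\<dots> = (\<Sum>k. (\<integral>\<^sup>+w. H w * ennreal (gamma_density (real k + 1/2) w) \<partial>lborel) * ennreal (?P k))"
    by (simp add: nn_integral_multc)
  finally show ?thesis .
qed

text \<open>
  Here \<open>r\<close>, \<open>v\<close> and \<open>z\<close> are independent with laws \<open>Gamma(a)\<close>, \<open>Gamma(b)\<close> and \<open>N(0, 1)\<close>; the law of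
  \<open>(\<tau> * sqrt (2 * r) - z)\<^sup>2 / 2 / v\<close> is a negative binomial mixture of beta prime laws.
\<close>

lemma nn_integral_noncentral_ratio:
  fixes h :: "real \<Rightarrow> ennreal"
  assumes a: "a > 0" and b: "b > 0" and [measurable]: "h \<in> borel_measurable borel"
  shows "(\<integral>\<^sup>+r. (\<integral>\<^sup>+v. (\<integral>\<^sup>+z. h ((\<tau> * sqrt (2 * r) - z)\<^sup>2 / 2 / v) \<partial>std_normal)
             * ennreal (gamma_density b v) \<partial>lborel) * ennreal (gamma_density a r) \<partial>lborel)
    = (\<integral>\<^sup>+y. h y * (\<Sum>k. ennreal (mixture_weight a (\<tau>\<^sup>2) k * beta_prime_density (real k + 1/2) b y)) \<partial>lborel)"
proof -
  let ?P = "\<lambda>k r. exp (- (\<tau>\<^sup>2 * r)) * (\<tau>\<^sup>2 * r) ^ k / fact k"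
  let ?I = "\<lambda>k. \<integral>\<^sup>+y. h y * ennreal (beta_prime_density (real k + 1/2) b y) \<partial>lborel"
  have "(\<integral>\<^sup>+v. (\<integral>\<^sup>+z. h ((\<tau> * sqrt (2 * r) - z)\<^sup>2 / 2 / v) \<partial>std_normal) * ennreal (gamma_density b v) \<partial>lborel)
      = (\<Sum>k. ?I k * ennreal (?P k r))" if r: "r \<ge> 0" for r
  proof -
    have "(\<integral>\<^sup>+z. h ((\<tau> * sqrt (2 * r) - z)\<^sup>2 / 2 / v) \<partial>std_normal)
       = (\<Sum>k. (\<integral>\<^sup>+w. h (w / v) * ennreal (gamma_density (real k + 1/2) w) \<partial>lborel) * ennreal (?P k r))" for v
      by (rule nn_integral_noncentral_square[OF r, of "\<lambda>w. h (w / v)"]) measurable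
    then have "(\<integral>\<^sup>+v. (\<integral>\<^sup>+z. h ((\<tau> * sqrt (2 * r) - z)\<^sup>2 / 2 / v) \<partial>std_normal) * ennreal (gamma_density b v) \<partial>lborel)
       = (\<integral>\<^sup>+v. (\<Sum>k. (\<integral>\<^sup>+w. h (w / v) * ennreal (gamma_density (real k + 1/2) w) \<partial>lborel)
             * ennreal (gamma_density b v) * ennreal (?P k r)) \<partial>lborel)"
      by (simp only: ennreal_suminf_multc[symmetric] mult.assoc mult.commute[of "ennreal (?P _ r)"])
    also have "\<dots> = (\<Sum>k. \<integral>\<^sup>+v. (\<integral>\<^sup>+w. h (w / v) * ennreal (gamma_density (real k + 1/2) w) \<partial>lborel)
             * ennreal (gamma_density b v) * ennreal (?P k r) \<partial>lborel)"
      by (rule nn_integral_suminf) measurable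
    also have "\<dots> = (\<Sum>k. ?I k * ennreal (?P k r))"
      using b by (intro suminf_cong) (simp add: nn_integral_multc nn_integral_gamma_ratio)
    finally show ?thesis .
  qed
  then have "(\<integral>\<^sup>+v. (\<integral>\<^sup>+z. h ((\<tau> * sqrt (2 * r) - z)\<^sup>2 / 2 / v) \<partial>std_normal) * ennreal (gamma_density b v) \<partial>lborel)
        * ennreal (gamma_density a r) = (\<Sum>k. ?I k * ennreal (?P k r)) * ennreal (gamma_density a r)" for r
    by (cases "r \<ge> 0") (auto simp: gamma_density_def)
  then have "(\<integral>\<^sup>+r. (\<integral>\<^sup>+v. (\<integral>\<^sup>+z. h ((\<tau> * sqrt (2 * r) - z)\<^sup>2 / 2 / v) \<partial>std_normal)
             * ennreal (gamma_density b v) \<partial>lborel) * ennreal (gamma_density a r) \<partial>lborel)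
     = (\<integral>\<^sup>+r. (\<Sum>k. ?I k * (ennreal (?P k r) * ennreal (gamma_density a r))) \<partial>lborel)"
    by (simp only: ennreal_suminf_multc[symmetric] mult.assoc)
  also have "\<dots> = (\<Sum>k. \<integral>\<^sup>+r. ?I k * (ennreal (?P k r) * ennreal (gamma_density a r)) \<partial>lborel)"
    by (rule nn_integral_suminf) measurable
  also have "\<dots> = (\<Sum>k. ?I k * ennreal (mixture_weight a (\<tau>\<^sup>2) k))"
    using a by (simp add: nn_integral_cmult nn_integral_gamma_mixed_poisson)
  also have "\<dots> = (\<Sum>k. \<integral>\<^sup>+y. h y * ennreal (beta_prime_density (real k + 1/2) b y) * ennreal (mixture_weight a (\<tau>\<^sup>2) k) \<partial>lborel)"
    by (simp add: nn_integral_multc)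
  also have "\<dots> = (\<integral>\<^sup>+y. (\<Sum>k. h y * ennreal (beta_prime_density (real k + 1/2) b y) * ennreal (mixture_weight a (\<tau>\<^sup>2) k)) \<partial>lborel)"
    by (rule nn_integral_suminf[symmetric]) measurable
  also have "\<dots> = (\<integral>\<^sup>+y. h y * (\<Sum>k. ennreal (mixture_weight a (\<tau>\<^sup>2) k * beta_prime_density (real k + 1/2) b y)) \<partial>lborel)"
  proof (intro nn_integral_cong)
    fix y
    have "ennreal (mixture_weight a (\<tau>\<^sup>2) k * beta_prime_density (real k + 1/2) b y)
      = ennreal (beta_prime_density (real k + 1/2) b y) * ennreal (mixture_weight a (\<tau>\<^sup>2) k)" for k
      using a by (simp add: ennreal_mult' mixture_weight_nonneg mult.commute)
    then show "(\<Sum>k. h y * ennreal (beta_prime_density (real k + 1/2) b y) * ennreal (mixture_weight a (\<tau>\<^sup>2) k))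
      = h y * (\<Sum>k. ennreal (mixture_weight a (\<tau>\<^sup>2) k * beta_prime_density (real k + 1/2) b y))"
      by (simp add: mult.assoc)
  qed
  finally show ?thesis .
qed

section \<open>The standard Gaussian law\<close>

lemma nn_integral_lborel_translate:
  fixes h :: "'c::euclidean_space \<Rightarrow> ennreal"
  assumes [measurable]: "h \<in> borel_measurable borel"
  shows "(\<integral>\<^sup>+x. h x \<partial>lborel) = (\<integral>\<^sup>+x. h (x + t) \<partial>lborel)"
proof -
  have "(\<integral>\<^sup>+x. h x \<partial>lborel) = (\<integral>\<^sup>+x. h x \<partial>distr lborel borel ((+) t))"
    by (subst lborel_distr_plus) simp
  also have "\<dots> = (\<integral>\<^sup>+x. h (t + x) \<partial>lborel)"
    by (subst nn_integral_distr) auto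
  finally show ?thesis by (simp add: add.commute)
qed

text \<open>
  A linear bijection maps Lebesgue measure to a multiple of Lebesgue measure. The multiple is not identified
  with a determinant: for probability densities it is forced by the total mass. The proof is the usual
  uniqueness argument for translation-invariant measures: Fubini's theorem is applied to
  \<open>indicator B y * indicator E (f x + y)\<close> with a box \<open>B\<close> of measure \<open>1\<close>.
\<close>

lemma distr_lborel_linear:
  fixes f :: "'a::euclidean_space \<Rightarrow> 'b::euclidean_space"
  assumes f: "linear f" and g: "\<And>y. f (g y) = y"
  obtains \<kappa> :: ennreal where "distr lborel borel f = density lborel (\<lambda>_. \<kappa>)"
proof -
  have [measurable]: "f \<in> borel_measurable borel"
    using f by (intro borel_measurable_continuous_onI linear_continuous_on linear_conv_bounded_linear[THEN iffD1])
  define B :: "'b set" where "B = box 0 One"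
  have [measurable]: "B \<in> sets borel" unfolding B_def by simp
  have B1: "emeasure lborel B = 1"
    unfolding B_def by (subst emeasure_lborel_box) (auto simp: inner_sum_left_Basis)
  define \<kappa> where "\<kappa> = (\<integral>\<^sup>+x. indicator B (- f x) \<partial>lborel)"
  have "distr lborel borel f = density lborel (\<lambda>_. \<kappa>)"
  proof (rule measure_eqI)
    fix E assume "E \<in> sets (distr lborel borel f)"
    then have [measurable]: "E \<in> sets borel" by simp
    have "emeasure (distr lborel borel f) E = (\<integral>\<^sup>+x. indicator E (f x) \<partial>lborel)"
    proof -
      have "emeasure (distr lborel borel f) E = (\<integral>\<^sup>+y. indicator E y \<partial>distr lborel borel f)" by simp
      also have "\<dots> = (\<integral>\<^sup>+x. indicator E (f x) \<partial>lborel)" by (subst nn_integral_distr) auto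
      finally show ?thesis .
    qed
    also have "\<dots> = (\<integral>\<^sup>+y. indicator B y * (\<integral>\<^sup>+x. indicator E (f x) \<partial>lborel) \<partial>lborel)"
      by (simp add: nn_integral_multc B1)
    also have "\<dots> = (\<integral>\<^sup>+y. (\<integral>\<^sup>+x. indicator B y * indicator E (f x + y) \<partial>lborel) \<partial>lborel)"
    proof (rule nn_integral_cong)
      fix y
      have "(\<integral>\<^sup>+x. indicator E (f x) \<partial>lborel) = (\<integral>\<^sup>+x. indicator E (f (x + g y)) \<partial>lborel)"
        by (rule nn_integral_lborel_translate) measurable
      then show "indicator B y * (\<integral>\<^sup>+x. indicator E (f x) \<partial>lborel)
         = (\<integral>\<^sup>+x. indicator B y * indicator E (f x + y) \<partial>lborel)"
        by (simp add: nn_integral_cmult linear_add[OF f] g)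
    qed
    also have "\<dots> = (\<integral>\<^sup>+x. (\<integral>\<^sup>+y. indicator B y * indicator E (f x + y) \<partial>lborel) \<partial>lborel)"
      by (rule lborel_pair.Fubini') measurable
    also have "\<dots> = (\<integral>\<^sup>+x. (\<integral>\<^sup>+y. indicator B (y - f x) * indicator E y \<partial>lborel) \<partial>lborel)"
    proof (rule nn_integral_cong)
      fix x
      show "(\<integral>\<^sup>+y. indicator B y * indicator E (f x + y) \<partial>lborel)
         = (\<integral>\<^sup>+y. indicator B (y - f x) * indicator E y \<partial>lborel)"
        by (subst nn_integral_lborel_translate[where t = "- f x"]) (auto simp: algebra_simps)
    qed
    also have "\<dots> = (\<integral>\<^sup>+y. (\<integral>\<^sup>+x. indicator B (y - f x) * indicator E y \<partial>lborel) \<partial>lborel)"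
      by (rule lborel_pair.Fubini') measurable
    also have "\<dots> = (\<integral>\<^sup>+y. \<kappa> * indicator E y \<partial>lborel)"
    proof (rule nn_integral_cong)
      fix y
      have "(\<integral>\<^sup>+x. indicator B (y - f x) \<partial>lborel) = (\<integral>\<^sup>+x. indicator B (y - f (x + g y)) \<partial>lborel)"
        by (rule nn_integral_lborel_translate) measurable
      then show "(\<integral>\<^sup>+x. indicator B (y - f x) * indicator E y \<partial>lborel) = \<kappa> * indicator E y"
        by (simp add: nn_integral_multc linear_add[OF f] g \<kappa>_def)
    qed
    also have "\<dots> = emeasure (density lborel (\<lambda>_. \<kappa>)) E"
      by (subst emeasure_density) auto
    finally show "emeasure (distr lborel borel f) E = emeasure (density lborel (\<lambda>_. \<kappa>)) E" .
  qed simp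
  then show thesis by (rule that)
qed

text \<open>
  The standard Gaussian law on \<open>\<real>\<^sup>n\<close>, with independent standard normal coordinates.
\<close>

definition std_gaussian :: "(real^'n) measure" where
  "std_gaussian = density lborel (\<lambda>x. ennreal (\<Prod>k\<in>UNIV. std_normal_density (x $ k)))"

lemma sets_std_gaussian [measurable_cong, simp]: "sets std_gaussian = sets borel"
  by (simp add: std_gaussian_def)

lemma space_std_gaussian [simp]: "space std_gaussian = UNIV"
  by (simp add: std_gaussian_def)

lemma space_std_normal [simp]: "space std_normal = UNIV"
  by (simp add: std_normal_def)

lemma borel_measurable_family_entry:
  "(\<lambda>x. x t $ s) \<in> borel_measurable (PiM UNIV (\<lambda>_. borel :: (real^'n) measure))"
  by (rule measurable_compose[OF measurable_component_singleton]) auto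

lemma borel_measurable_vec_lambda [measurable (raw)]:
  assumes "\<And>k. (\<lambda>w. f w k) \<in> borel_measurable N"
  shows "(\<lambda>w. (\<chi> k. f w k) :: real^'n) \<in> borel_measurable N"
proof -
  have "(\<lambda>w. (\<chi> k. f w k) \<bullet> b) \<in> borel_measurable N" if "b \<in> Basis" for b :: "real^'n"
    using that assms by (auto simp: Basis_vec_def inner_axis)
  then show ?thesis by (subst borel_measurable_euclidean_space) blast
qed

lemma emeasure_std_gaussian_box:
  fixes A :: "'n::finite \<Rightarrow> real set"
  assumes [measurable]: "\<And>k. A k \<in> sets borel"
  shows "emeasure std_gaussian {x :: real^'n. \<forall>k. x $ k \<in> A k} = (\<Prod>k\<in>UNIV. emeasure std_normal (A k))"
proof -
  let ?f = "\<lambda>k x. ennreal (std_normal_density x) * indicator (A k) x"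
  have [measurable]: "{x :: real^'n. \<forall>k. x $ k \<in> A k} \<in> sets borel"
  proof -
    have "{x \<in> space borel. \<forall>k. (x :: real^'n) $ k \<in> A k} \<in> sets borel" by measurable
    then show ?thesis by simp
  qed
  have Basis: "(Basis :: (real^'n) set) = range (\<lambda>k. axis k 1)"
    by (auto simp: Basis_vec_def)
  have inj: "inj (\<lambda>k. axis k 1 :: real^'n)" by (auto simp: inj_on_def axis_eq_axis)
  have "emeasure std_gaussian {x :: real^'n. \<forall>k. x $ k \<in> A k}
      = (\<integral>\<^sup>+x. ennreal (\<Prod>k\<in>UNIV. std_normal_density (x $ k)) * indicator {x :: real^'n. \<forall>k. x $ k \<in> A k} x \<partial>lborel)"
    unfolding std_gaussian_def by (rule emeasure_density) auto
  also have "\<dots> = (\<integral>\<^sup>+x. (\<Prod>b\<in>Basis. ?f (axis_index b) ((x::real^'n) \<bullet> b)) \<partial>lborel)"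
  proof (intro nn_integral_cong)
    fix x :: "real^'n"
    have "(\<Prod>b\<in>Basis. ?f (axis_index b) (x \<bullet> b)) = (\<Prod>k\<in>UNIV. ?f k (x $ k))"
      unfolding Basis using inj by (subst prod.reindex) (auto simp: inner_axis)
    also have "\<dots> = (\<Prod>k\<in>UNIV. ennreal (std_normal_density (x $ k))) * (\<Prod>k\<in>UNIV. indicator (A k) (x $ k))"
      by (rule prod.distrib)
    also have "(\<Prod>k\<in>UNIV. indicator (A k) (x $ k)) = (indicator {x :: real^'n. \<forall>k. x $ k \<in> A k} x :: ennreal)"
      by (auto simp: indicator_def prod_zero_iff)
    also have "(\<Prod>k\<in>UNIV. ennreal (std_normal_density (x $ k))) = ennreal (\<Prod>k\<in>UNIV. std_normal_density (x $ k))"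
      by (rule prod_ennreal) simp
    finally show "ennreal (\<Prod>k\<in>UNIV. std_normal_density (x $ k)) * indicator {x. \<forall>k. x $ k \<in> A k} x
       = (\<Prod>b\<in>Basis. ?f (axis_index b) (x \<bullet> b))" ..
  qed
  also have "\<dots> = (\<Prod>b\<in>(Basis::(real^'n) set). \<integral>\<^sup>+x. ?f (axis_index b) x \<partial>lborel)"
    by (rule nn_integral_lborel_prod) auto
  also have "\<dots> = (\<Prod>k\<in>UNIV. \<integral>\<^sup>+x. ?f k x \<partial>lborel)"
    unfolding Basis using inj by (subst prod.reindex) auto
  also have "\<dots> = (\<Prod>k\<in>UNIV. emeasure std_normal (A k))"
    unfolding std_normal_def by (simp add: emeasure_density)
  finally show ?thesis .
qed

lemma prob_space_std_gaussian: "prob_space (std_gaussian :: (real^'n) measure)"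
proof
  interpret prob_space std_normal by (rule prob_space_std_normal)
  show "emeasure (std_gaussian :: (real^'n) measure) (space std_gaussian) = 1"
    using emeasure_std_gaussian_box[of "\<lambda>_. UNIV"] emeasure_space_1 by simp
qed

lemma product_sigma_finite_std_gaussian: "product_sigma_finite (\<lambda>_. std_gaussian :: (real^'n) measure)"
  by (rule product_sigma_finite.intro)
     (metis prob_space_std_gaussian prob_space.axioms(1) finite_measure.axioms(1))

lemma std_gaussian_density_norm:
  "(\<Prod>k\<in>UNIV. std_normal_density (x $ k)) = exp (- (x \<bullet> x) / 2) / sqrt ((2 * pi) ^ CARD('n))" for x :: "real^'n"
proof -
  have "(\<Prod>k\<in>UNIV. std_normal_density (x $ k))
     = (\<Prod>k\<in>(UNIV::'n set). 1 / sqrt (2 * pi)) * (\<Prod>k\<in>UNIV. exp (- (x $ k)\<^sup>2 / 2))"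
    unfolding std_normal_density_def by (rule prod.distrib)
  also have "(\<Prod>k\<in>UNIV. exp (- (x $ k)\<^sup>2 / 2)) = exp (\<Sum>k\<in>UNIV. - (x $ k)\<^sup>2 / 2)"
    by (rule exp_sum[symmetric]) simp
  also have "(\<Sum>k\<in>UNIV. - (x $ k)\<^sup>2 / 2) = - (x \<bullet> x) / 2"
    by (simp add: inner_vec_def power2_eq_square sum_negf sum_divide_distrib)
  finally show ?thesis
    unfolding real_sqrt_power prod_constant power_one_over by simp
qed

text \<open>
  If \<open>\<mu>\<close> has a density proportional to the Gaussian density at \<open>f x\<close>, then \<open>f\<close> maps \<open>\<mu>\<close> to the
  standard Gaussian law. This covers both rotations and whitening.
\<close>

lemma distr_std_gaussian_linear:
  fixes \<mu> :: "(real^'n) measure" and f :: "real^'n \<Rightarrow> real^'n"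
  assumes \<mu>: "prob_space \<mu>" "\<mu> = density lborel (\<lambda>x. ennreal (c * exp (- (f x \<bullet> f x) / 2)))"
    and f: "linear f" and g: "\<And>y. f (g y) = y" and c: "c \<ge> 0"
  shows "distr \<mu> borel f = std_gaussian"
proof -
  interpret G: prob_space "std_gaussian :: (real^'n) measure" by (rule prob_space_std_gaussian)
  have [measurable]: "f \<in> borel_measurable borel"
    using f by (intro borel_measurable_continuous_onI linear_continuous_on linear_conv_bounded_linear[THEN iffD1])
  obtain \<kappa> where \<kappa>: "distr lborel borel f = density lborel (\<lambda>_. \<kappa>)"
    by (rule distr_lborel_linear[OF f g])
  define s where "s = sqrt ((2 * pi) ^ CARD('n))"
  have s: "s > 0" by (simp add: s_def)
  define C where "C = \<kappa> * ennreal (c * s)"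
  have key: "emeasure (distr \<mu> borel f) E = C * emeasure std_gaussian E" if [measurable]: "E \<in> sets borel" for E
  proof -
    have "emeasure (distr \<mu> borel f) E = emeasure \<mu> (f -` E)"
      using \<mu>(2) by (subst emeasure_distr) auto
    also have "\<dots> = (\<integral>\<^sup>+x. ennreal (c * exp (- (f x \<bullet> f x) / 2)) * indicator E (f x) \<partial>lborel)"
    proof -
      have [measurable]: "f -` E \<in> sets borel" by (rule measurable_sets_borel[of f borel]) auto
      show ?thesis unfolding \<mu>(2)
        by (subst emeasure_density) (auto intro!: nn_integral_cong split: split_indicator)
    qed
    also have "\<dots> = (\<integral>\<^sup>+y. ennreal (c * exp (- (y \<bullet> y) / 2)) * indicator E y \<partial>distr lborel borel f)"
      by (subst nn_integral_distr) auto
    also have "\<dots> = (\<integral>\<^sup>+y. \<kappa> * (ennreal (c * exp (- (y \<bullet> y) / 2)) * indicator E y) \<partial>lborel)"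
      unfolding \<kappa> by (subst nn_integral_density) auto
    also have "\<dots> = (\<integral>\<^sup>+y. C * (ennreal (\<Prod>k\<in>UNIV. std_normal_density (y $ k)) * indicator E y) \<partial>lborel)"
    proof (intro nn_integral_cong)
      fix y :: "real^'n"
      have "c * exp (- (y \<bullet> y) / 2) = (c * s) * (\<Prod>k\<in>UNIV. std_normal_density (y $ k))"
        unfolding std_gaussian_density_norm s_def[symmetric] using s by simp
      then have "ennreal (c * exp (- (y \<bullet> y) / 2)) = ennreal (c * s) * ennreal (\<Prod>k\<in>UNIV. std_normal_density (y $ k))"
        using c s by (simp only:) (intro ennreal_mult; simp add: prod_nonneg)
      then show "\<kappa> * (ennreal (c * exp (- (y \<bullet> y) / 2)) * indicator E y) =
           C * (ennreal (\<Prod>k\<in>UNIV. std_normal_density (y $ k)) * indicator E y)"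
        by (simp add: C_def mult.assoc)
    qed
    also have "\<dots> = C * emeasure std_gaussian E"
      unfolding std_gaussian_def by (subst nn_integral_cmult, simp, subst emeasure_density) auto
    finally show ?thesis .
  qed
  have sp: "space \<mu> = UNIV" using \<mu>(2) by simp
  have "emeasure (distr \<mu> borel f) UNIV = 1"
    using prob_space.emeasure_space_1[OF \<mu>(1)] \<mu>(2) sp by (subst emeasure_distr) auto
  then have "C = 1" using key[of UNIV] G.emeasure_space_1 by simp
  then show ?thesis by (intro measure_eqI) (auto simp: key)
qed

lemma matrix_vector_mult_inner_left:
  fixes A :: "real^'n^'m"
  shows "(A *v x) \<bullet> y = x \<bullet> (transpose A *v y)"
  by (metis dot_lmul_matrix inner_commute transpose_matrix_vector)

lemma distr_std_gaussian_orthogonal: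
  fixes Q :: "real^'n^'n"
  assumes "orthogonal_matrix Q"
  shows "distr std_gaussian borel ((*v) Q) = std_gaussian"
proof (rule distr_std_gaussian_linear)
  show "prob_space (std_gaussian :: (real^'n) measure)" by (rule prob_space_std_gaussian)
  have "(Q *v x) \<bullet> (Q *v x) = x \<bullet> x" for x
    using assms by (simp add: matrix_vector_mult_inner_left matrix_vector_mul_assoc orthogonal_matrix
        del: transpose_matrix_vector)
  then show "std_gaussian = density lborel (\<lambda>x. ennreal (1 / sqrt ((2 * pi) ^ CARD('n)) * exp (- ((Q *v x) \<bullet> (Q *v x)) / 2)))"
    unfolding std_gaussian_def std_gaussian_density_norm by simp
  show "linear ((*v) Q)" by simp
  show "Q *v (transpose Q *v y) = y" for y
    using assms by (simp add: matrix_vector_mul_assoc orthogonal_matrix_def del: transpose_matrix_vector)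
qed simp

lemma pos_def_whitening_inverse:
  fixes S W :: "real^'n^'n"
  assumes "transpose W ** S ** W = mat 1"
  shows "matrix_inv S = W ** transpose W" "S ** W ** transpose W = mat 1" "W ** (transpose W ** S) = mat 1"
proof -
  have "transpose W ** (S ** W) = mat 1" using assms by (simp add: matrix_mul_assoc)
  then show 1: "S ** W ** transpose W = mat 1" by (simp add: matrix_left_right_inverse)
  then show "matrix_inv S = W ** transpose W" by (intro matrix_inv_eqI) (simp add: matrix_mul_assoc)
  show "W ** (transpose W ** S) = mat 1"
    using assms by (simp add: matrix_left_right_inverse)
qed

text \<open>
  Since \<open>matrix_inv S = W ** transpose W\<close>, the density of \<open>Z\<close> is a constant times the Gaussian density at
  \<open>transpose W *v x\<close>.
\<close>

lemma distr_normal_vector_whitening: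
  fixes Z :: "'a \<Rightarrow> real^'n" and S W :: "real^'n^'n"
  assumes M: "prob_space M" and Z: "normal_vector M 0 S Z" and W: "transpose W ** S ** W = mat 1"
  shows "distr M borel (\<lambda>w. transpose W *v Z w) = std_gaussian"
proof -
  let ?\<mu> = "density lborel (\<lambda>x. ennreal (mvn_density 0 S x))"
  have dZ: "distributed M lborel Z (\<lambda>x. ennreal (mvn_density 0 S x))"
    using Z by (auto simp: normal_vector_def)
  have [measurable]: "Z \<in> borel_measurable M" using distributed_measurable[OF dZ] by simp
  have lin: "linear (\<lambda>x. transpose W *v x)" by (rule matrix_vector_mul_linear)
  then have [measurable]: "(\<lambda>x. transpose W *v x) \<in> borel_measurable borel"
    by (intro borel_measurable_continuous_onI linear_continuous_on linear_conv_bounded_linear[THEN iffD1])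
  have law: "distr M lborel Z = ?\<mu>" by (rule distributed_distr_eq_density[OF dZ])
  define c where "c = 1 / sqrt ((2 * pi) ^ CARD('n) * det S)"
  have "det W * det S * det W = 1"
    using arg_cong[OF W, of det] by (simp add: det_mul)
  then have "(det W)\<^sup>2 * det S = 1" by (simp add: power2_eq_square mult_ac)
  then have "det S \<ge> 0"
    by (metis mult_neg_pos mult_zero_left not_le not_one_less_zero not_less zero_less_one zero_le_power2 less_eq_real_def mult_nonneg_nonpos)
  then have c: "c \<ge> 0" by (simp add: c_def)
  have "distr ?\<mu> borel (\<lambda>x. transpose W *v x) = std_gaussian"
  proof (rule distr_std_gaussian_linear)
    have "prob_space (distr M lborel Z)"
      using M by (rule prob_space.prob_space_distr) simp
    then show "prob_space ?\<mu>" by (simp add: law)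
    show "?\<mu> = density lborel (\<lambda>x. ennreal (c * exp (- ((transpose W *v x) \<bullet> (transpose W *v x)) / 2)))"
      unfolding mvn_density_def pos_def_whitening_inverse(1)[OF W] c_def
      by (simp add: matrix_vector_mult_inner_left matrix_vector_mul_assoc transpose_transpose del: transpose_matrix_vector)
    show "linear (\<lambda>x. transpose W *v x)" by (rule lin)
    show "transpose W *v ((S ** W) *v y) = y" for y
      using W by (simp add: matrix_vector_mul_assoc matrix_mul_assoc del: transpose_matrix_vector)
  qed (use c in auto)
  moreover have "distr ?\<mu> borel (\<lambda>x. transpose W *v x) = distr M borel (\<lambda>w. transpose W *v Z w)"
    unfolding law[symmetric] by (subst distr_distr) (auto simp: comp_def)
  ultimately show ?thesis by simp
qed

section \<open>Families of independent Gaussian vectors\<close>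

lemma measurable_family_entries:
  "(\<lambda>x (t, s). x t $ s) \<in> measurable (PiM UNIV (\<lambda>_::'t. borel :: (real^'n) measure))
     (PiM UNIV (\<lambda>_::'t \<times> 'n. borel))"
  unfolding split_beta
  by (rule measurable_PiM_single') (auto simp: space_PiM borel_measurable_family_entry)

lemma sets_PiM_std_gaussian: "sets (PiM I (\<lambda>_. std_gaussian)) = sets (PiM I (\<lambda>_. borel))"
  by (intro sets_PiM_cong) auto

lemma distr_PiM_std_gaussian_entries:
  "distr (PiM UNIV (\<lambda>_::'t::finite. std_gaussian)) (PiM UNIV (\<lambda>_. borel)) (\<lambda>x (t, s). x t $ s)
     = PiM UNIV (\<lambda>_::'t \<times> 'n::finite. std_normal)"
proof (rule product_sigma_finite.PiM_eqI[OF product_sigma_finite_std_normal])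
  interpret product_sigma_finite "\<lambda>_::'t. std_gaussian :: (real^'n) measure"
    by (rule product_sigma_finite_std_gaussian)
  have [measurable]: "(\<lambda>x (t, s). x t $ s) \<in> measurable (PiM UNIV (\<lambda>_::'t. std_gaussian)) (PiM UNIV (\<lambda>_::'t \<times> 'n. borel :: real measure))"
    by (subst measurable_cong_sets[OF sets_PiM_std_gaussian refl]) (rule measurable_family_entries)
  show "sets (distr (PiM UNIV (\<lambda>_::'t. std_gaussian)) (PiM UNIV (\<lambda>_. borel)) (\<lambda>x (t, s). x t $ s))
     = sets (PiM UNIV (\<lambda>_::'t \<times> 'n. std_normal))"
    by (auto intro!: sets_PiM_cong simp: sets_std_normal)
  fix A :: "'t \<times> 'n \<Rightarrow> real set"
  assume "\<And>i. i \<in> UNIV \<Longrightarrow> A i \<in> sets std_normal"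
  then have A [measurable]: "A i \<in> sets borel" for i by (simp add: sets_std_normal)
  have m: "{x :: real^'n. \<forall>s. x $ s \<in> A (t, s)} \<in> sets borel" for t
  proof -
    have "{x \<in> space borel. \<forall>s. (x :: real^'n) $ s \<in> A (t, s)} \<in> sets borel" by measurable
    then show ?thesis by simp
  qed
  have "emeasure (distr (PiM UNIV (\<lambda>_::'t. std_gaussian)) (PiM UNIV (\<lambda>_. borel)) (\<lambda>x (t, s). x t $ s)) (Pi\<^sub>E UNIV A)
     = emeasure (PiM UNIV (\<lambda>_::'t. std_gaussian)) (Pi\<^sub>E UNIV (\<lambda>t. {x :: real^'n. \<forall>s. x $ s \<in> A (t, s)}))"
  proof -
    have "Pi\<^sub>E UNIV A \<in> sets (PiM UNIV (\<lambda>_::'t \<times> 'n. borel))"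
      by (rule sets_PiM_I_finite) (auto simp: A)
    then show ?thesis
      by (subst emeasure_distr) (auto intro!: arg_cong2[where f = emeasure] simp: space_PiM PiE_def Pi_def)
  qed
  also have "\<dots> = (\<Prod>t\<in>UNIV. emeasure std_gaussian {x :: real^'n. \<forall>s. x $ s \<in> A (t, s)})"
    using m by (intro emeasure_PiM) auto
  also have "\<dots> = (\<Prod>t\<in>UNIV. \<Prod>s\<in>UNIV. emeasure std_normal (A (t, s)))"
    by (intro prod.cong refl emeasure_std_gaussian_box) simp
  also have "\<dots> = (\<Prod>i\<in>UNIV. emeasure std_normal (A i))"
    by (simp add: prod.cartesian_product)
  finally show "emeasure (distr (PiM UNIV (\<lambda>_::'t. std_gaussian)) (PiM UNIV (\<lambda>_. borel)) (\<lambda>x (t, s). x t $ s)) (Pi\<^sub>E UNIV A)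
    = (\<Prod>i\<in>UNIV. emeasure std_normal (A i))" .
qed simp

text \<open>
  Vectors are independent and standard Gaussian if and only if all their entries are independent and standard normal.
  Applied in one direction to the columns and in the other to the rows, this exchanges the columns of a data
  matrix for its rows.
\<close>

lemma iid_std_gaussian_iff_entries:
  fixes Z :: "'t::finite \<Rightarrow> 'a \<Rightarrow> real^'n"
  assumes [measurable]: "\<And>t. Z t \<in> borel_measurable M"
  shows "distr M (PiM UNIV (\<lambda>_. borel)) (\<lambda>w t. Z t w) = PiM UNIV (\<lambda>_. std_gaussian) \<longleftrightarrow>
         distr M (PiM UNIV (\<lambda>_. borel)) (\<lambda>w (t, s). Z t w $ s) = PiM UNIV (\<lambda>_. std_normal)"
proof -
  let ?\<phi> = "\<lambda>(x :: 't \<Rightarrow> real^'n) (t, s). x t $ s" and ?\<psi> = "\<lambda>(e :: 't \<times> 'n \<Rightarrow> real) t. (\<chi> s. e (t, s)) :: real^'n"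
  let ?V = "PiM UNIV (\<lambda>_::'t. borel :: (real^'n) measure)" and ?E = "PiM UNIV (\<lambda>_::'t \<times> 'n. borel :: real measure)"
  let ?G = "PiM UNIV (\<lambda>_::'t. std_gaussian :: (real^'n) measure)" and ?N = "PiM UNIV (\<lambda>_::'t \<times> 'n. std_normal)"
  have sG: "sets ?G = sets ?V" and sN: "sets ?N = sets ?E"
    by (auto intro!: sets_PiM_cong simp: sets_std_normal)
  have [measurable]: "?\<phi> \<in> measurable ?V ?E" by (rule measurable_family_entries)
  have [measurable]: "?\<psi> \<in> measurable ?E ?V"
    by (rule measurable_PiM_single') (auto simp: space_PiM)
  have [measurable]: "(\<lambda>w t. Z t w) \<in> measurable M ?V"
    by (rule measurable_PiM_single') (auto simp: space_PiM)
  have "(\<lambda>w. Z t w $ s) \<in> borel_measurable M" for t s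
    by (rule measurable_compose[OF assms]) auto
  then have [measurable]: "(\<lambda>w (t, s). Z t w $ s) \<in> measurable M ?E"
    unfolding split_beta by (intro measurable_PiM_single') (auto simp: space_PiM)
  have \<psi>\<phi>: "?\<psi> (?\<phi> x) = x" for x by (simp add: fun_eq_iff vec_eq_iff)
  have GN: "distr ?G ?E ?\<phi> = ?N" by (rule distr_PiM_std_gaussian_entries)
  have NG: "distr ?N ?V ?\<psi> = ?G"
  proof -
    have "distr ?N ?V ?\<psi> = distr (distr ?G ?E ?\<phi>) ?V ?\<psi>" by (simp only: GN)
    also have "\<dots> = distr ?G ?V (\<lambda>x. x)"
      using sG by (subst distr_distr) (auto simp: comp_def \<psi>\<phi> cong: measurable_cong_sets)
    also have "\<dots> = ?G" using sG by (simp add: distr_id2)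
    finally show ?thesis .
  qed
  show ?thesis
  proof
    assume L: "distr M ?V (\<lambda>w t. Z t w) = ?G"
    have "distr M ?E (\<lambda>w (t, s). Z t w $ s) = distr (distr M ?V (\<lambda>w t. Z t w)) ?E ?\<phi>"
      by (subst distr_distr) (auto simp: comp_def)
    then show "distr M ?E (\<lambda>w (t, s). Z t w $ s) = ?N" by (simp add: L GN)
  next
    assume L: "distr M ?E (\<lambda>w (t, s). Z t w $ s) = ?N"
    have "distr M ?V (\<lambda>w t. Z t w) = distr (distr M ?E (\<lambda>w (t, s). Z t w $ s)) ?V ?\<psi>"
      by (subst distr_distr) (auto simp: comp_def)
    then show "distr M ?V (\<lambda>w t. Z t w) = ?G" by (simp add: L NG)
  qed
qed

section \<open>Projections of Gaussian vectors\<close>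

lemma distr_std_gaussian_components:
  fixes J :: "'n::finite set"
  shows "distr std_gaussian (PiM J (\<lambda>_. borel)) (\<lambda>x::real^'n. \<lambda>k\<in>J. x $ k) = PiM J (\<lambda>_. std_normal)"
proof (rule product_sigma_finite.PiM_eqI[OF product_sigma_finite_std_normal])
  have m: "(\<lambda>x::real^'n. \<lambda>k\<in>J. x $ k) \<in> measurable std_gaussian (PiM J (\<lambda>_. borel))"
    by (rule measurable_restrict) (auto cong: measurable_cong_sets)
  show "sets (distr std_gaussian (PiM J (\<lambda>_. borel)) (\<lambda>x::real^'n. \<lambda>k\<in>J. x $ k)) = sets (PiM J (\<lambda>_. std_normal))"
    by (auto intro!: sets_PiM_cong simp: sets_std_normal)
  fix A :: "'n \<Rightarrow> real set"
  assume "\<And>k. k \<in> J \<Longrightarrow> A k \<in> sets std_normal"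
  then have A: "\<And>k. k \<in> J \<Longrightarrow> A k \<in> sets borel" by (simp add: sets_std_normal)
  define A' where "A' k = (if k \<in> J then A k else UNIV)" for k
  have A': "A' k \<in> sets borel" for k using A by (simp add: A'_def)
  have P: "Pi\<^sub>E J A \<in> sets (PiM J (\<lambda>_. borel))" using A by (intro sets_PiM_I_finite) auto
  have "emeasure (distr std_gaussian (PiM J (\<lambda>_. borel)) (\<lambda>x::real^'n. \<lambda>k\<in>J. x $ k)) (Pi\<^sub>E J A)
     = emeasure std_gaussian {x :: real^'n. \<forall>k. x $ k \<in> A' k}"
    using P by (subst emeasure_distr[OF m]) (auto intro!: arg_cong2[where f = emeasure] simp: A'_def PiE_def Pi_def split: if_splits)
  also have "\<dots> = (\<Prod>k\<in>UNIV. emeasure std_normal (A' k))"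
    using A' by (rule emeasure_std_gaussian_box)
  also have "\<dots> = (\<Prod>k\<in>J. emeasure std_normal (A' k))"
    using prob_space.emeasure_space_1[OF prob_space_std_normal]
    by (intro prod.mono_neutral_right) (auto simp: A'_def)
  also have "\<dots> = (\<Prod>k\<in>J. emeasure std_normal (A k))"
    by (intro prod.cong) (auto simp: A'_def)
  finally show "emeasure (distr std_gaussian (PiM J (\<lambda>_. borel)) (\<lambda>x::real^'n. \<lambda>k\<in>J. x $ k)) (Pi\<^sub>E J A)
     = (\<Prod>k\<in>J. emeasure std_normal (A k))" .
qed simp

lemma distr_std_gaussian_projections:
  fixes q :: "'n::finite \<Rightarrow> real^'n"
  assumes "orthonormal_on J q"
  shows "distr std_gaussian (PiM J (\<lambda>_. borel)) (\<lambda>x. \<lambda>k\<in>J. x \<bullet> q k) = PiM J (\<lambda>_. std_normal)"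
proof -
  obtain y where y: "\<And>k. k \<in> J \<Longrightarrow> y k = q k" "orthonormal_on UNIV y"
    by (rule orthonormal_on_extend[OF assms]) blast
  define Q where "Q = transpose (matrix_of_columns y)"
  have Q: "orthogonal_matrix Q"
    unfolding Q_def using orthonormal_matrix_of_columns[OF y(2)] by (simp add: orthogonal_matrix_transpose)
  have Qx: "(Q *v x) $ k = x \<bullet> y k" for x k
    unfolding Q_def matrix_vector_mult_def
    by (simp add: transpose_def matrix_of_columns_def inner_vec_def mult.commute)
  have mQ: "(*v) Q \<in> measurable std_gaussian borel"
    by (auto intro!: borel_measurable_continuous_onI linear_continuous_on linear_conv_bounded_linear[THEN iffD1]
       cong: measurable_cong_sets)
  have m: "(\<lambda>x::real^'n. \<lambda>k\<in>J. x $ k) \<in> measurable borel (PiM J (\<lambda>_. borel))"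
    by (rule measurable_restrict) auto
  have "distr std_gaussian (PiM J (\<lambda>_. borel)) (\<lambda>x::real^'n. \<lambda>k\<in>J. x $ k)
     = distr (distr std_gaussian borel ((*v) Q)) (PiM J (\<lambda>_. borel)) (\<lambda>x. \<lambda>k\<in>J. x $ k)"
    unfolding distr_std_gaussian_orthogonal[OF Q] ..
  also have "\<dots> = distr std_gaussian (PiM J (\<lambda>_. borel)) (\<lambda>x. \<lambda>k\<in>J. (Q *v x) $ k)"
    by (subst distr_distr[OF m mQ]) (simp add: comp_def)
  also have "(\<lambda>x. \<lambda>k\<in>J. (Q *v x) $ k) = (\<lambda>x. \<lambda>k\<in>J. x \<bullet> q k)"
    by (auto simp: Qx y(1) restrict_def fun_eq_iff)
  finally show ?thesis unfolding distr_std_gaussian_components by (rule sym)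
qed

lemma nn_integral_std_gaussian_projections:
  fixes q :: "'n::finite \<Rightarrow> real^'n" and H :: "('n \<Rightarrow> real) \<Rightarrow> ennreal"
  assumes "orthonormal_on J q" and [measurable]: "H \<in> borel_measurable (PiM J (\<lambda>_. borel))"
  shows "(\<integral>\<^sup>+x. H (\<lambda>k\<in>J. x \<bullet> q k) \<partial>std_gaussian) = (\<integral>\<^sup>+e. H e \<partial>PiM J (\<lambda>_. std_normal))"
proof -
  have m: "(\<lambda>x::real^'n. \<lambda>k\<in>J. x \<bullet> q k) \<in> measurable std_gaussian (PiM J (\<lambda>_. borel))"
    by (rule measurable_restrict) (auto cong: measurable_cong_sets)
  show ?thesis
    unfolding distr_std_gaussian_projections[OF assms(1), symmetric]
    by (subst nn_integral_distr[OF m]) auto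
qed

lemma sets_PiM_std_normal [measurable_cong]: "sets (PiM J (\<lambda>_. std_normal)) = sets (PiM J (\<lambda>_. borel))"
  by (intro sets_PiM_cong) (auto simp: sets_std_normal)

text \<open>
  Half the squared norm of the projection of a standard Gaussian vector onto a space of dimension \<open>card J\<close>
  has a Gamma law with shape \<open>card J / 2\<close>.
\<close>

lemma nn_integral_std_gaussian_norm_projection:
  fixes q :: "'n::finite \<Rightarrow> real^'n" and h :: "real \<Rightarrow> ennreal"
  assumes q: "orthonormal_on J q" and J: "J \<noteq> {}" and [measurable]: "h \<in> borel_measurable borel"
  shows "(\<integral>\<^sup>+x. h ((\<Sum>k\<in>J. (x \<bullet> q k)\<^sup>2) / 2) \<partial>std_gaussian)
     = (\<integral>\<^sup>+r. h r * ennreal (gamma_density (real (card J) / 2) r) \<partial>lborel)"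
proof -
  have "(\<integral>\<^sup>+x. h ((\<Sum>k\<in>J. (x \<bullet> q k)\<^sup>2) / 2) \<partial>std_gaussian)
      = (\<integral>\<^sup>+e. h ((\<Sum>k\<in>J. (e k)\<^sup>2) / 2) \<partial>PiM J (\<lambda>_. std_normal))"
    by (subst nn_integral_std_gaussian_projections[OF q, symmetric]) auto
  also have "\<dots> = (\<integral>\<^sup>+r. h r * ennreal (gamma_density (real (card J) / 2) r) \<partial>lborel)"
    using J by (intro nn_integral_sum_squares_std_normal) auto
  finally show ?thesis .
qed

text \<open>
  The component along \<open>q k0\<close> is standard normal and independent of the projection onto the span of the
  \<open>q k\<close> with \<open>k \<in> J\<close>.
\<close>

lemma nn_integral_std_gaussian_coordinate_norm:
  fixes q :: "'n::finite \<Rightarrow> real^'n" and H :: "real \<Rightarrow> real \<Rightarrow> ennreal"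
  assumes q: "orthonormal_on (insert k0 J) q" and J: "J \<noteq> {}" "k0 \<notin> J"
    and [measurable]: "(\<lambda>(z, v). H z v) \<in> borel_measurable (borel \<Otimes>\<^sub>M borel)"
  shows "(\<integral>\<^sup>+x. H (x \<bullet> q k0) ((\<Sum>k\<in>J. (x \<bullet> q k)\<^sup>2) / 2) \<partial>std_gaussian)
     = (\<integral>\<^sup>+v. (\<integral>\<^sup>+z. H z v \<partial>std_normal) * ennreal (gamma_density (real (card J) / 2) v) \<partial>lborel)"
proof -
  interpret product_sigma_finite "\<lambda>_::'n. std_normal" by (rule product_sigma_finite_std_normal)
  interpret N: prob_space std_normal by (rule prob_space_std_normal)
  have "(\<integral>\<^sup>+x. H (x \<bullet> q k0) ((\<Sum>k\<in>J. (x \<bullet> q k)\<^sup>2) / 2) \<partial>std_gaussian)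
      = (\<integral>\<^sup>+e. H (e k0) ((\<Sum>k\<in>J. (e k)\<^sup>2) / 2) \<partial>PiM (insert k0 J) (\<lambda>_. std_normal))"
    by (subst nn_integral_std_gaussian_projections[OF q, symmetric]) auto
  also have "\<dots> = (\<integral>\<^sup>+e. (\<integral>\<^sup>+z. H ((e(k0 := z)) k0) ((\<Sum>k\<in>J. ((e(k0 := z)) k)\<^sup>2) / 2) \<partial>std_normal) \<partial>PiM J (\<lambda>_. std_normal))"
    using J by (intro product_nn_integral_insert) auto
  also have "\<dots> = (\<integral>\<^sup>+e. (\<integral>\<^sup>+z. H z ((\<Sum>k\<in>J. (e k)\<^sup>2) / 2) \<partial>std_normal) \<partial>PiM J (\<lambda>_. std_normal))"
  proof -
    have "(\<Sum>k\<in>J. ((e(k0 := z)) k)\<^sup>2) = (\<Sum>k\<in>J. (e k)\<^sup>2)" for e :: "'n \<Rightarrow> real" and z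
      using J by (intro sum.cong) auto
    then show ?thesis by simp
  qed
  also have "\<dots> = (\<integral>\<^sup>+v. (\<integral>\<^sup>+z. H z v \<partial>std_normal) * ennreal (gamma_density (real (card J) / 2) v) \<partial>lborel)"
    using J by (intro nn_integral_sum_squares_std_normal) auto
  finally show ?thesis .
qed

section \<open>Almost sure linear independence of Gaussian rows\<close>

lemma AE_std_gaussian_not_in_subspace:
  fixes S :: "(real^'n) set"
  assumes "dim S < CARD('n)"
  shows "AE x in std_gaussian. x \<notin> span S"
proof -
  have "negligible (span S)" using assms by (intro negligible_lowdim) simp
  moreover have "span S \<in> sets borel" by (intro borel_closed closed_span)
  ultimately have "span S \<in> null_sets lborel"
    by (simp add: negligible_iff_null_sets null_sets_completion_iff)
  then have "AE x in lborel. x \<notin> span S" by (rule AE_not_in)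
  then show ?thesis unfolding std_gaussian_def by (subst AE_density) auto
qed

lemma lin_indep_family_insert:
  fixes z :: "'i \<Rightarrow> 'v::real_vector"
  assumes I: "finite I" "a \<notin> I" and ind: "lin_indep_family I z" and za: "z a \<notin> span (z ` I)"
  shows "lin_indep_family (insert a I) z"
  unfolding lin_indep_family_def
proof (intro allI impI)
  fix c assume "(\<Sum>i\<in>insert a I. c i *\<^sub>R z i) = 0"
  then have s: "c a *\<^sub>R z a + (\<Sum>i\<in>I. c i *\<^sub>R z i) = 0" using I by simp
  have "c a = 0"
  proof (rule ccontr)
    assume "c a \<noteq> 0"
    have "c a *\<^sub>R z a = - (\<Sum>i\<in>I. c i *\<^sub>R z i)" using s by (simp add: add_eq_0_iff)
    then have "(1 / c a) *\<^sub>R (c a *\<^sub>R z a) = (- 1 / c a) *\<^sub>R (\<Sum>i\<in>I. c i *\<^sub>R z i)" by simp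
    then have "z a = (- 1 / c a) *\<^sub>R (\<Sum>i\<in>I. c i *\<^sub>R z i)" using \<open>c a \<noteq> 0\<close> by simp
    also have "\<dots> \<in> span (z ` I)" by (intro span_scale span_sum span_base) auto
    finally show False using za by simp
  qed
  then show "\<forall>i\<in>insert a I. c i = 0" using s ind by (auto simp: lin_indep_family_def)
qed

lemma lin_indep_family_cong:
  "(\<And>i. i \<in> I \<Longrightarrow> z i = z' i) \<Longrightarrow> lin_indep_family I z \<longleftrightarrow> lin_indep_family I z'"
  unfolding lin_indep_family_def by (simp cong: sum.cong)

lemma dim_lin_indep_family:
  fixes z :: "'i \<Rightarrow> 'v::euclidean_space"
  assumes I: "finite I" and ind: "lin_indep_family I z"
  shows "dim (z ` I) = card I"
proof -
  have inj: "inj_on z I"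
  proof (rule inj_onI, rule ccontr)
    fix a b assume ab: "a \<in> I" "b \<in> I" "z a = z b" "a \<noteq> b"
    have "(\<Sum>i\<in>I. (of_bool (i = a) - of_bool (i = b)) *\<^sub>R z i)
       = (\<Sum>i\<in>I. (if i = a then z i else 0)) - (\<Sum>i\<in>I. (if i = b then z i else 0))"
      by (simp add: sum_subtractf[symmetric] scaleR_diff_left) (auto intro!: sum.cong)
    also have "\<dots> = 0" using ab I by simp
    finally have "\<forall>i\<in>I. (of_bool (i = a) - of_bool (i = b) :: real) = 0"
      using ind[unfolded lin_indep_family_def, THEN spec, of "\<lambda>i. of_bool (i = a) - of_bool (i = b)"] by blast
    then show False using ab by (auto dest: bspec[of _ _ a])
  qed
  have "independent (z ` I)"
    unfolding independent_explicit_finite_subsets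
  proof (intro allI impI)
    fix A u assume A: "A \<subseteq> z ` I" "finite A" "(\<Sum>v\<in>A. u v *\<^sub>R v) = 0"
    obtain I' where I': "I' \<subseteq> I" "A = z ` I'" using A(1) by (auto simp: subset_image_iff)
    have inj': "inj_on z I'" using inj I'(1) by (rule inj_on_subset)
    have "(\<Sum>i\<in>I. (if i \<in> I' then u (z i) else 0) *\<^sub>R z i) = (\<Sum>i\<in>I'. u (z i) *\<^sub>R z i)"
      using I I'(1) by (intro sum.mono_neutral_cong_right) auto
    also have "\<dots> = 0" using A(3) inj' by (simp add: I'(2) sum.reindex)
    finally have "\<forall>i\<in>I. (if i \<in> I' then u (z i) else 0) = 0"
      using ind[unfolded lin_indep_family_def, THEN spec, of "\<lambda>i. if i \<in> I' then u (z i) else 0"] by blast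
    then have "u (z i) = 0" if "i \<in> I'" for i
      using that I'(1) by (metis subsetD)
    then show "\<forall>v\<in>A. u v = 0" using I'(2) by auto
  qed
  then show ?thesis using inj by (simp add: dim_eq_card_independent card_image)
qed

text \<open>
  The Gram matrix of the vectors with index in \<open>I\<close>, completed to a square matrix over the whole index type by a unit
  block. Its determinant detects linear independence, which makes that property measurable.
\<close>

definition padded_gram :: "'n set \<Rightarrow> ('n \<Rightarrow> 'v::real_inner) \<Rightarrow> real^'n^'n" where
  "padded_gram I z = (\<chi> a b. if a \<in> I \<and> b \<in> I then z a \<bullet> z b else of_bool (a = b))"

lemma padded_gram_mult_vec:
  fixes z :: "'n::finite \<Rightarrow> 'v::real_inner"
  shows "(padded_gram I z *v c) $ a = (if a \<in> I then z a \<bullet> (\<Sum>b\<in>I. c $ b *\<^sub>R z b) else c $ a)"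
proof -
  have "(padded_gram I z *v c) $ a = (\<Sum>b\<in>UNIV. (if a \<in> I \<and> b \<in> I then z a \<bullet> z b else of_bool (a = b)) * c $ b)"
    by (simp add: padded_gram_def matrix_vector_mult_def)
  also have "\<dots> = (if a \<in> I then z a \<bullet> (\<Sum>b\<in>I. c $ b *\<^sub>R z b) else c $ a)"
  proof (cases "a \<in> I")
    case True
    have "(\<Sum>b\<in>UNIV. (if a \<in> I \<and> b \<in> I then z a \<bullet> z b else of_bool (a = b)) * c $ b) = (\<Sum>b\<in>I. (z a \<bullet> z b) * c $ b)"
      using True by (intro sum.mono_neutral_cong_right) auto
    then show ?thesis using True by (simp add: inner_sum_right mult.commute)
  next
    case False
    have "(\<Sum>b\<in>UNIV. (if a \<in> I \<and> b \<in> I then z a \<bullet> z b else of_bool (a = b)) * c $ b) = (\<Sum>b\<in>UNIV. if b = a then c $ b else 0)"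
      using False by (intro sum.cong) auto
    then show ?thesis using False by simp
  qed
  finally show ?thesis .
qed

lemma lin_indep_family_iff_det:
  fixes z :: "'n::finite \<Rightarrow> 'v::real_inner"
  shows "lin_indep_family I z \<longleftrightarrow> det (padded_gram I z) \<noteq> 0"
proof -
  have "det (padded_gram I z) \<noteq> 0 \<longleftrightarrow> (\<forall>c. padded_gram I z *v c = 0 \<longrightarrow> c = 0)"
    using invertible_det_nz[of "padded_gram I z"] matrix_left_invertible_ker[of "padded_gram I z"]
      invertible_left_inverse[of "padded_gram I z"] by blast
  also have "\<dots> \<longleftrightarrow> lin_indep_family I z"
  proof
    assume *: "\<forall>c. padded_gram I z *v c = 0 \<longrightarrow> c = 0"
    show "lin_indep_family I z"
      unfolding lin_indep_family_def
    proof (intro allI impI ballI)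
      fix c i assume c: "(\<Sum>i\<in>I. c i *\<^sub>R z i) = 0" and i: "i \<in> I"
      let ?c = "\<chi> i. if i \<in> I then c i else 0"
      have "(\<Sum>b\<in>I. ?c $ b *\<^sub>R z b) = 0" using c by (simp cong: sum.cong)
      then have "padded_gram I z *v ?c = 0" by (simp add: vec_eq_iff padded_gram_mult_vec)
      then have "?c = 0" using * by blast
      then have "?c $ i = 0" by simp
      then show "c i = 0" using i by simp
    qed
  next
    assume ind: "lin_indep_family I z"
    show "\<forall>c. padded_gram I z *v c = 0 \<longrightarrow> c = 0"
    proof (intro allI impI)
      fix c assume "padded_gram I z *v c = 0"
      then have a: "(if a \<in> I then z a \<bullet> (\<Sum>b\<in>I. c $ b *\<^sub>R z b) else c $ a) = 0" for a
        by (simp flip: padded_gram_mult_vec)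
      have "(\<Sum>b\<in>I. c $ b *\<^sub>R z b) \<bullet> (\<Sum>b\<in>I. c $ b *\<^sub>R z b)
          = (\<Sum>a\<in>I. c $ a * (z a \<bullet> (\<Sum>b\<in>I. c $ b *\<^sub>R z b)))"
        by (simp add: inner_sum_left)
      also have "\<dots> = 0"
      proof (intro sum.neutral ballI)
        fix k assume "k \<in> I"
        then have "z k \<bullet> (\<Sum>b\<in>I. c $ b *\<^sub>R z b) = 0" using a[of k] by simp
        then show "c $ k * (z k \<bullet> (\<Sum>b\<in>I. c $ b *\<^sub>R z b)) = 0" by simp
      qed
      finally have "(\<Sum>b\<in>I. c $ b *\<^sub>R z b) = 0" by simp
      then have "\<forall>b\<in>I. c $ b = 0"
        using ind[unfolded lin_indep_family_def, THEN spec, of "\<lambda>b. c $ b"] by blast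
      then have "c $ b = 0" for b using a[of b] by (cases "b \<in> I") auto
      then show "c = 0" by (simp add: vec_eq_iff)
    qed
  qed
  finally show ?thesis by simp
qed

lemma borel_measurable_det [measurable (raw)]:
  fixes A :: "'a \<Rightarrow> real^'n^'n"
  assumes "\<And>i j. (\<lambda>w. A w $ i $ j) \<in> borel_measurable M"
  shows "(\<lambda>w. det (A w)) \<in> borel_measurable M"
  unfolding det_def using assms by (auto intro!: borel_measurable_sum borel_measurable_times borel_measurable_prod)

lemma sets_lin_indep_family:
  fixes I J :: "'n::finite set"
  assumes "I \<subseteq> J"
  shows "{x \<in> space (PiM J (\<lambda>_. std_gaussian :: (real^'t) measure)). lin_indep_family I x} \<in> sets (PiM J (\<lambda>_. std_gaussian))"
proof -
  have "(\<lambda>x. padded_gram I x $ a $ b) \<in> borel_measurable (PiM J (\<lambda>_. std_gaussian :: (real^'t) measure))" for a b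
  proof (cases "a \<in> I \<and> b \<in> I")
    case True
    then have m: "(\<lambda>x. x a) \<in> borel_measurable (PiM J (\<lambda>_. std_gaussian :: (real^'t) measure))"
         "(\<lambda>x. x b) \<in> borel_measurable (PiM J (\<lambda>_. std_gaussian :: (real^'t) measure))"
      using assms measurable_component_singleton[of a J "\<lambda>_. std_gaussian"] measurable_component_singleton[of b J "\<lambda>_. std_gaussian"]
      by (auto cong: measurable_cong_sets)
    show ?thesis using True by (simp add: padded_gram_def borel_measurable_inner[OF m])
  next
    case False
    then have "(\<lambda>x :: 'n \<Rightarrow> real^'t. padded_gram I x $ a $ b) = (\<lambda>_. of_bool (a = b))"
      by (auto simp: padded_gram_def fun_eq_iff)
    then show ?thesis by simp
  qed
  then have "(\<lambda>x. det (padded_gram I x)) \<in> borel_measurable (PiM J (\<lambda>_. std_gaussian :: (real^'t) measure))"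
    by (rule borel_measurable_det)
  then show ?thesis unfolding lin_indep_family_iff_det by measurable
qed

lemma AE_lin_indep_family:
  fixes I :: "'n::finite set"
  assumes "card I \<le> CARD('t)"
  shows "AE x in PiM I (\<lambda>_. std_gaussian :: (real^'t) measure). lin_indep_family I x"
  using finite[of I] assms
proof (induction I rule: finite_induct)
  case empty
  show ?case by (simp add: lin_indep_family_def)
next
  case (insert a I)
  interpret product_sigma_finite "\<lambda>_::'n. std_gaussian :: (real^'t) measure"
    by (rule product_sigma_finite_std_gaussian)
  let ?P = "\<lambda>J. PiM J (\<lambda>_::'n. std_gaussian :: (real^'t) measure)"
  let ?S = "{x \<in> space (?P (insert a I)). lin_indep_family (insert a I) x}"
  have S[measurable]: "space (?P (insert a I)) - ?S \<in> sets (?P (insert a I))"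
    by (intro sets.compl_sets sets_lin_indep_family subset_refl)
  have IH: "AE x in ?P I. lin_indep_family I x" using insert by simp
  have "emeasure (?P (insert a I)) (space (?P (insert a I)) - ?S)
     = (\<integral>\<^sup>+x. indicator (space (?P (insert a I)) - ?S) x \<partial>?P (insert a I))"
    by simp
  also have "\<dots> = (\<integral>\<^sup>+x. (\<integral>\<^sup>+y. indicator (space (?P (insert a I)) - ?S) (x(a := y)) \<partial>std_gaussian) \<partial>?P I)"
    using insert by (intro product_nn_integral_insert) auto
  also have "\<dots> = (\<integral>\<^sup>+x. 0 \<partial>?P I)"
  proof (rule nn_integral_cong_AE, use IH in eventually_elim)
    fix x :: "'n \<Rightarrow> real^'t"
    assume x: "lin_indep_family I x"
    have "dim (x ` I) < CARD('t)"
      using dim_lin_indep_family[OF insert(1) x] insert by simp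
    then have "AE y in std_gaussian. y \<notin> span (x ` I)" by (rule AE_std_gaussian_not_in_subspace)
    then have "AE y in std_gaussian. indicator (space (?P (insert a I)) - ?S) (x(a := y)) = (0::ennreal)"
    proof eventually_elim
      fix y assume y: "y \<notin> span (x ` I)"
      have im: "(x(a := y)) ` I = x ` I" using insert by auto
      have "lin_indep_family I (x(a := y))"
        using x insert(2) by (subst lin_indep_family_cong[of I _ x]) auto
      then have "lin_indep_family (insert a I) (x(a := y))"
      proof (rule lin_indep_family_insert[OF insert(1,2)])
        show "(x(a := y)) a \<notin> span ((x(a := y)) ` I)" unfolding im using y by simp
      qed
      then show "indicator (space (?P (insert a I)) - ?S) (x(a := y)) = (0::ennreal)"
        by (auto simp: indicator_def)
    qed
    then show "(\<integral>\<^sup>+y. indicator (space (?P (insert a I)) - ?S) (x(a := y)) \<partial>std_gaussian) = 0"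
      by (rule nn_integral_zero')
  qed
  finally have "emeasure (?P (insert a I)) (space (?P (insert a I)) - ?S) = 0" by simp
  then show ?case using S by (intro AE_I[of _ _ "space (?P (insert a I)) - ?S"]) auto
qed

section \<open>The law of the ratio for independent Gaussian rows\<close>

text \<open>
  The density of \<open>(\<tau> * sqrt (2 * r) - z)\<^sup>2 / 2 / v\<close> for independent \<open>r\<close>, \<open>v\<close>, \<open>z\<close> with laws \<open>Gamma(a)\<close>, \<open>Gamma(b)\<close> and
  \<open>N(0, 1)\<close>, where \<open>l = \<tau>\<^sup>2\<close>. It takes values in the extended nonnegative reals, so no convergence is required.
\<close>

definition noncentral_ratio_density :: "real \<Rightarrow> real \<Rightarrow> real \<Rightarrow> real \<Rightarrow> ennreal" where
  "noncentral_ratio_density a b l y = (\<Sum>k. ennreal (mixture_weight a l k * beta_prime_density (real k + 1/2) b y))"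

text \<open>
  The integral over the row \<open>i\<close>, all other rows being fixed: \<open>y\<close> is the row \<open>j\<close>, and the \<open>v k\<close> with \<open>k \<in> I\<close> form an
  orthonormal basis of the span of the remaining rows. The result depends on the fixed rows only
  through the norm \<open>sqrt (\<Sum>k\<in>- I. (y \<bullet> v k)\<^sup>2)\<close> of the projection of \<open>y\<close> onto the orthogonal complement of that span.
\<close>

lemma nn_integral_gram_inverse_ratio_last_row:
  fixes x :: "'n::finite \<Rightarrow> real^'t" and F :: "('n \<Rightarrow> real^'t) \<Rightarrow> ennreal" and h :: "real \<Rightarrow> ennreal"
    and v :: "'t \<Rightarrow> real^'t"
  assumes ij: "i \<noteq> j" and n: "CARD('n) < CARD('t)"
    and [measurable]: "h \<in> borel_measurable borel"
    and F: "\<And>z. lin_indep_family UNIV z \<Longrightarrow> F z = h ((\<tau> * matrix_inv (gram z) $ i $ i + matrix_inv (gram z) $ i $ j)\<^sup>2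
        / (matrix_inv (gram z) $ i $ i * matrix_inv (gram z) $ j $ j - matrix_inv (gram z) $ i $ j * matrix_inv (gram z) $ i $ j))"
    and x: "lin_indep_family (UNIV - {i, j}) x"
    and v: "orthonormal_on UNIV v" and I: "card I = CARD('n) - 2" and spanI: "span (v ` I) = span (x ` (UNIV - {i, j}))"
    and y: "y \<notin> span (x ` (UNIV - {i, j}))"
  shows "(\<integral>\<^sup>+y'. F (x(j := y, i := y')) \<partial>std_gaussian)
     = (\<integral>\<^sup>+r. (\<integral>\<^sup>+z. h ((\<tau> * sqrt (2 * ((\<Sum>k\<in>- I. (y \<bullet> v k)\<^sup>2) / 2)) - z)\<^sup>2 / 2 / r) \<partial>std_normal)
          * ennreal (gamma_density (real (CARD('t) - CARD('n) + 1) / 2) r) \<partial>lborel)"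
proof -
  let ?W = "UNIV - {i, j}"
  have n2: "CARD('n) \<ge> 2" using ij card_mono[of "UNIV::'n set" "{i, j}"] by simp
  have vv: "v k \<bullet> v l = of_bool (k = l)" for k l using v by (simp add: orthonormal_on_def)
  define S where "S = (\<Sum>k\<in>- I. (y \<bullet> v k)\<^sup>2)"
  define s where "s = sqrt S"
  define P where "P = (\<Sum>k\<in>- I. (y \<bullet> v k) *\<^sub>R v k)"
  have PP: "P \<bullet> P = S"
    by (simp add: P_def S_def inner_sum_left inner_sum_right vv power2_eq_square
        sum.delta of_bool_def if_distrib cong: if_cong)
  have S0: "S \<ge> 0" unfolding S_def by (intro sum_nonneg) auto
  have yP: "y = (\<Sum>k\<in>I. (y \<bullet> v k) *\<^sub>R v k) + P"
  proof -
    have "y = (\<Sum>k\<in>I \<union> - I. (y \<bullet> v k) *\<^sub>R v k)"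
      using orthonormal_expansion[OF v, of y] by simp
    also have "\<dots> = (\<Sum>k\<in>I. (y \<bullet> v k) *\<^sub>R v k) + P"
      unfolding P_def by (rule sum.union_disjoint) auto
    finally show ?thesis .
  qed
  have cI: "(\<Sum>k\<in>I. c k *\<^sub>R v k) \<in> span (v ` I)" for c
    by (intro span_sum span_scale span_base) auto
  have "P \<noteq> 0"
  proof
    assume "P = 0"
    then have "y \<in> span (v ` I)" using yP cI by (metis add.right_neutral)
    then show False using y spanI by simp
  qed
  then have S: "S > 0" using PP S0 by (metis inner_eq_zero_iff order_le_less)
  then have s: "s > 0" by (simp add: s_def)
  have ss: "s * s = S" using S by (simp add: s_def)
  have "card I < CARD('t)" using I n by simp
  then have "I \<noteq> UNIV" by auto
  then obtain k0 where k0: "k0 \<notin> I" by auto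
  \<comment> \<open>The orthonormal basis \<open>v\<close> is adapted to \<open>y\<close>: the direction of \<open>P\<close> becomes a basis vector.\<close>
  define q0 where "q0 k = (if k = k0 then (1/s) *\<^sub>R P else v k)" for k
  have vP: "v k \<bullet> P = 0" if "k \<in> I" for k
    using that by (auto simp: P_def inner_sum_right vv intro!: sum.neutral)
  then have Pv: "P \<bullet> v k = 0" if "k \<in> I" for k
    using that by (simp add: inner_commute)
  have q0_k0: "q0 k0 \<bullet> q0 k0 = 1"
    using s S by (simp add: q0_def PP ss)
  have q0_I: "q0 k \<bullet> q0 k0 = 0" "q0 k0 \<bullet> q0 k = 0" "q0 k = v k" if "k \<in> I" for k
    using that k0 vP[OF that] Pv[OF that] by (auto simp: q0_def)
  have q0_v: "q0 k \<bullet> q0 l = of_bool (k = l)" if "k \<in> I" "l \<in> I" for k l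
    using that by (simp add: q0_I(3) vv)
  have "orthonormal_on (insert k0 I) q0"
    unfolding orthonormal_on_def
  proof (intro ballI)
    fix k l assume "k \<in> insert k0 I" "l \<in> insert k0 I"
    then consider "k = k0" "l = k0" | "k = k0" "l \<in> I" | "k \<in> I" "l = k0" | "k \<in> I" "l \<in> I" by blast
    then show "q0 k \<bullet> q0 l = of_bool (k = l)"
      by cases (use k0 in \<open>auto simp: q0_k0 q0_I(1,2) q0_v\<close>)
  qed
  then obtain q where q: "\<And>k. k \<in> insert k0 I \<Longrightarrow> q k = q0 k" "orthonormal_on UNIV q"
    by (rule orthonormal_on_extend) blast
  have qI: "q ` I = v ` I" using q(1) k0 by (intro image_cong) (auto simp: q0_def)
  have sqk: "s *\<^sub>R q k0 = P" using q(1)[of k0] s by (simp add: q0_def)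
  define J where "J = UNIV - insert k0 I"
  have cJ: "card J = CARD('t) - CARD('n) + 1"
  proof -
    have "card (insert k0 I) = CARD('n) - 1" using k0 I n2 by simp
    then show ?thesis unfolding J_def using n n2 by (subst card_Diff_subset) auto
  qed
  have "card J \<noteq> 0" using cJ by simp
  then have J: "J \<noteq> {}" "k0 \<notin> J" by (auto simp: J_def)
  define H where "H z r = h ((\<tau> * s - z)\<^sup>2 / 2 / r)" for z r
  have W': "UNIV = insert i (insert j ?W)" by auto
  let ?xj = "x(j := y)"
  have xW: "?xj ` ?W = x ` ?W" by auto
  have indj: "lin_indep_family (insert j ?W) ?xj"
  proof (rule lin_indep_family_insert)
    show "lin_indep_family ?W ?xj" using x by (subst lin_indep_family_cong[of ?W _ x]) auto
    show "?xj j \<notin> span (?xj ` ?W)" using y xW by simp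
  qed auto
  have "dim (?xj ` insert j ?W) = card (insert j ?W)" by (rule dim_lin_indep_family[OF _ indj]) simp
  also have "\<dots> < CARD('t)"
    using n card_mono[of "UNIV :: 'n set" "insert j ?W"] by simp
  finally have "AE y' in std_gaussian. y' \<notin> span (?xj ` insert j ?W)"
    by (rule AE_std_gaussian_not_in_subspace)
  then have "AE y' in std_gaussian. F (x(j := y, i := y')) = H (y' \<bullet> q k0) ((\<Sum>k\<in>J. (y' \<bullet> q k)\<^sup>2) / 2)"
  proof eventually_elim
    fix y' assume y': "y' \<notin> span (?xj ` insert j ?W)"
    let ?z = "x(j := y, i := y')"
    have iW: "i \<notin> insert j ?W" using ij by auto
    have im: "?z ` insert j ?W = ?xj ` insert j ?W" using ij by auto
    have ind: "lin_indep_family UNIV ?z"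
    proof (subst W', rule lin_indep_family_insert)
      show "lin_indep_family (insert j ?W) ?z"
        using indj iW by (subst lin_indep_family_cong[of "insert j ?W" _ ?xj]) auto
      show "?z i \<notin> span (?z ` insert j ?W)" unfolding im using y' by simp
    qed (use iW in auto)
    have zW: "span (q ` I) = span (?z ` ?W)"
      unfolding qI spanI by (rule arg_cong[where f = span]) auto
    have zj: "?z j - s *\<^sub>R q k0 \<in> span (q ` I)"
    proof -
      have "?z j = y" using ij by simp
      moreover have "y - P = (\<Sum>k\<in>I. (y \<bullet> v k) *\<^sub>R v k)" by (rule diff_eq_eq[THEN iffD2, OF yP])
      ultimately show ?thesis unfolding sqk qI using cI by (simp only:)
    qed
    let ?R = "\<Sum>k\<in>J. (y' \<bullet> q k)\<^sup>2"
    note G = inverse_gram_entries_orthonormal[OF ind ij q(2) k0 zW zj less_imp_neq[OF s, symmetric], folded J_def, simplified fun_upd_same]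
    have R: "?R > 0" using G(1) .
    have "F ?z = h ((\<tau> * (1 / ?R) + - (y' \<bullet> q k0) / (s * ?R))\<^sup>2 / (1 / (?R * s\<^sup>2)))"
      unfolding F[OF ind] unfolding G(3) unfolding G(2,4) by (rule refl)
    also have "\<tau> * (1 / ?R) + - (y' \<bullet> q k0) / (s * ?R) = (\<tau> * s - y' \<bullet> q k0) / (s * ?R)"
      using s R by (simp add: field_simps)
    also have "((\<tau> * s - y' \<bullet> q k0) / (s * ?R))\<^sup>2 / (1 / (?R * s\<^sup>2)) = (\<tau> * s - y' \<bullet> q k0)\<^sup>2 / 2 / (?R / 2)"
      using s R by (simp add: power_divide power_mult_distrib) (simp add: power2_eq_square)
    finally show "F ?z = H (y' \<bullet> q k0) (?R / 2)" unfolding H_def .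
  qed
  then have "(\<integral>\<^sup>+y'. F (x(j := y, i := y')) \<partial>std_gaussian)
      = (\<integral>\<^sup>+y'. H (y' \<bullet> q k0) ((\<Sum>k\<in>J. (y' \<bullet> q k)\<^sup>2) / 2) \<partial>std_gaussian)"
    by (rule nn_integral_cong_AE)
  also have "\<dots> = (\<integral>\<^sup>+r. (\<integral>\<^sup>+z. H z r \<partial>std_normal) * ennreal (gamma_density (real (card J) / 2) r) \<partial>lborel)"
  proof (rule nn_integral_std_gaussian_coordinate_norm)
    show "orthonormal_on (insert k0 J) q" using q(2) by (auto simp: orthonormal_on_def)
    show "(\<lambda>(z, v). H z v) \<in> borel_measurable (borel \<Otimes>\<^sub>M borel)"
      unfolding H_def by measurable
  qed (use J in auto)
  finally show ?thesis by (simp add: cJ H_def s_def S_def)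
qed

text \<open>
  The law of \<open>(\<tau> u\<^sub>i\<^sub>i + u\<^sub>i\<^sub>j)\<^sup>2 / (u\<^sub>i\<^sub>i u\<^sub>j\<^sub>j - u\<^sub>i\<^sub>j\<^sup>2)\<close> for the inverse Gram matrix of independent standard Gaussian rows. The
  function \<open>F\<close> is prescribed only on linearly independent families, which is where the inverse exists.
\<close>

lemma nn_integral_gram_inverse_ratio:
  fixes F :: "('n::finite \<Rightarrow> real^'t) \<Rightarrow> ennreal" and h :: "real \<Rightarrow> ennreal"
  assumes ij: "i \<noteq> j" and n: "CARD('n) < CARD('t)"
    and h[measurable]: "h \<in> borel_measurable borel"
    and Fm[measurable]: "F \<in> borel_measurable (PiM UNIV (\<lambda>_. borel))"
    and F: "\<And>z. lin_indep_family UNIV z \<Longrightarrow> F z = h ((\<tau> * matrix_inv (gram z) $ i $ i + matrix_inv (gram z) $ i $ j)\<^sup>2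
        / (matrix_inv (gram z) $ i $ i * matrix_inv (gram z) $ j $ j - matrix_inv (gram z) $ i $ j * matrix_inv (gram z) $ i $ j))"
  shows "(\<integral>\<^sup>+z. F z \<partial>PiM UNIV (\<lambda>_. std_gaussian))
     = (\<integral>\<^sup>+y. h y * noncentral_ratio_density (real (CARD('t) - CARD('n) + 2) / 2)
          (real (CARD('t) - CARD('n) + 1) / 2) (\<tau>\<^sup>2) y \<partial>lborel)"
    (is "_ = ?D")
proof -
  interpret product_sigma_finite "\<lambda>_::'n. std_gaussian :: (real^'t) measure"
    by (rule product_sigma_finite_std_gaussian)
  interpret G: prob_space "std_gaussian :: (real^'t) measure" by (rule prob_space_std_gaussian)
  let ?P = "\<lambda>J. PiM J (\<lambda>_::'n. std_gaussian :: (real^'t) measure)"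
  let ?W = "UNIV - {i, j}"
  have n2: "CARD('n) \<ge> 2" using ij card_mono[of "UNIV::'n set" "{i, j}"] by simp
  have W': "(UNIV :: 'n set) = insert i (insert j ?W)" by auto
  have iW: "i \<notin> insert j ?W" "j \<notin> ?W" using ij by auto
  have F1: "F \<in> borel_measurable (?P (insert i (insert j ?W)))"
    using Fm unfolding W'[symmetric] by (simp cong: measurable_cong_sets sets_PiM_std_gaussian)
  have F2: "(\<lambda>z. \<integral>\<^sup>+y'. F (z(i := y')) \<partial>std_gaussian) \<in> borel_measurable (?P (insert j ?W))"
  proof -
    have "(\<lambda>(z, y'). z(i := y')) \<in> measurable (?P (insert j ?W) \<Otimes>\<^sub>M std_gaussian) (?P (insert i (insert j ?W)))"
      by (rule measurable_add_dim)
    then have "(\<lambda>(z, y'). F (z(i := y'))) \<in> borel_measurable (?P (insert j ?W) \<Otimes>\<^sub>M std_gaussian)"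
      using F1 by (simp add: split_beta' measurable_compose)
    then show ?thesis by measurable
  qed
  \<comment> \<open>Integrate over row \<open>i\<close> first, then over row \<open>j\<close>, then over the rest.\<close>
  have "(\<integral>\<^sup>+z. F z \<partial>?P UNIV) = (\<integral>\<^sup>+z. F z \<partial>?P (insert i (insert j ?W)))"
    using W' by simp
  also have "\<dots> = (\<integral>\<^sup>+z. (\<integral>\<^sup>+y'. F (z(i := y')) \<partial>std_gaussian) \<partial>?P (insert j ?W))"
    using iW F1 by (intro product_nn_integral_insert) auto
  also have "\<dots> = (\<integral>\<^sup>+x. (\<integral>\<^sup>+y. (\<integral>\<^sup>+y'. F (x(j := y, i := y')) \<partial>std_gaussian) \<partial>std_gaussian) \<partial>?P ?W)"
    using iW F2 by (intro product_nn_integral_insert) auto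
  also have "\<dots> = (\<integral>\<^sup>+x. ?D \<partial>?P ?W)"
  proof (rule nn_integral_cong_AE)
    have cW: "card ?W = CARD('n) - 2" using ij by (subst card_Diff_subset) auto
    have "AE x in ?P ?W. lin_indep_family ?W x"
      using cW n by (intro AE_lin_indep_family) simp
    then show "AE x in ?P ?W. (\<integral>\<^sup>+y. (\<integral>\<^sup>+y'. F (x(j := y, i := y')) \<partial>std_gaussian) \<partial>std_gaussian) = ?D"
    proof eventually_elim
      fix x :: "'n \<Rightarrow> real^'t"
      assume x: "lin_indep_family ?W x"
      have dW: "dim (x ` ?W) = CARD('n) - 2" using dim_lin_indep_family[OF _ x] cW by simp
      have "CARD('n) - 2 \<le> CARD('t)" using n by simp
      then obtain I :: "'t set" where I: "card I = CARD('n) - 2"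
        using obtain_subset_with_card_n[of "CARD('n) - 2" "UNIV :: 't set"] by blast
      obtain v0 where v0: "orthonormal_on I v0" "span (v0 ` I) = span (x ` ?W)"
        using orthonormal_family_of_subspace[of "span (x ` ?W)" I] dW I by auto
      obtain v where v: "\<And>k. k \<in> I \<Longrightarrow> v k = v0 k" "orthonormal_on UNIV v"
        by (rule orthonormal_on_extend[OF v0(1)]) blast
      have vI: "span (v ` I) = span (x ` ?W)" using v(1) v0(2) by (metis image_cong)
      define \<Phi> where "\<Phi> t = (\<integral>\<^sup>+r. (\<integral>\<^sup>+z. h ((\<tau> * sqrt (2 * t) - z)\<^sup>2 / 2 / r) \<partial>std_normal)
          * ennreal (gamma_density (real (CARD('t) - CARD('n) + 1) / 2) r) \<partial>lborel)" for t
      have [measurable]: "\<Phi> \<in> borel_measurable borel"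
      proof -
        interpret N: prob_space std_normal by (rule prob_space_std_normal)
        show ?thesis unfolding \<Phi>_def by measurable
      qed
      have "dim (x ` ?W) < CARD('t)" using dW n by simp
      then have "AE y in std_gaussian. y \<notin> span (x ` ?W)" by (rule AE_std_gaussian_not_in_subspace)
      then have "AE y in std_gaussian. (\<integral>\<^sup>+y'. F (x(j := y, i := y')) \<partial>std_gaussian)
          = \<Phi> ((\<Sum>k\<in>- I. (y \<bullet> v k)\<^sup>2) / 2)"
        unfolding \<Phi>_def
        by eventually_elim (rule nn_integral_gram_inverse_ratio_last_row[OF ij n h F x v(2) I vI])
      then have "(\<integral>\<^sup>+y. (\<integral>\<^sup>+y'. F (x(j := y, i := y')) \<partial>std_gaussian) \<partial>std_gaussian)
         = (\<integral>\<^sup>+y. \<Phi> ((\<Sum>k\<in>- I. (y \<bullet> v k)\<^sup>2) / 2) \<partial>std_gaussian)"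
        by (rule nn_integral_cong_AE)
      also have "\<dots> = (\<integral>\<^sup>+r. \<Phi> r * ennreal (gamma_density (real (card (- I)) / 2) r) \<partial>lborel)"
      proof (rule nn_integral_std_gaussian_norm_projection)
        show "orthonormal_on (- I) v" using v(2) by (auto simp: orthonormal_on_def)
        have "I \<noteq> UNIV" using I n by auto
        then show "- I \<noteq> {}" by auto
      qed measurable
      also have "card (- I) = CARD('t) - CARD('n) + 2"
        using I n n2 by (simp add: Compl_eq_Diff_UNIV card_Diff_subset)
      also have "(\<integral>\<^sup>+r. \<Phi> r * ennreal (gamma_density (real (CARD('t) - CARD('n) + 2) / 2) r) \<partial>lborel) = ?D"
        unfolding \<Phi>_def noncentral_ratio_density_def by (rule nn_integral_noncentral_ratio) auto
      finally show "(\<integral>\<^sup>+y. (\<integral>\<^sup>+y'. F (x(j := y, i := y')) \<partial>std_gaussian) \<partial>std_gaussian) = ?D" .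
    qed
  qed
  also have "\<dots> = ?D"
  proof -
    have "prob_space (?P ?W)" by (rule prob_space_PiM) (rule prob_space_std_gaussian)
    then show ?thesis by (simp add: prob_space.emeasure_space_1)
  qed
  finally show ?thesis .
qed

section \<open>Measurability of the inverse matrix\<close>

text \<open>
  On singular matrices \<open>matrix_inv\<close> is a fixed unspecified matrix, elsewhere Cramer's rule applies.
\<close>

lemma borel_measurable_matrix_inv_entry:
  fixes A :: "'a \<Rightarrow> real^'n^'n"
  assumes [measurable]: "\<And>a b. (\<lambda>w. A w $ a $ b) \<in> borel_measurable M"
  shows "(\<lambda>w. matrix_inv (A w) $ i $ j) \<in> borel_measurable M"
proof -
  define N where "N w = (\<chi> a b. if b = i then axis j 1 $ a else A w $ a $ b)" for w
  have [measurable]: "(\<lambda>w. det (N w)) \<in> borel_measurable M" "(\<lambda>w. det (A w)) \<in> borel_measurable M"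
    by (rule borel_measurable_det; simp add: N_def)+
  have "matrix_inv (A w) $ i $ j =
      (if det (A w) \<noteq> 0 then det (N w) / det (A w) else (SOME B. False) $ i $ j)" for w
  proof (cases "det (A w) = 0")
    case True
    then have "(\<lambda>B. A w ** B = mat 1 \<and> B ** A w = mat 1) = (\<lambda>_. False)"
      by (metis invertible_det_nz invertible_def)
    then have "matrix_inv (A w) = (SOME B. False)" unfolding matrix_inv_def by (simp only:)
    then show ?thesis using True by simp
  next
    case False
    then have "invertible (A w)" by (simp add: invertible_det_nz)
    then have "A w *v (matrix_inv (A w) *v axis j 1) = axis j 1"
      by (simp add: matrix_vector_mul_assoc matrix_inv_mult)
    then have "matrix_inv (A w) *v axis j 1 = (\<chi> k. det (\<chi> a b. if b = k then axis j 1 $ a else A w $ a $ b) / det (A w))"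
      using cramer[OF False] by blast
    then have "(matrix_inv (A w) *v axis j 1) $ i = det (N w) / det (A w)"
      by (simp add: N_def)
    then show ?thesis using False by (simp add: matrix_vector_mult_basis column_def)
  qed
  then show ?thesis by simp
qed

section \<open>Covariance and rearrangement of Gaussian data\<close>

lemma integral_PiM_std_normal_monomial:
  fixes e :: "'n::finite \<Rightarrow> nat"
  shows "integrable (PiM UNIV (\<lambda>_::'n. std_normal)) (\<lambda>x. \<Prod>k\<in>UNIV. x k ^ e k)"
    and "(\<integral>x. (\<Prod>k\<in>UNIV. x k ^ e k) \<partial>PiM UNIV (\<lambda>_::'n. std_normal)) = (\<Prod>k\<in>UNIV. \<integral>x. x ^ e k \<partial>std_normal)"
proof -
  interpret product_sigma_finite "\<lambda>_::'n. std_normal" by (rule product_sigma_finite_std_normal)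
  have i: "integrable std_normal (\<lambda>x. x ^ m)" for m
    unfolding std_normal_def by (subst integrable_density) (auto simp: integrable_std_normal_moment)
  show "integrable (PiM UNIV (\<lambda>_::'n. std_normal)) (\<lambda>x. \<Prod>k\<in>UNIV. x k ^ e k)"
    by (rule product_integrable_prod) (auto simp: i)
  show "(\<integral>x. (\<Prod>k\<in>UNIV. x k ^ e k) \<partial>PiM UNIV (\<lambda>_::'n. std_normal)) = (\<Prod>k\<in>UNIV. \<integral>x. x ^ e k \<partial>std_normal)"
    by (rule product_integral_prod) (auto simp: i)
qed

lemma integral_std_normal_power:
  "(\<integral>x. x ^ 0 \<partial>std_normal) = 1" "(\<integral>x. x ^ 1 \<partial>std_normal) = 0" "(\<integral>x. x ^ 2 \<partial>std_normal) = 1"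
proof -
  interpret prob_space std_normal by (rule prob_space_std_normal)
  have *: "(\<integral>x. x ^ m \<partial>std_normal) = (\<integral>x. std_normal_density x * x ^ m \<partial>lborel)" for m
    unfolding std_normal_def by (subst integral_density) auto
  show "(\<integral>x. x ^ 0 \<partial>std_normal) = 1" using prob_space by simp
  show "(\<integral>x. x ^ 1 \<partial>std_normal) = 0" unfolding * using integral_std_normal_moment_odd[of 0] by simp
  show "(\<integral>x. x ^ 2 \<partial>std_normal) = 1" unfolding * using integral_std_normal_moment_even[of 1] by simp
qed

lemma std_gaussian_moments:
  fixes a b :: "'n::finite"
  shows "integrable std_gaussian (\<lambda>x::real^'n. x $ a)" "(\<integral>x. x $ a \<partial>(std_gaussian :: (real^'n) measure)) = 0"
    "integrable std_gaussian (\<lambda>x::real^'n. x $ a * x $ b)"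
    "(\<integral>x. x $ a * x $ b \<partial>(std_gaussian :: (real^'n) measure)) = of_bool (a = b)"
proof -
  let ?N = "PiM UNIV (\<lambda>_::'n. std_normal)"
  have m: "(\<lambda>x::real^'n. \<lambda>k\<in>UNIV. x $ k) \<in> measurable std_gaussian (PiM UNIV (\<lambda>_. borel))"
    by (rule measurable_restrict) (auto cong: measurable_cong_sets)
  have m': "(\<lambda>x. \<Prod>k\<in>UNIV. x k ^ e k) \<in> borel_measurable (PiM UNIV (\<lambda>_::'n. borel :: real measure))" for e :: "'n \<Rightarrow> nat"
    by measurable
  have int: "integrable std_gaussian (\<lambda>x::real^'n. \<Prod>k\<in>UNIV. x $ k ^ e k)" for e
    using integral_PiM_std_normal_monomial(1)[of e] integrable_distr_eq[OF m m', of e]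
    unfolding distr_std_gaussian_components by simp
  have eq: "(\<integral>x. (\<Prod>k\<in>UNIV. x $ k ^ e k) \<partial>(std_gaussian :: (real^'n) measure)) = (\<Prod>k\<in>UNIV. \<integral>x. x ^ e k \<partial>std_normal)" for e
    using integral_PiM_std_normal_monomial(2)[of e] integral_distr[OF m m', of e]
    unfolding distr_std_gaussian_components by simp
  let ?e1 = "\<lambda>k. if k = a then 1 else (0::nat)" and ?e2 = "\<lambda>k. (if k = a then 1 else 0) + (if k = b then 1 else (0::nat))"
  have e1: "(\<Prod>k\<in>UNIV. x $ k ^ ?e1 k) = x $ a" for x :: "real^'n"
  proof -
    have "(\<Prod>k\<in>UNIV. x $ k ^ ?e1 k) = (\<Prod>k\<in>UNIV. if k = a then x $ k else 1)" by (rule prod.cong) auto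
    then show ?thesis by simp
  qed
  have e2: "(\<Prod>k\<in>UNIV. x $ k ^ ?e2 k) = x $ a * x $ b" for x :: "real^'n"
  proof -
    have "(\<Prod>k\<in>UNIV. x $ k ^ ?e2 k) = (\<Prod>k\<in>UNIV. (if k = a then x $ k else 1) * (if k = b then x $ k else 1))"
      by (rule prod.cong) auto
    then show ?thesis by (simp add: prod.distrib)
  qed
  show "integrable std_gaussian (\<lambda>x::real^'n. x $ a)" using int[of ?e1] unfolding e1 .
  show "integrable std_gaussian (\<lambda>x::real^'n. x $ a * x $ b)" using int[of ?e2] unfolding e2 .
  have "(\<integral>x. x $ a \<partial>(std_gaussian :: (real^'n) measure)) = (\<Prod>k\<in>UNIV. \<integral>x. x ^ ?e1 k \<partial>std_normal)"
    using eq[of ?e1] unfolding e1 .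
  also have "\<dots> = 0"
    by (rule prod_zero) (auto intro!: exI[of _ a] simp: integral_std_normal_power(2)[simplified])
  finally show "(\<integral>x. x $ a \<partial>(std_gaussian :: (real^'n) measure)) = 0" .
  have E2: "(\<integral>x. x $ a * x $ b \<partial>(std_gaussian :: (real^'n) measure)) = (\<Prod>k\<in>UNIV. \<integral>x. x ^ ?e2 k \<partial>std_normal)"
    using eq[of ?e2] unfolding e2 .
  show "(\<integral>x. x $ a * x $ b \<partial>(std_gaussian :: (real^'n) measure)) = of_bool (a = b)"
  proof (cases "a = b")
    case True
    have "(\<Prod>k\<in>UNIV. \<integral>x. x ^ ?e2 k \<partial>std_normal) = 1"
      using True integral_std_normal_power(1,3) by (intro prod.neutral) (auto simp: numeral_2_eq_2)
    then show ?thesis using E2 True by simp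
  next
    case False
    have "(\<Prod>k\<in>UNIV. \<integral>x. x ^ ?e2 k \<partial>std_normal) = 0"
      using False by (intro prod_zero) (auto intro!: exI[of _ a] simp: integral_std_normal_power(2)[simplified])
    then show ?thesis using E2 False by simp
  qed
qed

lemma cov_matrix_linear_image:
  fixes Z :: "'a \<Rightarrow> real^'n" and C :: "real^'n^'m"
  assumes [measurable]: "Z \<in> borel_measurable M" and law: "distr M borel Z = std_gaussian"
    and Y: "\<And>w. Y w = C *v Z w"
  shows "cov_matrix M Y = C ** transpose C"
proof -
  have iZ: "integrable M (\<lambda>w. h (Z w)) \<longleftrightarrow> integrable std_gaussian h"
    and eZ: "(\<integral>w. h (Z w) \<partial>M) = (\<integral>x. h x \<partial>std_gaussian)" if [measurable]: "h \<in> borel_measurable borel" for h :: "real^'n \<Rightarrow> real"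
    unfolding law[symmetric] by (simp_all add: integrable_distr_eq integral_distr)
  have Ys: "Y w $ i = (\<Sum>a\<in>UNIV. C $ i $ a * Z w $ a)" for w i by (simp add: Y matrix_vector_mult_def)
  have i1: "integrable M (\<lambda>w. Z w $ a)" for a using iZ[of "\<lambda>x. x $ a"] std_gaussian_moments(1) by simp
  have e1: "(\<integral>w. Z w $ a \<partial>M) = 0" for a
    using eZ[of "\<lambda>x. x $ a"] std_gaussian_moments(2)[of a] by simp
  have mean: "(\<integral>w. Y w $ i \<partial>M) = 0" for i
    unfolding Ys using i1 e1 by simp
  have i2: "integrable M (\<lambda>w. Z w $ a * Z w $ b)" for a b
    using iZ[of "\<lambda>x. x $ a * x $ b"] std_gaussian_moments(3) by simp
  have e2: "(\<integral>w. Z w $ a * Z w $ b \<partial>M) = of_bool (a = b)" for a b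
    using eZ[of "\<lambda>x. x $ a * x $ b"] std_gaussian_moments(4)[of a b] by simp
  have "(\<integral>w. Y w $ i * Y w $ j \<partial>M) = (C ** transpose C) $ i $ j" for i j
  proof -
    have "(\<integral>w. Y w $ i * Y w $ j \<partial>M) = (\<integral>w. (\<Sum>a\<in>UNIV. \<Sum>b\<in>UNIV. (C $ i $ a * C $ j $ b) * (Z w $ a * Z w $ b)) \<partial>M)"
      unfolding Ys sum_product by (simp add: mult_ac)
    also have "\<dots> = (\<Sum>a\<in>UNIV. \<Sum>b\<in>UNIV. (C $ i $ a * C $ j $ b) * of_bool (a = b))"
      using i2 e2 by (simp add: integral_sum)
    also have "\<dots> = (C ** transpose C) $ i $ j"
      by (simp add: matrix_matrix_mult_def transpose_def sum.delta' of_bool_def if_distrib cong: if_cong)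
    finally show ?thesis .
  qed
  then show ?thesis unfolding cov_matrix_def by (simp add: mean vec_eq_iff)
qed

lemma iid_std_gaussian_orthogonal:
  fixes Q :: "real^'n^'n" and Z :: "'t::finite \<Rightarrow> 'a \<Rightarrow> real^'n"
  assumes Q: "orthogonal_matrix Q" and [measurable]: "\<And>t. Z t \<in> borel_measurable M"
    and law: "distr M (PiM UNIV (\<lambda>_. borel)) (\<lambda>w t. Z t w) = PiM UNIV (\<lambda>_. std_gaussian)"
  shows "distr M (PiM UNIV (\<lambda>_. borel)) (\<lambda>w t. Q *v Z t w) = PiM UNIV (\<lambda>_. std_gaussian)"
proof (rule product_sigma_finite.PiM_eqI[OF product_sigma_finite_std_gaussian])
  interpret product_sigma_finite "\<lambda>_::'t. std_gaussian :: (real^'n) measure"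
    by (rule product_sigma_finite_std_gaussian)
  show "sets (distr M (PiM UNIV (\<lambda>_. borel)) (\<lambda>w t. Q *v Z t w)) = sets (PiM UNIV (\<lambda>_. std_gaussian))"
    by (simp add: sets_PiM_std_gaussian)
  have mQ: "(*v) Q \<in> measurable borel borel"
    by (auto intro!: borel_measurable_continuous_onI linear_continuous_on linear_conv_bounded_linear[THEN iffD1])
  have m: "(\<lambda>w t. Z t w) \<in> measurable M (PiM UNIV (\<lambda>_. borel))"
    by (rule measurable_PiM_single') (auto simp: space_PiM)
  have mQZ: "(\<lambda>w t. Q *v Z t w) \<in> measurable M (PiM UNIV (\<lambda>_. borel))"
    using mQ by (intro measurable_PiM_single') (auto simp: space_PiM)
  fix A :: "'t \<Rightarrow> (real^'n) set"
  assume "\<And>i. i \<in> UNIV \<Longrightarrow> A i \<in> sets std_gaussian"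
  then have A: "A t \<in> sets borel" for t by simp
  define A' where "A' t = (*v) Q -` A t" for t
  have A': "A' t \<in> sets borel" for t
    unfolding A'_def using measurable_sets[OF mQ A] by simp
  have P: "Pi\<^sub>E UNIV A \<in> sets (PiM UNIV (\<lambda>_. borel))" "Pi\<^sub>E UNIV A' \<in> sets (PiM UNIV (\<lambda>_. borel))"
    using A A' by (auto intro!: sets_PiM_I_finite)
  have "emeasure (distr M (PiM UNIV (\<lambda>_. borel)) (\<lambda>w t. Q *v Z t w)) (Pi\<^sub>E UNIV A)
     = emeasure (distr M (PiM UNIV (\<lambda>_. borel)) (\<lambda>w t. Z t w)) (Pi\<^sub>E UNIV A')"
    unfolding emeasure_distr[OF mQZ P(1)] emeasure_distr[OF m P(2)]
    by (rule arg_cong2[where f = emeasure]) (auto simp: A'_def PiE_def Pi_def)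
  also have "\<dots> = (\<Prod>t\<in>UNIV. emeasure std_gaussian (A' t))"
    unfolding law using A' by (intro emeasure_PiM) auto
  also have "\<dots> = (\<Prod>t\<in>UNIV. emeasure (distr std_gaussian borel ((*v) Q)) (A t))"
    using A mQ by (intro prod.cong refl) (subst emeasure_distr; auto simp: A'_def cong: measurable_cong_sets)
  also have "\<dots> = (\<Prod>t\<in>UNIV. emeasure std_gaussian (A t))"
    by (simp add: distr_std_gaussian_orthogonal[OF Q])
  finally show "emeasure (distr M (PiM UNIV (\<lambda>_. borel)) (\<lambda>w t. Q *v Z t w)) (Pi\<^sub>E UNIV A)
    = (\<Prod>i\<in>UNIV. emeasure std_gaussian (A i))" .
qed simp

lemma iid_std_gaussian_transpose:
  fixes Z :: "'t::finite \<Rightarrow> 'a \<Rightarrow> real^'n::finite"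
  assumes Zm[measurable]: "\<And>t. Z t \<in> borel_measurable M"
    and law: "distr M (PiM UNIV (\<lambda>_. borel)) (\<lambda>w t. Z t w) = PiM UNIV (\<lambda>_. std_gaussian)"
  shows "distr M (PiM UNIV (\<lambda>_. borel)) (\<lambda>w s. (\<chi> t. Z t w $ s) :: real^'t) = PiM UNIV (\<lambda>_. std_gaussian)"
proof -
  let ?N = "PiM UNIV (\<lambda>_::'t \<times> 'n. std_normal)"
  have entry: "(\<lambda>w. Z t w $ s) \<in> borel_measurable M" for t s
    by (rule measurable_compose[OF Zm]) auto
  have m1: "(\<lambda>w (t, s). Z t w $ s) \<in> measurable M (PiM UNIV (\<lambda>_::'t \<times> 'n. borel))"
    unfolding split_beta using entry by (intro measurable_PiM_single') (auto simp: space_PiM)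
  have m2: "(\<lambda>e (s, t). e (t, s)) \<in> measurable (PiM UNIV (\<lambda>_::'t \<times> 'n. borel :: real measure)) (PiM UNIV (\<lambda>_::'n \<times> 't. borel))"
    unfolding split_beta by (intro measurable_PiM_single') (auto simp: space_PiM)
  have "distr M (PiM UNIV (\<lambda>_. borel)) (\<lambda>w (s, t). ((\<chi> t. Z t w $ s) :: real^'t) $ t)
      = distr (distr M (PiM UNIV (\<lambda>_. borel)) (\<lambda>w (t, s). Z t w $ s)) (PiM UNIV (\<lambda>_. borel)) (\<lambda>e (s, t). e (t, s))"
    unfolding distr_distr[OF m2 m1] by (simp add: comp_def split_beta')
  also have "distr M (PiM UNIV (\<lambda>_. borel)) (\<lambda>w (t, s). Z t w $ s) = ?N"
    using law by (subst (asm) iid_std_gaussian_iff_entries[OF Zm])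
  also have "distr ?N (PiM UNIV (\<lambda>_. borel)) (\<lambda>e (s, t). e (t, s)) = PiM UNIV (\<lambda>_::'n \<times> 't. std_normal)"
  proof -
    have "distr ?N (PiM UNIV (\<lambda>_::'n \<times> 't. std_normal)) (\<lambda>e. \<lambda>i\<in>UNIV. e (prod.swap i)) = PiM UNIV (\<lambda>_::'n \<times> 't. std_normal)"
      by (rule distr_PiM_reindex) (auto simp: prob_space_std_normal)
    moreover have "distr ?N (PiM UNIV (\<lambda>_::'n \<times> 't. std_normal)) (\<lambda>e. \<lambda>i\<in>UNIV. e (prod.swap i))
       = distr ?N (PiM UNIV (\<lambda>_. borel)) (\<lambda>e (s, t). e (t, s))"
      by (rule distr_cong) (auto intro!: sets_PiM_cong simp: sets_std_normal fun_eq_iff)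
    ultimately show ?thesis by simp
  qed
  finally show ?thesis
    by (rule iid_std_gaussian_iff_entries[THEN iffD2, rotated]) (intro borel_measurable_vec_lambda entry)
qed

text \<open>
  The whitened vectors \<open>\<phi> (f t)\<close> and \<open>\<psi> (u t)\<close>, stacked, have independent standard normal entries. It is enough to
  compare the joint law with the product law on rectangles, where the three independence assumptions
  factor the probability.
\<close>

lemma iid_entries_of_independent_blocks:
  fixes f :: "'t::finite \<Rightarrow> 'a \<Rightarrow> real^'k::finite" and u :: "'t \<Rightarrow> 'a \<Rightarrow> real^'p::finite"
    and \<phi> :: "real^'k \<Rightarrow> real^'k" and \<psi> :: "real^'p \<Rightarrow> real^'p"
  assumes M: "prob_space M"
    and f_indep: "prob_space.indep_vars M (\<lambda>_. borel) f UNIV"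
    and u_indep: "prob_space.indep_vars M (\<lambda>_. borel) u UNIV"
    and fu_indep: "prob_space.indep_set M
        (sets (vimage_algebra (space M) (\<lambda>w t. f t w) (Pi\<^sub>M UNIV (\<lambda>_. borel))))
        (sets (vimage_algebra (space M) (\<lambda>w t. u t w) (Pi\<^sub>M UNIV (\<lambda>_. borel))))"
    and \<phi>: "\<phi> \<in> borel_measurable borel" and \<psi>: "\<psi> \<in> borel_measurable borel"
    and f_law: "\<And>t. distr M borel (\<lambda>w. \<phi> (f t w)) = std_gaussian"
    and u_law: "\<And>t. distr M borel (\<lambda>w. \<psi> (u t w)) = std_gaussian"
  shows "distr M (PiM UNIV (\<lambda>_. borel)) (\<lambda>w (t, s). stack (\<psi> (u t w)) (\<phi> (f t w)) $ s)
      = PiM UNIV (\<lambda>_::'t \<times> ('p + 'k). std_normal)"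
proof (rule product_sigma_finite.PiM_eqI[OF product_sigma_finite_std_normal])
  interpret prob_space M by (rule M)
  have fm: "f t \<in> borel_measurable M" and um: "u t \<in> borel_measurable M" for t
    using f_indep u_indep by (auto simp: indep_vars_def)
  have \<phi>f: "(\<lambda>w. \<phi> (f t w)) \<in> borel_measurable M" and \<psi>u: "(\<lambda>w. \<psi> (u t w)) \<in> borel_measurable M" for t
    using fm um \<phi> \<psi> by (auto intro: measurable_compose)
  have entry: "(\<lambda>w. stack (\<psi> (u t w)) (\<phi> (f t w)) $ s) \<in> borel_measurable M" for t s
    by (cases s) (auto simp: stack_def intro!: measurable_compose[OF \<phi>f] measurable_compose[OF \<psi>u])
  have m: "(\<lambda>w (t, s). stack (\<psi> (u t w)) (\<phi> (f t w)) $ s) \<in> measurable M (PiM UNIV (\<lambda>_. borel))"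
    unfolding split_beta using entry by (intro measurable_PiM_single') (auto simp: space_PiM)
  show "sets (distr M (PiM UNIV (\<lambda>_. borel)) (\<lambda>w (t, s). stack (\<psi> (u t w)) (\<phi> (f t w)) $ s))
     = sets (PiM UNIV (\<lambda>_::'t \<times> ('p + 'k). std_normal))"
    by (simp add: sets_PiM_std_normal)
  fix A :: "'t \<times> ('p + 'k) \<Rightarrow> real set"
  assume "\<And>i. i \<in> UNIV \<Longrightarrow> A i \<in> sets std_normal"
  then have A: "A i \<in> sets borel" for i by (simp add: sets_std_normal)
  define Af where "Af t = {x :: real^'k. \<forall>k. x $ k \<in> A (t, Inr k)}" for t
  define Au where "Au t = {x :: real^'p. \<forall>k. x $ k \<in> A (t, Inl k)}" for t
  have box: "{x :: real^'n. \<forall>k. x $ k \<in> D k} \<in> sets borel" if "\<And>k. D k \<in> sets borel" for D :: "'n::finite \<Rightarrow> real set"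
  proof -
    note [measurable] = that
    have "{x \<in> space borel. \<forall>k. (x :: real^'n) $ k \<in> D k} \<in> sets borel" by measurable
    then show ?thesis by simp
  qed
  have Af: "Af t \<in> sets borel" and Au: "Au t \<in> sets borel" for t
    unfolding Af_def Au_def by (intro box A)+
  define Bf where "Bf t = \<phi> -` Af t" for t
  define Bu where "Bu t = \<psi> -` Au t" for t
  have Bf: "Bf t \<in> sets borel" and Bu: "Bu t \<in> sets borel" for t
    unfolding Bf_def Bu_def using measurable_sets[OF \<phi> Af] measurable_sets[OF \<psi> Au] by auto
  define Ef where "Ef = (\<Inter>t\<in>UNIV. f t -` Bf t \<inter> space M)"
  define Eu where "Eu = (\<Inter>t\<in>UNIV. u t -` Bu t \<inter> space M)"
  have Ef: "Ef \<in> sets (vimage_algebra (space M) (\<lambda>w t. f t w) (Pi\<^sub>M UNIV (\<lambda>_. borel)))"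
  proof -
    have "Ef = (\<lambda>w t. f t w) -` (Pi\<^sub>E UNIV Bf) \<inter> space M" by (auto simp: Ef_def PiE_def Pi_def)
    moreover have "Pi\<^sub>E UNIV Bf \<in> sets (PiM UNIV (\<lambda>_. borel))" using Bf by (intro sets_PiM_I_finite) auto
    ultimately show ?thesis by (auto intro: in_vimage_algebra)
  qed
  have Eu: "Eu \<in> sets (vimage_algebra (space M) (\<lambda>w t. u t w) (Pi\<^sub>M UNIV (\<lambda>_. borel)))"
  proof -
    have "Eu = (\<lambda>w t. u t w) -` (Pi\<^sub>E UNIV Bu) \<inter> space M" by (auto simp: Eu_def PiE_def Pi_def)
    moreover have "Pi\<^sub>E UNIV Bu \<in> sets (PiM UNIV (\<lambda>_. borel))" using Bu by (intro sets_PiM_I_finite) auto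
    ultimately show ?thesis by (auto intro: in_vimage_algebra)
  qed
  have pf: "prob Ef = (\<Prod>t\<in>UNIV. prob (f t -` Bf t \<inter> space M))"
    unfolding Ef_def using Bf by (intro indep_varsD[OF f_indep]) auto
  have pu: "prob Eu = (\<Prod>t\<in>UNIV. prob (u t -` Bu t \<inter> space M))"
    unfolding Eu_def using Bu by (intro indep_varsD[OF u_indep]) auto
  have gf: "ennreal (prob (f t -` Bf t \<inter> space M)) = emeasure std_gaussian (Af t)" for t
  proof -
    have "emeasure std_gaussian (Af t) = emeasure M ((\<lambda>w. \<phi> (f t w)) -` Af t \<inter> space M)"
      unfolding f_law[of t, symmetric] by (rule emeasure_distr[OF \<phi>f Af])
    also have "(\<lambda>w. \<phi> (f t w)) -` Af t \<inter> space M = f t -` Bf t \<inter> space M" by (auto simp: Bf_def)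
    finally show ?thesis by (simp add: emeasure_eq_measure)
  qed
  have gu: "ennreal (prob (u t -` Bu t \<inter> space M)) = emeasure std_gaussian (Au t)" for t
  proof -
    have "emeasure std_gaussian (Au t) = emeasure M ((\<lambda>w. \<psi> (u t w)) -` Au t \<inter> space M)"
      unfolding u_law[of t, symmetric] by (rule emeasure_distr[OF \<psi>u Au])
    also have "(\<lambda>w. \<psi> (u t w)) -` Au t \<inter> space M = u t -` Bu t \<inter> space M" by (auto simp: Bu_def)
    finally show ?thesis by (simp add: emeasure_eq_measure)
  qed
  have P: "Pi\<^sub>E UNIV A \<in> sets (PiM UNIV (\<lambda>_. borel))" using A by (intro sets_PiM_I_finite) auto
  have "emeasure (distr M (PiM UNIV (\<lambda>_. borel)) (\<lambda>w (t, s). stack (\<psi> (u t w)) (\<phi> (f t w)) $ s)) (Pi\<^sub>E UNIV A)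
     = emeasure M (Ef \<inter> Eu)"
    unfolding emeasure_distr[OF m P]
  proof (rule arg_cong2[where f = emeasure], rule refl)
    have "(\<lambda>(t, s). stack (\<psi> (u t w)) (\<phi> (f t w)) $ s) \<in> Pi\<^sub>E UNIV A
       \<longleftrightarrow> (\<forall>t. f t w \<in> Bf t) \<and> (\<forall>t. u t w \<in> Bu t)" for w
    proof -
      have "(\<lambda>(t, s). stack (\<psi> (u t w)) (\<phi> (f t w)) $ s) \<in> Pi\<^sub>E UNIV A
        \<longleftrightarrow> (\<forall>t s. stack (\<psi> (u t w)) (\<phi> (f t w)) $ s \<in> A (t, s))"
        by (auto simp: PiE_def Pi_def)
      also have "\<dots> \<longleftrightarrow> (\<forall>t. (\<forall>k. \<psi> (u t w) $ k \<in> A (t, Inl k)) \<and> (\<forall>k. \<phi> (f t w) $ k \<in> A (t, Inr k)))"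
        unfolding split_sum_all by (simp add: stack_def)
      finally show ?thesis by (auto simp: Bf_def Bu_def Af_def Au_def)
    qed
    then show "(\<lambda>w (t, s). stack (\<psi> (u t w)) (\<phi> (f t w)) $ s) -` Pi\<^sub>E UNIV A \<inter> space M = Ef \<inter> Eu"
      by (auto simp: Ef_def Eu_def)
  qed
  also have "\<dots> = ennreal (prob Ef * prob Eu)"
    using indep_setD[OF fu_indep Ef Eu] by (simp add: emeasure_eq_measure)
  also have "\<dots> = (\<Prod>t\<in>UNIV. emeasure std_gaussian (Af t)) * (\<Prod>t\<in>UNIV. emeasure std_gaussian (Au t))"
    unfolding pf pu gf[symmetric] gu[symmetric]
    by (simp add: ennreal_mult prod_ennreal prod_nonneg)
  also have "\<dots> = (\<Prod>t\<in>UNIV. (\<Prod>k\<in>UNIV. emeasure std_normal (A (t, Inl k))) * (\<Prod>k\<in>UNIV. emeasure std_normal (A (t, Inr k))))"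
    unfolding Af_def Au_def using A by (simp add: emeasure_std_gaussian_box prod.distrib mult.commute)
  also have "\<dots> = (\<Prod>t\<in>UNIV. \<Prod>s\<in>UNIV. emeasure std_normal (A (t, s)))"
    by (intro prod.cong refl) (subst UNIV_Plus_UNIV[symmetric], subst prod.Plus; simp)
  also have "\<dots> = (\<Prod>i\<in>UNIV. emeasure std_normal (A i))"
    by (simp add: prod.cartesian_product)
  finally show "emeasure (distr M (PiM UNIV (\<lambda>_. borel)) (\<lambda>w (t, s). stack (\<psi> (u t w)) (\<phi> (f t w)) $ s)) (Pi\<^sub>E UNIV A)
    = (\<Prod>i\<in>UNIV. emeasure std_normal (A i))" .
qed simp

section \<open>The hypergeometric form of the density\<close>

lemma hypergeom_2F1_zero:
  assumes "a > 0" "b > 0" "c > 0"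
  shows "hypergeom_2F1 a b c 0 = 1"
proof -
  have "(\<Sum>k. Gamma (a + real k) * Gamma (b + real k) / Gamma (c + real k) * (0 ^ k / fact k)) = Gamma a * Gamma b / Gamma c"
    by (subst suminf_finite[of "{0}"]) auto
  moreover have "Gamma a > 0" "Gamma b > 0" "Gamma c > 0" using assms by (auto intro: Gamma_real_pos)
  ultimately show ?thesis by (simp add: hypergeom_2F1_def)
qed

lemma noncentral_ratio_density_term:
  fixes c l x :: real
  assumes c: "c > 0" and l: "l \<ge> 0" and x: "x > 0"
  shows "mixture_weight ((c + 1) / 2) l k * beta_prime_density (real k + 1/2) (c / 2) (x / c) / c
    = F_density 1 c x * (1 + l) powr (- (c + 1) / 2) * (Gamma (1/2) / (Gamma ((c + 1) / 2) * Gamma ((c + 1) / 2)))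
     * (Gamma ((c + 1) / 2 + real k) * Gamma ((c + 1) / 2 + real k) / Gamma (1/2 + real k) * ((x / (c + x) * (l / (1 + l))) ^ k / fact k))"
proof -
  define a where "a = (c + 1) / 2"
  define y where "y = x / c"
  have y: "y > 0" using c x by (simp add: y_def)
  have ca: "c / 2 = a - 1/2" by (simp add: a_def field_simps)
  have G: "Gamma a > 0" "Gamma (a + real k) > 0" "Gamma (c / 2) > 0" "Gamma (1/2 + real k) > 0" "Gamma (1/2::real) > 0"
    using c by (auto simp: a_def intro!: Gamma_real_pos add_pos_nonneg)
  have q: "x / (c + x) * (l / (1 + l)) = (y / (1 + y)) * (l / (1 + l))"
    using c by (simp add: y_def field_simps)
  have qk: "(y / (1 + y) * (l / (1 + l))) ^ k = y ^ k * l ^ k / ((1 + y) ^ k * (1 + l) ^ k)"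
    by (simp add: power_mult_distrib power_divide)
  have p1: "(1 + l) powr (a + real k) = (1 + l) powr a * (1 + l) ^ k"
    using l by (simp add: powr_add powr_realpow)
  have p2: "(1 + y) powr (- (real k + 1/2 + c/2)) = (1 + y) powr (- a) / (1 + y) ^ k"
  proof -
    have "- (real k + 1/2 + c/2) = - a - real k" by (simp add: a_def field_simps)
    moreover have "(1 + y) powr (- a - real k) = (1 + y) powr (- a) / (1 + y) ^ k"
      using y by (simp only: powr_diff powr_realpow add_pos_pos[OF zero_less_one])
    ultimately show ?thesis by (simp only:)
  qed
  have p3: "y powr (real k + 1/2 - 1) = y powr (-1/2) * y ^ k"
  proof -
    have "real k + 1/2 - 1 = -1/2 + real k" by simp
    then show ?thesis using y by (simp only: powr_add powr_realpow)
  qed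
  have F: "F_density 1 c x = y powr (-1/2) / c * (1 + y) powr (- a) / Beta (1/2) (c/2)"
  proof -
    have "(1 / c) powr (1/2) * x powr (1/2 - 1) = y powr (-1/2) / c"
    proof -
      have "y powr (-1/2) / c = x powr (-1/2) * (c powr (1/2) / c powr 1)"
        using c x by (simp add: y_def powr_divide powr_minus_divide)
      also have "c powr (1/2) / c powr 1 = c powr (1/2 - 1)" by (rule powr_diff[symmetric])
      also have "\<dots> = (1 / c) powr (1/2)" using c by (simp add: powr_divide powr_minus_divide)
      finally show ?thesis by simp
    qed
    moreover have "- (1 + c) / 2 = - a" by (simp add: a_def minus_divide_left add.commute)
    ultimately show ?thesis using x unfolding F_density_def y_def by simp
  qed
  have B1: "Beta (1/2) (c/2) = Gamma (1/2) * Gamma (c/2) / Gamma a"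
    unfolding Beta_def a_def by (simp add: add_divide_distrib add.commute)
  have B2: "Beta (real k + 1/2) (c/2) = Gamma (1/2 + real k) * Gamma (c/2) / Gamma (a + real k)"
    unfolding Beta_def a_def by (simp add: add_divide_distrib algebra_simps)
  have la: "(1 + l) powr (- (c + 1) / 2) = 1 / (1 + l) powr a"
  proof -
    have "- (c + 1) / 2 = - a" by (simp add: a_def minus_divide_left)
    then show ?thesis by (simp only: powr_minus_divide)
  qed
  have gen: "gak / (ga * fk) * lk / (Ly * L) * ((Y * yk) * (P / pk) / (gk * gc / gak)) / c
     = (Y / c * P / (gh * gc / ga)) * (1 / Ly) * (gh / (ga * ga)) * (gak * gak / gk * (yk * lk / (pk * L) / fk))"
    if "gh \<noteq> 0" "ga \<noteq> 0" for gak ga fk lk Ly L Y yk P pk gk gc gh :: real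
    using that by (simp add: mult_ac)
  show ?thesis
    unfolding a_def[symmetric] y_def[symmetric] q qk la F B1 mixture_weight_def beta_prime_density_def if_P[OF y] p1 p2 p3 B2
    by (rule gen) (use G in \<open>auto simp: Gamma_one_half_real\<close>)
qed

text \<open>
  Where the series of extended reals is finite, it can be replaced by the real hypergeometric series, which then
  converges. A density of total mass \<open>1\<close> is finite almost everywhere, so this suffices for identifying the law.
\<close>

lemma noncentral_ratio_density_eq:
  fixes c l x :: real
  assumes c: "c > 0" and l: "l \<ge> 0" and x: "x > 0"
    and fin: "noncentral_ratio_density ((c + 1) / 2) (c / 2) l (x / c) \<noteq> \<infinity>"
  shows "ennreal (1 / c) * noncentral_ratio_density ((c + 1) / 2) (c / 2) l (x / c)
     = ennreal (F_density 1 c x * (1 + l) powr (- (c + 1) / 2)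
          * hypergeom_2F1 ((c + 1) / 2) ((c + 1) / 2) (1/2) (x / (c + x) * (l / (1 + l))))"
proof -
  define t where "t k = mixture_weight ((c + 1) / 2) l k * beta_prime_density (real k + 1/2) (c / 2) (x / c)" for k
  define h where "h k = Gamma ((c + 1) / 2 + real k) * Gamma ((c + 1) / 2 + real k) / Gamma (1/2 + real k)
     * ((x / (c + x) * (l / (1 + l))) ^ k / fact k)" for k
  define K where "K = F_density 1 c x * (1 + l) powr (- (c + 1) / 2) * (Gamma (1/2) / (Gamma ((c + 1) / 2) * Gamma ((c + 1) / 2)))"
  have G: "Gamma ((c + 1) / 2) > 0" "Gamma (c / 2) > 0" "Gamma (1/2 :: real) > 0"
    using c by (auto intro!: Gamma_real_pos)
  have "Beta (1/2) (c/2) > 0" unfolding Beta_def using c G by (auto intro!: divide_pos_pos mult_pos_pos Gamma_real_pos)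
  then have "F_density 1 c x > 0"
    unfolding F_density_def using c x add_pos_pos[OF zero_less_one, of "x / c"]
    by (auto intro!: divide_pos_pos mult_pos_pos)
  then have K: "K > 0" unfolding K_def using l G by (auto intro!: mult_pos_pos divide_pos_pos)
  have th: "t k = c * K * h k" for k
    using noncentral_ratio_density_term[OF c l x, of k] c unfolding t_def h_def K_def by (simp add: field_simps)
  have h0: "h k \<ge> 0" for k
    unfolding h_def using c l x by (auto intro!: mult_nonneg_nonneg divide_nonneg_nonneg zero_le_power less_imp_le[OF Gamma_real_pos])
  have t0: "t k \<ge> 0" for k unfolding th using h0 K c by simp
  have "(\<Sum>k. ennreal (t k)) \<noteq> top" using fin by (simp add: noncentral_ratio_density_def t_def)
  then have sum: "summable t" and eq: "(\<Sum>k. ennreal (t k)) = ennreal (\<Sum>k. t k)"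
    using t0 by (auto intro: summable_suminf_not_top)
  have "summable h"
  proof -
    have "summable (\<lambda>k. 1 / (c * K) * t k)" using sum by (rule summable_mult)
    then show ?thesis using c K by (simp add: th)
  qed
  then have "(\<Sum>k. t k) = c * K * (\<Sum>k. h k)" unfolding th by (rule suminf_mult)
  then have "1 / c * (\<Sum>k. t k) = K * (\<Sum>k. h k)" using c by simp
  moreover have "ennreal (1 / c) * noncentral_ratio_density ((c + 1) / 2) (c / 2) l (x / c) = ennreal (1 / c * (\<Sum>k. t k))"
    unfolding noncentral_ratio_density_def t_def[symmetric] eq using c t0 sum
    by (intro ennreal_mult[symmetric]) (auto intro: suminf_nonneg)
  ultimately show ?thesis
    unfolding K_def h_def hypergeom_2F1_def by (simp add: mult.assoc)
qed

section \<open>The statistic as a function of independent Gaussian rows\<close>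

lemma inner_mult_axis:
  fixes A :: "real^'n^'m"
  shows "axis a 1 \<bullet> (A *v axis b 1) = A $ a $ b"
  by (simp add: matrix_vector_mult_basis column_def inner_axis')

text \<open>
  The columns \<open>i\<close> and \<open>j\<close> of \<open>C\<close> are the \<open>\<Omega>\<close>-orthonormalization of the unit vectors \<open>e\<^sub>i\<close> and \<open>e\<^sub>j\<close>, in this order; the
  other columns complete them. Since \<open>transpose C ** \<Omega>\<close> is the inverse of \<open>C\<close>, this makes the columns \<open>i\<close> and \<open>j\<close> of the
  inverse sparse.
\<close>

lemma pos_def_triangular_factor:
  fixes \<Omega> :: "real^'n^'n"
  assumes \<Omega>: "pos_def_matrix \<Omega>" and ij: "i \<noteq> j"
  obtains C \<delta> \<kappa> where "transpose C ** \<Omega> ** C = mat 1" "\<delta> > 0" "\<kappa> > 0"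
    "(transpose C ** \<Omega>) *v axis i 1 = \<delta> *\<^sub>R axis i 1"
    "(transpose C ** \<Omega>) *v axis j 1 = \<kappa> *\<^sub>R axis j 1 + (\<Omega> $ i $ j / \<delta>) *\<^sub>R axis i 1"
    "\<delta>\<^sup>2 = \<Omega> $ i $ i" "\<kappa>\<^sup>2 = \<Omega> $ j $ j - (\<Omega> $ i $ j)\<^sup>2 / \<Omega> $ i $ i" "\<Omega> $ j $ j > 0"
proof -
  let ?e = "\<lambda>k. axis k 1 :: real^'n"
  have sym: "transpose \<Omega> = \<Omega>" and pos: "\<And>x. x \<noteq> 0 \<Longrightarrow> 0 < x \<bullet> (\<Omega> *v x)"
    using \<Omega> by (auto simp: pos_def_matrix_def)
  have \<Omega>ji: "\<Omega> $ j $ i = \<Omega> $ i $ j" by (metis sym transpose_def vec_lambda_beta)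
  have ee: "?e a \<bullet> (\<Omega> *v ?e b) = \<Omega> $ a $ b" for a b by (rule inner_mult_axis)
  have ii: "\<Omega> $ i $ i > 0" and jj: "\<Omega> $ j $ j > 0"
    using pos[of "?e i"] pos[of "?e j"] by (simp_all add: ee axis_eq_0_iff)
  define \<delta> where "\<delta> = sqrt (\<Omega> $ i $ i)"
  have \<delta>: "\<delta> > 0" "\<delta>\<^sup>2 = \<Omega> $ i $ i" "\<delta> * \<delta> = \<Omega> $ i $ i" using ii by (simp_all add: \<delta>_def)
  define b where "b = \<Omega> $ i $ j / \<Omega> $ i $ i"
  define w where "w = ?e j - b *\<^sub>R ?e i"
  have "w $ j = 1" using ij by (simp add: w_def axis_def)
  then have "w \<noteq> 0" by auto
  have wi: "?e i \<bullet> (\<Omega> *v w) = 0" "w \<bullet> (\<Omega> *v ?e i) = 0"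
    using ii by (simp_all add: w_def matrix_vector_mult_diff_distrib matrix_vector_mult_scaleR inner_diff_right inner_diff_left ee b_def \<Omega>ji)
  have ww: "w \<bullet> (\<Omega> *v w) = \<Omega> $ j $ j - (\<Omega> $ i $ j)\<^sup>2 / \<Omega> $ i $ i"
  proof -
    have "w \<bullet> (\<Omega> *v w) = ?e j \<bullet> (\<Omega> *v w) - b * (?e i \<bullet> (\<Omega> *v w))"
      by (subst (1) w_def) (simp add: inner_diff_left)
    also have "\<dots> = ?e j \<bullet> (\<Omega> *v w)" by (simp add: wi)
    also have "\<dots> = \<Omega> $ j $ j - b * \<Omega> $ i $ j"
      by (simp add: w_def matrix_vector_mult_diff_distrib matrix_vector_mult_scaleR inner_diff_right ee \<Omega>ji)
    finally show ?thesis by (simp add: b_def power2_eq_square)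
  qed
  define \<kappa> where "\<kappa> = sqrt (w \<bullet> (\<Omega> *v w))"
  have \<kappa>: "\<kappa> > 0" "\<kappa>\<^sup>2 = w \<bullet> (\<Omega> *v w)" "\<kappa> * \<kappa> = w \<bullet> (\<Omega> *v w)"
    using pos[OF \<open>w \<noteq> 0\<close>] by (simp_all add: \<kappa>_def)
  define x where "x k = (if k = i then (1/\<delta>) *\<^sub>R ?e i else (1/\<kappa>) *\<^sub>R w)" for k
  have xi: "x i = (1/\<delta>) *\<^sub>R ?e i" and xj: "x j = (1/\<kappa>) *\<^sub>R w"
    using ij by (simp_all add: x_def)
  have "x i \<bullet> (\<Omega> *v x i) = 1"
    using \<delta>(1) by (simp add: xi matrix_vector_mult_scaleR ee \<delta>(3)[symmetric])
  moreover have "x j \<bullet> (\<Omega> *v x j) = 1"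
    using \<kappa>(1) by (simp add: xj matrix_vector_mult_scaleR \<kappa>(3)[symmetric])
  moreover have "x i \<bullet> (\<Omega> *v x j) = 0" "x j \<bullet> (\<Omega> *v x i) = 0"
    by (simp_all add: xi xj matrix_vector_mult_scaleR wi)
  ultimately have xx: "x k \<bullet> (\<Omega> *v x l) = of_bool (k = l)" if "k \<in> {i, j}" "l \<in> {i, j}" for k l
    using that ij by auto
  have "\<exists>y. (\<forall>k\<in>{i, j}. y k = x k) \<and> (\<forall>k l. y k \<bullet> (\<Omega> *v y l) = of_bool (k = l))"
  proof (rule orthonormal_wrt_extend[OF \<Omega>, of "{i, j}" x, OF xx])
    fix y assume "\<And>k. k \<in> {i, j} \<Longrightarrow> y k = x k" "\<And>k l. y k \<bullet> (\<Omega> *v y l) = of_bool (k = l)"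
    then show ?thesis by (intro exI[of _ y]) simp
  qed
  then obtain y where y: "\<And>k. k \<in> {i, j} \<Longrightarrow> y k = x k" "\<And>k l. y k \<bullet> (\<Omega> *v y l) = of_bool (k = l)"
    by auto
  let ?C = "matrix_of_columns y"
  have yi: "?e i = \<delta> *\<^sub>R y i" using y(1)[of i] \<delta> by (simp add: x_def)
  have yj: "?e j = \<kappa> *\<^sub>R y j + (\<Omega> $ i $ j / \<delta>) *\<^sub>R y i"
  proof -
    have "\<kappa> *\<^sub>R y j = w" using y(1)[of j] ij \<kappa> by (simp add: x_def)
    moreover have "(\<Omega> $ i $ j / \<delta>) *\<^sub>R y i = b *\<^sub>R ?e i"
      using y(1)[of i] \<delta>(1) by (simp add: x_def b_def \<delta>(3)[symmetric])
    ultimately show ?thesis by (simp add: w_def)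
  qed
  have CO: "((transpose ?C ** \<Omega>) *v v) $ k = y k \<bullet> (\<Omega> *v v)" for v k
  proof -
    have "((transpose ?C ** \<Omega>) *v v) $ k = (transpose ?C *v (\<Omega> *v v)) $ k"
      by (simp add: matrix_vector_mul_assoc del: transpose_matrix_vector)
    then show ?thesis
      by (simp add: matrix_vector_mult_def transpose_def matrix_of_columns_def inner_vec_def del: transpose_matrix_vector)
  qed
  show thesis
  proof (rule that)
    show "transpose ?C ** \<Omega> ** ?C = mat 1"
      unfolding vec_eq_iff matrix_of_columns_congruence y(2) by (simp add: mat_def)
    show "(transpose ?C ** \<Omega>) *v ?e i = \<delta> *\<^sub>R ?e i"
      unfolding vec_eq_iff CO
    proof
      fix k
      have "y k \<bullet> (\<Omega> *v ?e i) = \<delta> * of_bool (k = i)"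
        by (subst yi) (simp add: matrix_vector_mult_scaleR y(2))
      then show "y k \<bullet> (\<Omega> *v ?e i) = (\<delta> *\<^sub>R ?e i) $ k" by (simp add: axis_def)
    qed
    show "(transpose ?C ** \<Omega>) *v ?e j = \<kappa> *\<^sub>R ?e j + (\<Omega> $ i $ j / \<delta>) *\<^sub>R ?e i"
      unfolding vec_eq_iff CO
    proof
      fix k
      have "y k \<bullet> (\<Omega> *v ?e j) = \<kappa> * of_bool (k = j) + \<Omega> $ i $ j / \<delta> * of_bool (k = i)"
        by (subst yj) (simp add: matrix_vector_right_distrib matrix_vector_mult_scaleR inner_add_right y(2))
      then show "y k \<bullet> (\<Omega> *v ?e j) = (\<kappa> *\<^sub>R ?e j + (\<Omega> $ i $ j / \<delta>) *\<^sub>R ?e i) $ k" by (simp add: axis_def)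
    qed
  qed (use \<delta> \<kappa> ww jj in auto)
qed

lemma squared_correlation_odds:
  fixes a b c :: real
  assumes d: "a * b - c\<^sup>2 > 0"
  shows "(c / sqrt (a * b))\<^sup>2 / (1 - (c / sqrt (a * b))\<^sup>2) = c\<^sup>2 / (a * b - c\<^sup>2)"
proof -
  define P where "P = a * b"
  have P: "P > 0" using d zero_le_power2[of c] unfolding P_def by linarith
  then have "(c / sqrt P)\<^sup>2 = c\<^sup>2 / P" by (simp add: power_divide)
  moreover have "1 - c\<^sup>2 / P = (P - c\<^sup>2) / P" using P by (simp add: diff_divide_distrib)
  ultimately show ?thesis using P unfolding P_def[symmetric] by simp
qed

text \<open>
  The multiple \<open>c * g\<^sup>2 / (1 - g\<^sup>2)\<close> of the odds of the squared correlation \<open>g\<close> formed from the entries \<open>i\<close>, \<open>j\<close> of the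
  inverse of \<open>A\<close>.
\<close>

definition inverse_correlation_statistic :: "real \<Rightarrow> 'n \<Rightarrow> 'n \<Rightarrow> real^'n^'n \<Rightarrow> real" where
  "inverse_correlation_statistic c i j A =
     (let V = matrix_inv A; g = V $ i $ j / sqrt (V $ i $ i * V $ j $ j) in c * (g\<^sup>2 / (1 - g\<^sup>2)))"

text \<open>
  With \<open>D = transpose C ** \<Omega>\<close>, the inverse of \<open>C ** G ** transpose C\<close> is \<open>transpose D ** U ** D\<close>, and only the columns
  \<open>i\<close> and \<open>j\<close> of \<open>D\<close> enter its entries at \<open>i\<close> and \<open>j\<close>.
\<close>

lemma inverse_correlation_statistic_congruence:
  fixes G U \<Omega> C :: "real^'n^'n"
  assumes C: "transpose C ** \<Omega> ** C = mat 1"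
    and Di: "(transpose C ** \<Omega>) *v axis i 1 = \<delta> *\<^sub>R axis i 1"
    and Dj: "(transpose C ** \<Omega>) *v axis j 1 = \<kappa> *\<^sub>R axis j 1 + \<mu> *\<^sub>R axis i 1"
    and pos: "\<delta> > 0" "\<kappa> > 0"
    and G: "invertible G"
  defines "U \<equiv> matrix_inv G"
  assumes U: "U $ i $ i > 0" "U $ i $ i * U $ j $ j - U $ i $ j * U $ i $ j > 0" "U $ j $ i = U $ i $ j"
  shows "inverse_correlation_statistic c i j (C ** G ** transpose C)
     = c * (((\<mu> / \<kappa>) * U $ i $ i + U $ i $ j)\<^sup>2 / (U $ i $ i * U $ j $ j - U $ i $ j * U $ i $ j))"
proof -
  define D where "D = transpose C ** \<Omega>"
  have DC: "D ** C = mat 1" using C by (simp add: D_def)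
  then have CD: "C ** D = mat 1" by (simp add: matrix_left_right_inverse)
  have CtDt: "transpose C ** transpose D = mat 1"
    using arg_cong[OF DC, of transpose] by (simp add: matrix_transpose_mul transpose_mat)
  define V where "V = matrix_inv (C ** G ** transpose C)"
  have V: "V = transpose D ** U ** D"
    unfolding V_def
  proof (rule matrix_inv_eqI)
    have "C ** G ** transpose C ** (transpose D ** U ** D) = C ** G ** (transpose C ** transpose D) ** U ** D"
      by (simp add: matrix_mul_assoc)
    also have "\<dots> = C ** (G ** U) ** D" by (simp add: CtDt matrix_mul_assoc)
    also have "\<dots> = mat 1" using matrix_inv_mult(1)[OF G] CD by (simp add: U_def)
    finally show "C ** G ** transpose C ** (transpose D ** U ** D) = mat 1" .
  qed
  have Ve: "V $ a $ b = (D *v axis a 1) \<bullet> (U *v (D *v axis b 1))" for a b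
  proof -
    have "V $ a $ b = axis a 1 \<bullet> (transpose D *v (U *v (D *v axis b 1)))"
      unfolding V inner_mult_axis[symmetric] by (simp add: matrix_vector_mul_assoc matrix_mul_assoc del: transpose_matrix_vector)
    then show ?thesis by (simp only: matrix_vector_mult_inner_left)
  qed
  have ee: "axis a 1 \<bullet> (U *v axis b 1) = U $ a $ b" for a b by (rule inner_mult_axis)
  note s = matrix_vector_right_distrib matrix_vector_mult_scaleR inner_add_right inner_add_left ee U(3)
  have Vii: "V $ i $ i = \<delta>\<^sup>2 * U $ i $ i"
    unfolding Ve Di[folded D_def] by (simp add: s power2_eq_square)
  have Vij: "V $ i $ j = \<delta> * (\<kappa> * U $ i $ j + \<mu> * U $ i $ i)"
    unfolding Ve Di[folded D_def] Dj[folded D_def] by (simp add: s algebra_simps)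
  have Vjj: "V $ j $ j = \<kappa>\<^sup>2 * U $ j $ j + 2 * \<kappa> * \<mu> * U $ i $ j + \<mu>\<^sup>2 * U $ i $ i"
    unfolding Ve Dj[folded D_def] by (simp add: s algebra_simps power2_eq_square)
  define \<Delta> where "\<Delta> = U $ i $ i * U $ j $ j - U $ i $ j * U $ i $ j"
  have \<Delta>: "\<Delta> > 0" using U(2) by (simp add: \<Delta>_def)
  have det: "V $ i $ i * V $ j $ j - (V $ i $ j)\<^sup>2 = (\<delta> * \<kappa>)\<^sup>2 * \<Delta>"
    unfolding Vii Vij Vjj \<Delta>_def by (simp add: algebra_simps power2_eq_square)
  have Vij2: "(V $ i $ j)\<^sup>2 = (\<delta> * \<kappa>)\<^sup>2 * ((\<mu> / \<kappa>) * U $ i $ i + U $ i $ j)\<^sup>2"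
  proof -
    have "V $ i $ j = (\<delta> * \<kappa>) * ((\<mu> / \<kappa>) * U $ i $ i + U $ i $ j)"
      unfolding Vij using pos by (simp add: field_simps)
    then show ?thesis by (simp only: power_mult_distrib)
  qed
  have "inverse_correlation_statistic c i j (C ** G ** transpose C)
      = c * ((V $ i $ j / sqrt (V $ i $ i * V $ j $ j))\<^sup>2 / (1 - (V $ i $ j / sqrt (V $ i $ i * V $ j $ j))\<^sup>2))"
    by (simp add: inverse_correlation_statistic_def Let_def V_def)
  also have "(V $ i $ j / sqrt (V $ i $ i * V $ j $ j))\<^sup>2 / (1 - (V $ i $ j / sqrt (V $ i $ i * V $ j $ j))\<^sup>2)
      = (V $ i $ j)\<^sup>2 / (V $ i $ i * V $ j $ j - (V $ i $ j)\<^sup>2)"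
    using pos \<Delta> by (intro squared_correlation_odds) (simp add: det)
  also have "\<dots> = ((\<mu> / \<kappa>) * U $ i $ i + U $ i $ j)\<^sup>2 / \<Delta>"
    unfolding det unfolding Vij2 using pos by simp
  finally show ?thesis by (simp only: \<Delta>_def)
qed

lemma inverse_gram_minor_pos:
  fixes z :: "'n::finite \<Rightarrow> 'v::real_inner"
  assumes z: "lin_indep_family UNIV z" and ij: "i \<noteq> j"
  defines "U \<equiv> matrix_inv (gram z)"
  shows "U $ i $ i > 0 \<and> U $ i $ i * U $ j $ j - U $ i $ j * U $ i $ j > 0 \<and> U $ j $ i = U $ i $ j"
proof -
  let ?G = "gram z" and ?e = "\<lambda>k. axis k 1 :: real^'n"
  note inv = matrix_inv_mult[OF invertible_gram[OF z], folded U_def]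
  have tG: "transpose ?G = ?G" by (simp add: transpose_def gram_def inner_commute)
  have "transpose U ** ?G = mat 1"
    using arg_cong[OF inv(1), of transpose] by (simp add: matrix_transpose_mul tG transpose_mat)
  then have "?G ** transpose U = mat 1" by (simp add: matrix_left_right_inverse)
  then have tU: "transpose U = U" using matrix_inv_eqI[of ?G "transpose U"] by (simp add: U_def)
  have Gpos: "v \<bullet> (?G *v v) > 0" if "v \<noteq> 0" for v
  proof -
    let ?s = "\<Sum>b\<in>UNIV. v $ b *\<^sub>R z b"
    have "v \<bullet> (?G *v v) = ?s \<bullet> ?s"
      by (simp add: inner_vec_def gram_mult_vec inner_sum_left)
    moreover have "?s \<noteq> 0"
      using z that unfolding lin_indep_family_def by (metis (mono_tags) UNIV_I vec_eq_iff zero_index)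
    ultimately show ?thesis by simp
  qed
  have pos: "v \<bullet> (U *v v) > 0" if "v \<noteq> 0" for v
  proof -
    have "?G *v (U *v v) = v" by (simp add: matrix_vector_mul_assoc inv)
    moreover from this that have "U *v v \<noteq> 0" by auto
    ultimately show ?thesis using Gpos[of "U *v v"] by (simp add: inner_commute)
  qed
  have ee: "?e a \<bullet> (U *v ?e b) = U $ a $ b" for a b by (rule inner_mult_axis)
  have ii: "U $ i $ i > 0" using pos[of "?e i"] by (simp add: ee axis_eq_0_iff)
  have ji: "U $ j $ i = U $ i $ j" by (metis tU transpose_def vec_lambda_beta)
  define w where "w = U $ i $ i *\<^sub>R ?e j - U $ i $ j *\<^sub>R ?e i"
  have "w $ j = U $ i $ i" using ij by (simp add: w_def axis_def)
  then have "w \<noteq> 0" using ii by auto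
  have "w \<bullet> (U *v w) = U $ i $ i * (U $ i $ i * U $ j $ j - U $ i $ j * U $ i $ j)"
    by (simp add: w_def matrix_vector_mult_diff_distrib matrix_vector_mult_scaleR inner_diff_right inner_diff_left ee ji algebra_simps)
  then have "U $ i $ i * U $ j $ j - U $ i $ j * U $ i $ j > 0"
    using pos[OF \<open>w \<noteq> 0\<close>] ii by (simp add: zero_less_mult_iff)
  with ii ji show ?thesis by blast
qed

lemma borel_measurable_inverse_correlation_statistic:
  fixes A :: "'a \<Rightarrow> real^'n^'n"
  assumes "\<And>a b. (\<lambda>w. A w $ a $ b) \<in> borel_measurable M"
  shows "(\<lambda>w. inverse_correlation_statistic c i j (A w)) \<in> borel_measurable M"
proof -
  have [measurable]: "(\<lambda>w. matrix_inv (A w) $ a $ b) \<in> borel_measurable M" for a b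
    using assms by (rule borel_measurable_matrix_inv_entry)
  show ?thesis unfolding inverse_correlation_statistic_def Let_def by measurable
qed

lemma borel_measurable_gram_congruence:
  fixes C :: "real^'n::finite^'n"
  shows "(\<lambda>x. (C ** gram x ** transpose C) $ a $ b) \<in> borel_measurable (PiM UNIV (\<lambda>_::'n. borel :: (real^'t) measure))"
proof -
  have [measurable]: "(\<lambda>x. gram x $ a $ b) \<in> borel_measurable (PiM UNIV (\<lambda>_::'n. borel :: (real^'t) measure))" for a b
    unfolding gram_def by (simp add: borel_measurable_inner)
  show ?thesis unfolding matrix_matrix_mult_def by simp
qed

text \<open>
  The density of the statistic with \<open>c\<close> denominator degrees of freedom and noncentrality \<open>l\<close>: the density of the \<open>F\<close>-law
  with \<open>1\<close> and \<open>c\<close> degrees of freedom times a hypergeometric factor.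
\<close>

definition correlation_odds_density :: "real \<Rightarrow> real \<Rightarrow> real \<Rightarrow> real" where
  "correlation_odds_density c l x =
     (if x > 0
      then F_density 1 c x * (1 + l) powr (- (c + 1) / 2)
         * hypergeom_2F1 ((c + 1) / 2) ((c + 1) / 2) (1 / 2) (x / (c + x) * (l / (1 + l)))
      else 0)"

lemma borel_measurable_correlation_odds_density [measurable]:
  "correlation_odds_density c l \<in> borel_measurable borel"
  unfolding correlation_odds_density_def F_density_def hypergeom_2F1_def by measurable

lemma borel_measurable_noncentral_ratio_density [measurable]:
  "noncentral_ratio_density a b l \<in> borel_measurable borel"
  unfolding noncentral_ratio_density_def by measurable

text \<open>
  The rows \<open>R w\<close> are independent standard Gaussian vectors, and \<open>C ** gram (R w) ** transpose C\<close> is the Gram matrix of the rows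
  transformed by \<open>C\<close>.
\<close>

lemma distributed_inverse_correlation_statistic:
  fixes R :: "'a \<Rightarrow> 'n::finite \<Rightarrow> real^'t::finite" and \<Omega> C :: "real^'n^'n"
  assumes M: "prob_space M"
    and Rm: "R \<in> measurable M (PiM UNIV (\<lambda>_. borel))"
    and law: "distr M (PiM UNIV (\<lambda>_. borel)) R = PiM UNIV (\<lambda>_. std_gaussian)"
    and ij: "i \<noteq> j" and n: "CARD('n) < CARD('t)" and c: "c = real CARD('t) - real CARD('n) + 1"
    and C: "transpose C ** \<Omega> ** C = mat 1"
    and Di: "(transpose C ** \<Omega>) *v axis i 1 = \<delta> *\<^sub>R axis i 1"
    and Dj: "(transpose C ** \<Omega>) *v axis j 1 = \<kappa> *\<^sub>R axis j 1 + \<mu> *\<^sub>R axis i 1"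
    and pos: "\<delta> > 0" "\<kappa> > 0" and l: "l = (\<mu> / \<kappa>)\<^sup>2"
    and X: "\<And>w. X w = inverse_correlation_statistic c i j (C ** gram (R w) ** transpose C)"
  shows "distributed M lborel X (\<lambda>x. ennreal (correlation_odds_density c l x))"
proof -
  define Tf where "Tf x = inverse_correlation_statistic c i j (C ** gram x ** transpose C)" for x :: "'n \<Rightarrow> real^'t"
  have Tfm: "Tf \<in> borel_measurable (PiM UNIV (\<lambda>_. borel))"
    unfolding Tf_def by (intro borel_measurable_inverse_correlation_statistic borel_measurable_gram_congruence)
  have XT: "X = (\<lambda>w. Tf (R w))" by (simp add: X Tf_def fun_eq_iff)
  have Xm: "X \<in> borel_measurable M" unfolding XT by (rule measurable_compose[OF Rm Tfm])
  have c0: "c > 0" using n by (simp add: c)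
  have a: "real (CARD('t) - CARD('n) + 2) / 2 = (c + 1) / 2" "real (CARD('t) - CARD('n) + 1) / 2 = c / 2"
    using n by (simp_all add: c of_nat_diff)
  let ?nd = "noncentral_ratio_density ((c + 1) / 2) (c / 2) l"
  have law_h: "(\<integral>\<^sup>+w. h (X w) \<partial>M) = (\<integral>\<^sup>+y. h (c * y) * ?nd y \<partial>lborel)"
    if h[measurable]: "h \<in> borel_measurable borel" for h :: "real \<Rightarrow> ennreal"
  proof -
    have hT: "(\<lambda>x. h (Tf x)) \<in> borel_measurable (PiM UNIV (\<lambda>_. borel))"
      by (rule measurable_compose[OF Tfm h])
    have "(\<integral>\<^sup>+w. h (X w) \<partial>M) = (\<integral>\<^sup>+x. h (Tf x) \<partial>distr M (PiM UNIV (\<lambda>_. borel)) R)"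
      unfolding XT using hT by (subst nn_integral_distr[OF Rm]) auto
    also have "\<dots> = (\<integral>\<^sup>+x. h (Tf x) \<partial>PiM UNIV (\<lambda>_. std_gaussian))" by (simp only: law)
    also have "\<dots> = (\<integral>\<^sup>+y. h (c * y) * noncentral_ratio_density (real (CARD('t) - CARD('n) + 2) / 2)
          (real (CARD('t) - CARD('n) + 1) / 2) ((\<mu> / \<kappa>)\<^sup>2) y \<partial>lborel)"
    proof (rule nn_integral_gram_inverse_ratio[OF ij n _ hT])
      show "(\<lambda>y. h (c * y)) \<in> borel_measurable borel" by measurable
      fix z :: "'n \<Rightarrow> real^'t"
      assume z: "lin_indep_family UNIV z"
      have UiiUjj: "matrix_inv (gram z) $ i $ i > 0"
        "matrix_inv (gram z) $ i $ i * matrix_inv (gram z) $ j $ j - matrix_inv (gram z) $ i $ j * matrix_inv (gram z) $ i $ j > 0"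
        "matrix_inv (gram z) $ j $ i = matrix_inv (gram z) $ i $ j"
        using inverse_gram_minor_pos[OF z ij] by auto
      show "h (Tf z) = h (c * ((\<mu> / \<kappa> * matrix_inv (gram z) $ i $ i + matrix_inv (gram z) $ i $ j)\<^sup>2 /
          (matrix_inv (gram z) $ i $ i * matrix_inv (gram z) $ j $ j - matrix_inv (gram z) $ i $ j * matrix_inv (gram z) $ i $ j)))"
        unfolding Tf_def
        by (subst inverse_correlation_statistic_congruence[OF C Di Dj pos invertible_gram[OF z] UiiUjj]) simp
    qed
    finally show ?thesis unfolding a l .
  qed
  have "1 = (\<integral>\<^sup>+y. ?nd y \<partial>lborel)"
    using law_h[of "\<lambda>_. 1"] prob_space.emeasure_space_1[OF M] by simp
  also have "\<dots> = ennreal \<bar>1 / c\<bar> * (\<integral>\<^sup>+x. ?nd (0 + 1 / c * x) \<partial>lborel)"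
    using c0 by (intro nn_integral_real_affine) auto
  finally have "(\<integral>\<^sup>+x. ?nd (0 + 1 / c * x) \<partial>lborel) \<noteq> \<infinity>"
    using c0 by (auto simp: ennreal_mult_top)
  then have fin: "AE x in lborel. ?nd (0 + 1 / c * x) \<noteq> \<infinity>"
    by (intro nn_integral_PInf_AE) auto
  have zero: "?nd y = 0" if "y \<le> 0" for y
    using that by (simp add: noncentral_ratio_density_def beta_prime_density_def)
  have "distr M lborel X = density lborel (\<lambda>x. ennreal (correlation_odds_density c l x))"
  proof (rule measure_eqI)
    fix E assume "E \<in> sets (distr M lborel X)"
    then have E[measurable]: "E \<in> sets borel" by simp
    have "emeasure (distr M lborel X) E = (\<integral>\<^sup>+x. indicator E x \<partial>distr M lborel X)" by simp
    also have "\<dots> = (\<integral>\<^sup>+w. indicator E (X w) \<partial>M)"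
      using Xm by (subst nn_integral_distr) auto
    also have "\<dots> = (\<integral>\<^sup>+y. indicator E (c * y) * ?nd y \<partial>lborel)"
      by (rule law_h) measurable
    also have "\<dots> = ennreal \<bar>1 / c\<bar> * (\<integral>\<^sup>+x. indicator E (c * (0 + 1 / c * x)) * ?nd (0 + 1 / c * x) \<partial>lborel)"
      using c0 by (intro nn_integral_real_affine) auto
    also have "\<dots> = (\<integral>\<^sup>+x. ennreal (1 / c) * (indicator E x * ?nd (0 + 1 / c * x)) \<partial>lborel)"
      using c0 by (subst nn_integral_cmult) auto
    also have "\<dots> = (\<integral>\<^sup>+x. ennreal (correlation_odds_density c l x) * indicator E x \<partial>lborel)"
    proof (rule nn_integral_cong_AE, use fin in eventually_elim)
      fix x assume f: "?nd (0 + 1 / c * x) \<noteq> \<infinity>"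
      show "ennreal (1 / c) * (indicator E x * ?nd (0 + 1 / c * x)) = ennreal (correlation_odds_density c l x) * indicator E x"
      proof (cases "x > 0")
        case True
        have "ennreal (1 / c) * ?nd (x / c) = ennreal (correlation_odds_density c l x)"
          using noncentral_ratio_density_eq[OF c0 _ True, of l] f True l
          by (simp add: correlation_odds_density_def)
        then show ?thesis by (simp add: mult.left_commute mult.commute)
      next
        case False
        then show ?thesis using zero[of "1 / c * x"] c0
          by (simp add: correlation_odds_density_def divide_nonpos_pos)
      qed
    qed
    also have "\<dots> = emeasure (density lborel (\<lambda>x. ennreal (correlation_odds_density c l x))) E"
      by (subst emeasure_density) auto
    finally show "emeasure (distr M lborel X) E = emeasure (density lborel (\<lambda>x. ennreal (correlation_odds_density c l x))) E" .
  qed simp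
  then show ?thesis using Xm by (simp add: distributed_def)
qed

section \<open>The factor model\<close>

text \<open>
  The matrix with diagonal blocks \<open>A\<close>, \<open>D\<close> and upper right block \<open>B\<close>, acting on stacked vectors.
\<close>

definition block_upper_triangular :: "real^'p^'p \<Rightarrow> real^'k^'p \<Rightarrow> real^'k^'k \<Rightarrow> real^('p + 'k)^('p + 'k)" where
  "block_upper_triangular A B D =
     (\<chi> r s. case r of
        Inl a \<Rightarrow> (case s of Inl b \<Rightarrow> A $ a $ b | Inr l \<Rightarrow> B $ a $ l)
      | Inr k \<Rightarrow> (case s of Inl b \<Rightarrow> 0 | Inr l \<Rightarrow> D $ k $ l))"

lemma sum_UNIV_sum_type:
  fixes h :: "'p::finite + 'k::finite \<Rightarrow> 'c::comm_monoid_add"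
  shows "(\<Sum>s\<in>UNIV. h s) = (\<Sum>a\<in>UNIV. h (Inl a)) + (\<Sum>k\<in>UNIV. h (Inr k))"
  by (subst UNIV_Plus_UNIV[symmetric], subst sum.Plus) simp_all

lemma block_upper_triangular_mult_stack:
  "block_upper_triangular A B D *v stack x y = stack (A *v x + B *v y) (D *v y)"
  by (simp add: vec_eq_iff split_sum_all block_upper_triangular_def stack_def matrix_vector_mult_def sum_UNIV_sum_type)

lemma invertible_block_upper_triangular:
  fixes A A' :: "real^'p::finite^'p" and D D' :: "real^'k::finite^'k"
  assumes "A ** A' = mat 1" "D ** D' = mat 1"
  shows "invertible (block_upper_triangular A B D)"
proof -
  have A: "A' ** A = mat 1" and D: "D' ** D = mat 1"
    using assms by (simp_all add: matrix_left_right_inverse)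
  have "z = 0" if z: "block_upper_triangular A B D *v z = 0" for z
  proof -
    define x y where "x = (\<chi> a. z $ Inl a)" and "y = (\<chi> k. z $ Inr k)"
    have zxy: "z = stack x y" by (simp add: vec_eq_iff split_sum_all stack_def x_def y_def)
    have s: "stack (A *v x + B *v y) (D *v y) = 0"
      using z by (simp add: zxy block_upper_triangular_mult_stack)
    have "D *v y = 0"
      using arg_cong[OF s, of "\<lambda>v. \<chi> k. v $ Inr k"] by (simp add: stack_def vec_eq_iff)
    then have "D' *v (D *v y) = 0" by simp
    then have y: "y = 0" by (simp add: matrix_vector_mul_assoc D)
    have "A *v x = 0"
      using arg_cong[OF s, of "\<lambda>v. \<chi> a. v $ Inl a"] y by (simp add: stack_def vec_eq_iff)
    then have "A' *v (A *v x) = 0" by simp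
    then have "x = 0" by (simp add: matrix_vector_mul_assoc A)
    with y zxy show ?thesis by (simp add: vec_eq_iff split_sum_all stack_def)
  qed
  then show ?thesis
    using matrix_left_invertible_ker[of "block_upper_triangular A B D"] invertible_left_inverse by blast
qed

lemma pos_def_matrix_inv_gram:
  fixes C :: "real^'n^'n"
  assumes C: "invertible C"
  shows "pos_def_matrix (matrix_inv (C ** transpose C))" "matrix_inv (C ** transpose C) ** (C ** transpose C) = mat 1"
proof -
  let ?H = "matrix_inv C"
  note H = matrix_inv_mult[OF C]
  have tH: "transpose C ** transpose ?H = mat 1"
    using arg_cong[OF H(2), of transpose] by (simp add: matrix_transpose_mul transpose_mat)
  have "C ** transpose C ** (transpose ?H ** ?H) = C ** (transpose C ** transpose ?H) ** ?H"
    by (simp add: matrix_mul_assoc)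
  also have "\<dots> = mat 1" by (simp add: tH H)
  finally have r: "C ** transpose C ** (transpose ?H ** ?H) = mat 1" .
  then have eq: "matrix_inv (C ** transpose C) = transpose ?H ** ?H" by (rule matrix_inv_eqI)
  show "matrix_inv (C ** transpose C) ** (C ** transpose C) = mat 1"
    unfolding eq using r by (simp add: matrix_left_right_inverse)
  show "pos_def_matrix (matrix_inv (C ** transpose C))"
    unfolding eq pos_def_matrix_def
  proof (intro conjI allI impI)
    show "transpose (transpose ?H ** ?H) = transpose ?H ** ?H"
      by (simp add: matrix_transpose_mul)
    fix x :: "real^'n" assume x: "x \<noteq> 0"
    have "C *v (?H *v x) = x" by (simp add: matrix_vector_mul_assoc H)
    with x have "?H *v x \<noteq> 0" by auto
    then have "0 < (?H *v x) \<bullet> (?H *v x)" by simp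
    also have "\<dots> = x \<bullet> ((transpose ?H ** ?H) *v x)"
      by (simp add: matrix_vector_mult_inner_left matrix_vector_mul_assoc del: transpose_matrix_vector)
    finally show "0 < x \<bullet> ((transpose ?H ** ?H) *v x)" .
  qed
qed

theorem theorem1:
  fixes M :: "'a measure"
    and p K T :: nat
    and B :: "real^'k::finite^'p::{finite,linorder}"
    and \<Sigma>f :: "real^'k^'k"
    and \<Sigma>u :: "real^'p::{finite,linorder}^'p::{finite,linorder}"
    and f :: "'t::finite \<Rightarrow> 'a \<Rightarrow> real^'k"
    and u X :: "'t \<Rightarrow> 'a \<Rightarrow> real^'p::{finite,linorder}"
    and Y :: "'t \<Rightarrow> 'a \<Rightarrow> real^('p + 'k)"
    and \<Omega> :: "real^('p + 'k)^('p + 'k)"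
    and S V :: "'a \<Rightarrow> real^('p + 'k)^('p + 'k)"
    and Ymat :: "'a \<Rightarrow> real^'t^('p + 'k)"
    and t\<^sub>0 :: 't
    and i j :: 'p
    and d lam :: real
    and g Tij :: "'a \<Rightarrow> real"
  assumes p: "p = CARD('p)" "p \<ge> 2"
    and K: "K = CARD('k)" "K \<ge> 1"
    and T: "T = CARD('t)" "p + K < T"
    and M: "prob_space M"
    and f_normal: "\<And>t. normal_vector M 0 \<Sigma>f (f t)"
    and f_indep: "prob_space.indep_vars M (\<lambda>_. borel) f UNIV"
    and u_normal: "\<And>t. normal_vector M 0 \<Sigma>u (u t)"
    and u_indep: "prob_space.indep_vars M (\<lambda>_. borel) u UNIV"
    and fu_indep: "prob_space.indep_set M
        (sets (vimage_algebra (space M) (\<lambda>w t. f t w) (Pi\<^sub>M UNIV (\<lambda>_. borel))))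
        (sets (vimage_algebra (space M) (\<lambda>w t. u t w) (Pi\<^sub>M UNIV (\<lambda>_. borel))))"
    and X: "\<And>t w. X t w = B *v f t w + u t w"
    and Y: "\<And>t w. Y t w = stack (X t w) (f t w)"
    and \<Omega>: "\<Omega> = matrix_inv (cov_matrix M (Y t\<^sub>0))"
    and Ymat: "\<And>w. Ymat w = matrix_of_columns (\<lambda>t. Y t w)"
    and S: "\<And>w. S w = (1 / real T) *\<^sub>R (Ymat w ** transpose (Ymat w))"
    and V: "\<And>w. V w = matrix_inv (real T *\<^sub>R S w)"
    and ij: "j < i"
    and d: "d = \<Omega> $ Inl i $ Inl j"
    and g: "\<And>w. g w = V w $ Inl i $ Inl j / sqrt (V w $ Inl i $ Inl i * V w $ Inl j $ Inl j)"
    and Tij: "\<And>w. Tij w = (real T - real K - real p + 1) * ((g w)\<^sup>2 / (1 - (g w)\<^sup>2))"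
    and lam: "lam = d\<^sup>2 / (\<Omega> $ Inl j $ Inl j * (\<Omega> $ Inl i $ Inl i - d\<^sup>2 / \<Omega> $ Inl j $ Inl j))"
  shows "distributed M lborel Tij (\<lambda>x. ennreal
           (if x > 0
            then F_density 1 (real T - real K - real p + 1) x
              * (1 + lam) powr (- (real T - real K - real p + 2) / 2)
              * hypergeom_2F1 ((real T - real K - real p + 2) / 2)
                  ((real T - real K - real p + 2) / 2) (1 / 2)
                  (x / (real T - real K - real p + 1 + x) * (lam / (1 + lam)))
            else 0))
       \<and> (\<Omega> $ Inl i $ Inl j = 0 \<longrightarrow>
            Tij \<in> borel_measurable M
            \<and> distr M borel Tij = F_distribution 1 (real T - real K - real p + 1))"
proof -
  interpret prob_space M by (rule M)
  let ?n = "CARD('p + 'k)"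
  have n: "?n = p + K" by (simp add: p K card_sum)
  define c where "c = real T - real K - real p + 1"
  have c_n: "c = real CARD('t) - real ?n + 1" by (simp add: c_def T(1) p(1) K(1))
  have c1: "real T - real K - real p + 2 = c + 1" by (simp add: c_def)
  obtain Wf :: "real^'k^'k" where Wf: "transpose Wf ** \<Sigma>f ** Wf = mat 1"
    by (rule pos_def_whitening[OF f_normal[unfolded normal_vector_def, THEN conjunct1]])
  obtain Wu :: "real^'p::{finite,linorder}^'p::{finite,linorder}" where Wu: "transpose Wu ** \<Sigma>u ** Wu = mat 1"
    by (rule pos_def_whitening[OF u_normal[unfolded normal_vector_def, THEN conjunct1]])
  define Lf where "Lf = \<Sigma>f ** Wf"
  define Lu where "Lu = \<Sigma>u ** Wu"
  have Lf: "Lf ** transpose Wf = mat 1" and Lu: "Lu ** transpose Wu = mat 1"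
    using pos_def_whitening_inverse(2)[OF Wf] pos_def_whitening_inverse(2)[OF Wu] by (simp_all add: Lf_def Lu_def)
  \<comment> \<open>The whitened data, and the block matrix that recovers \<open>Y\<close> from them.\<close>
  define Z0 where "Z0 t w = stack (transpose Wu *v u t w) (transpose Wf *v f t w)" for t w
  define C0 where "C0 = block_upper_triangular Lu (B ** Lf) Lf"
  have invC0: "invertible C0"
    unfolding C0_def using Lu Lf by (rule invertible_block_upper_triangular)
  have Y0: "Y t w = C0 *v Z0 t w" for t w
  proof -
    have "Lf *v (transpose Wf *v f t w) = f t w" "Lu *v (transpose Wu *v u t w) = u t w"
      using Lf Lu by (simp_all add: matrix_vector_mul_assoc del: transpose_matrix_vector)
    then have "C0 *v Z0 t w = stack (u t w + B *v f t w) (f t w)"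
      unfolding C0_def Z0_def block_upper_triangular_mult_stack
      by (simp add: matrix_vector_mul_assoc[symmetric] del: transpose_matrix_vector)
    then show ?thesis by (simp add: Y X add.commute)
  qed
  have fm: "f t \<in> borel_measurable M" and um: "u t \<in> borel_measurable M" for t
    using f_indep u_indep by (auto simp: indep_vars_def)
  have mlin: "(*v) A \<in> borel_measurable borel" for A :: "real^'x^'y"
    by (auto intro!: borel_measurable_continuous_onI linear_continuous_on linear_conv_bounded_linear[THEN iffD1])
  have Z0_entry: "(\<lambda>w. Z0 t w $ s) \<in> borel_measurable M" for t s
  proof (cases s)
    case (Inl a)
    have "(\<lambda>w. (transpose Wu *v u t w) $ a) \<in> borel_measurable M"
      by (rule measurable_compose[OF measurable_compose[OF um mlin]]) auto
    then show ?thesis by (simp add: Z0_def stack_def Inl del: transpose_matrix_vector)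
  next
    case (Inr k)
    have "(\<lambda>w. (transpose Wf *v f t w) $ k) \<in> borel_measurable M"
      by (rule measurable_compose[OF measurable_compose[OF fm mlin]]) auto
    then show ?thesis by (simp add: Z0_def stack_def Inr del: transpose_matrix_vector)
  qed
  have Z0m: "Z0 t \<in> borel_measurable M" for t
  proof -
    have "(\<lambda>w. \<chi> s. Z0 t w $ s) \<in> borel_measurable M"
      by (rule borel_measurable_vec_lambda) (rule Z0_entry)
    then show ?thesis by simp
  qed
  have entries: "distr M (PiM UNIV (\<lambda>_. borel)) (\<lambda>w (t, s). Z0 t w $ s) = PiM UNIV (\<lambda>_. std_normal)"
    unfolding Z0_def
    by (rule iid_entries_of_independent_blocks[OF M f_indep u_indep fu_indep mlin mlin
          distr_normal_vector_whitening[OF M f_normal Wf] distr_normal_vector_whitening[OF M u_normal Wu]])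
  have law0: "distr M (PiM UNIV (\<lambda>_. borel)) (\<lambda>w t. Z0 t w) = PiM UNIV (\<lambda>_. std_gaussian)"
    using entries by (subst iid_std_gaussian_iff_entries[OF Z0m])
  have "cov_matrix M (Y t\<^sub>0) = C0 ** transpose C0"
  proof (rule cov_matrix_linear_image[OF Z0m])
    have mZ0: "(\<lambda>w t. Z0 t w) \<in> measurable M (PiM UNIV (\<lambda>_. borel))"
      using Z0m by (intro measurable_PiM_single') (auto simp: space_PiM)
    have "distr M borel (Z0 t\<^sub>0) = distr (distr M (PiM UNIV (\<lambda>_. borel)) (\<lambda>w t. Z0 t w)) borel (\<lambda>x. x t\<^sub>0)"
      by (subst distr_distr[OF _ mZ0]) (auto simp: comp_def)
    also have "\<dots> = distr (PiM UNIV (\<lambda>_::'t. std_gaussian)) std_gaussian (\<lambda>x. x t\<^sub>0)"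
      unfolding law0 by (rule distr_cong) auto
    also have "\<dots> = std_gaussian"
      by (rule distr_PiM_component) (auto simp: prob_space_std_gaussian)
    finally show "distr M borel (Z0 t\<^sub>0) = std_gaussian" .
  qed (rule Y0)
  then have \<Omega>_C0: "\<Omega> = matrix_inv (C0 ** transpose C0)" by (simp add: \<Omega>)
  note pdO = pos_def_matrix_inv_gram[OF invC0, folded \<Omega>_C0]
  have ij': "Inl i \<noteq> (Inl j :: 'p + 'k)" using ij by simp
  obtain C :: "real^('p::{finite,linorder} + 'k)^('p::{finite,linorder} + 'k)" and \<delta> \<kappa> :: real where C: "transpose C ** \<Omega> ** C = mat 1" and pos: "\<delta> > 0" "\<kappa> > 0"
    and Di: "(transpose C ** \<Omega>) *v axis (Inl i) 1 = \<delta> *\<^sub>R axis (Inl i) 1"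
    and Dj: "(transpose C ** \<Omega>) *v axis (Inl j) 1 = \<kappa> *\<^sub>R axis (Inl j) 1 + (\<Omega> $ Inl i $ Inl j / \<delta>) *\<^sub>R axis (Inl i) 1"
    and \<delta>: "\<delta>\<^sup>2 = \<Omega> $ Inl i $ Inl i"
    and \<kappa>: "\<kappa>\<^sup>2 = \<Omega> $ Inl j $ Inl j - (\<Omega> $ Inl i $ Inl j)\<^sup>2 / \<Omega> $ Inl i $ Inl i"
    and jj: "\<Omega> $ Inl j $ Inl j > 0"
    by (rule pos_def_triangular_factor[OF pdO(1) ij'])
  have lam': "lam = (\<Omega> $ Inl i $ Inl j / \<delta> / \<kappa>)\<^sup>2"
  proof -
    have "\<Omega> $ Inl i $ Inl i > 0" using \<delta> pos by (metis zero_less_power)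
    then have "\<Omega> $ Inl j $ Inl j * (\<Omega> $ Inl i $ Inl i - d\<^sup>2 / \<Omega> $ Inl j $ Inl j) = \<delta>\<^sup>2 * \<kappa>\<^sup>2"
      unfolding \<delta> \<kappa> d using jj by (simp add: field_simps)
    then show ?thesis unfolding lam d by (simp add: power_divide power_mult_distrib)
  qed
  \<comment> \<open>The matrix \<open>Q\<close> is the product of the inverse of \<open>C\<close> with \<open>C0\<close>; it is orthogonal because \<open>C\<close> and \<open>C0\<close> factor the same covariance.\<close>
  define Q where "Q = transpose C ** \<Omega> ** C0"
  have "Q ** transpose Q = transpose C ** (\<Omega> ** (C0 ** transpose C0)) ** transpose \<Omega> ** C"
    by (simp add: Q_def matrix_transpose_mul matrix_mul_assoc)
  also have "\<dots> = mat 1"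
    using C pdO(1) by (simp add: pdO(2) pos_def_matrix_def)
  finally have Q: "orthogonal_matrix Q"
    by (simp add: orthogonal_matrix matrix_left_right_inverse)
  define Z where "Z t w = Q *v Z0 t w" for t w
  have Zm: "Z t \<in> borel_measurable M" for t
    unfolding Z_def by (rule measurable_compose[OF Z0m mlin])
  have law1: "distr M (PiM UNIV (\<lambda>_. borel)) (\<lambda>w t. Z t w) = PiM UNIV (\<lambda>_. std_gaussian)"
    unfolding Z_def by (rule iid_std_gaussian_orthogonal[OF Q Z0m law0])
  \<comment> \<open>The rows of the transformed data matrix.\<close>
  define R where "R w = (\<lambda>s. (\<chi> t. Z t w $ s) :: real^'t)" for w
  have lawR: "distr M (PiM UNIV (\<lambda>_. borel)) R = PiM UNIV (\<lambda>_. std_gaussian)"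
    unfolding R_def by (rule iid_std_gaussian_transpose[OF Zm law1])
  have Rm: "R \<in> measurable M (PiM UNIV (\<lambda>_. borel))"
  proof -
    have "(\<lambda>w. Z t w $ s) \<in> borel_measurable M" for t s
      by (rule measurable_compose[OF Zm]) auto
    then show ?thesis
      unfolding R_def by (intro measurable_PiM_single' borel_measurable_vec_lambda) (auto simp: space_PiM)
  qed
  have "C ** (transpose C ** \<Omega>) = mat 1" by (rule pos_def_whitening_inverse(3)[OF C])
  then have YZ: "Y t w = C *v Z t w" for t w
    unfolding Z_def Q_def Y0 by (simp add: matrix_vector_mul_assoc matrix_mul_assoc)
  have G: "real T *\<^sub>R S w = C ** gram (R w) ** transpose C" for w
  proof -
    let ?Z = "matrix_of_columns (\<lambda>t. Z t w)"
    have "Ymat w = C ** ?Z"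
      by (simp add: Ymat YZ vec_eq_iff matrix_of_columns_def matrix_matrix_mult_def matrix_vector_mult_def)
    moreover have ZZ: "gram (R w) = ?Z ** transpose ?Z"
      by (simp add: vec_eq_iff gram_def R_def matrix_of_columns_def matrix_matrix_mult_def transpose_def inner_vec_def)
    moreover have "real T *\<^sub>R S w = Ymat w ** transpose (Ymat w)" using T by (simp add: S)
    ultimately show ?thesis unfolding ZZ by (simp add: matrix_transpose_mul matrix_mul_assoc)
  qed
  have stat: "Tij w = inverse_correlation_statistic c (Inl i) (Inl j) (C ** gram (R w) ** transpose C)" for w
    by (simp add: Tij g V G inverse_correlation_statistic_def c_def Let_def)
  have main: "distributed M lborel Tij (\<lambda>x. ennreal (correlation_odds_density c lam x))"
    using n T by (intro distributed_inverse_correlation_statistic[OF M Rm lawR ij' _ c_n C Di Dj pos lam' stat]) simp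
  have null: "Tij \<in> borel_measurable M \<and> distr M borel Tij = F_distribution 1 c" if "\<Omega> $ Inl i $ Inl j = 0"
  proof
    show "Tij \<in> borel_measurable M" using distributed_measurable[OF main] by simp
    have c0: "c > 0" using T by (simp add: c_def)
    have "lam = 0" using that by (simp add: lam d)
    then have "correlation_odds_density c lam x = F_density 1 c x" for x
      using hypergeom_2F1_zero[of "(c + 1) / 2" "(c + 1) / 2" "1 / 2"] c0
      by (simp add: correlation_odds_density_def F_density_def)
    then have "distr M lborel Tij = F_distribution 1 c"
      using distributed_distr_eq_density[OF main] by (simp add: F_distribution_def)
    moreover have "distr M lborel Tij = distr M borel Tij" by (rule distr_cong) auto
    ultimately show "distr M borel Tij = F_distribution 1 c" by simp
  qed
  show ?thesis
    unfolding c1 c_def[symmetric] using main null by (simp add: correlation_odds_density_def)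
qed

end
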